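(* Let $d\in\mathbb{N}$, let $\omega$ be an admissible radial measure on $\mathbb{B}_d$, let $1\le p,q<\infty$, and let $N\ge 0$ be an integer. Let $f\in B^{N}_{\omega}(p,q)$ be a function that extends continuously to $\overline{\mathbb{B}}_d$ and satisfies $f(z)\neq 0$ for all $z\in\mathbb{B}_d$. Then $f$ is cyclic in $B^{N}_{\omega}(p,q)$ if and only if $$\inf\Bigl\{\|1-\varphi f\|_{B^{N}_{\omega}(p,q)}:\varphi\in\operatorname{Mult}(B^{N}_{\omega}(p,q))\Bigr\}=0.$$
   Context: $\mathbb{B}_d$ is the open unit ball of $\mathbb{C}^d$. A measure $\omega$ on $\mathbb{B}_d$ is an admissible radial measure if it has the form $d\omega(z)=d\mu(r)\,d\sigma(w)$, $z=rw$, $0\le r<1$, $w\in\partial\mathbb{B}_d$, where $\sigma$ is the normalized rotation-invariant measure on $\partial\mathbb{B}_d$ and $\mu$ is a Borel measure on $[0,1]$ with $\mu((r,1])>0$ for all $0<r<1$. Let $Rf(z)=\sum_{j=1}^d z_j\frac{\partial f}{\partial z_j}(z)$ be the radial derivative. The mixed norm Besov space $B^N_\omega(p,q)$ consists of all holomorphic functions $f$ on $\mathbb{B}_d$ with finite norm $$\|f\|_{B^{N}_{\omega}(p,q)}=\left(\int_0^1\left(\int_{\partial\mathbb{B}_d}|R^Nf(rw)|^p\,d\sigma(w)\right)^{q/p}d\mu(r)\right)^{1/q}.$$ For a space $X$ of functions on $\mathbb{B}_d$ such as this one, $\operatorname{Mult}(X)=\{\varphi:\varphi h\in X\text{ for all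 }h\in X\}$. For $f\in X$, $[f]=\overline{\{\varphi f:\varphi\in\operatorname{Mult}(X)\}}$, with closure in the norm of $X$; $f$ is cyclic in $X$ if $[f]=X$.
   Formalization: For N ≥ 1 the displayed norm vanishes on constants (φ = 0 would make the infimum 0 for every f), so |f(0)| is added to it; if μ charges r = 1, the inner integral there is read as the supremum over radii below 1. *)

theory Defs
  imports "HOL-Analysis.Analysis"
begin

section \<open>Holomorphic functions of several variables\<close>

(* HOL-Analysis has holomorphy in one variable only.  Functions on a subset of C^d are rendered as
   total functions; their values off the set play no role. *)
definition holomorphic_vec_on :: "(complex^'d::finite \<Rightarrow> complex) \<Rightarrow> (complex^'d) set \<Rightarrow> bool" where
  "holomorphic_vec_on f S \<longleftrightarrow>
     (\<forall>z\<in>S. \<exists>f'. (f has_derivative f') (at z within S) \<and> (\<forall>c v. f' (c *s v) = c * f' v))"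

definition partial_deriv :: "'d::finite \<Rightarrow> (complex^'d \<Rightarrow> complex) \<Rightarrow> complex^'d \<Rightarrow> complex" where
  "partial_deriv j f z = deriv (\<lambda>t. f (z + axis j t)) 0"

definition radial_deriv :: "(complex^'d::finite \<Rightarrow> complex) \<Rightarrow> complex^'d \<Rightarrow> complex" where
  "radial_deriv f z = (\<Sum>j\<in>UNIV. z $ j * partial_deriv j f z)"


section \<open>The normalized rotation-invariant measure on the sphere\<close>

(* The cone measure: the uniform probability measure of the unit ball, pushed to the sphere along
   z |-> z / |z|.  It is a measure on the Borel sets of C^d; the lemmas below show that it is
   carried by the sphere, normalized and rotation invariant. *)
definition sphere_measure :: "(complex^'d::finite) measure" where
  "sphere_measure = distr (uniform_measure lborel (ball 0 1)) borel sgn"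

lemma emeasure_unit_ball_pos_finite:
  fixes B :: "'a::euclidean_space set"
  assumes "B = ball 0 1"
  shows "emeasure lborel B \<noteq> 0" "emeasure lborel B \<noteq> \<infinity>"
proof -
  have "measure lborel B > 0" "emeasure lborel B < \<infinity>"
    using content_ball_pos[of 1 "0::'a"] emeasure_bounded_finite[of B] assms by auto
  then show "emeasure lborel B \<noteq> 0" "emeasure lborel B \<noteq> \<infinity>"
    by (auto simp: measure_def)
qed

lemma measurable_sgn_vec [measurable]: "(sgn :: complex^'d::finite \<Rightarrow> _) \<in> borel_measurable borel"
  unfolding sgn_div_norm[abs_def] by measurable

lemma emeasure_sphere_measure_UNIV:
  "emeasure (sphere_measure :: (complex^'d::finite) measure) UNIV = 1"
proof -
  let ?U = "ball (0 :: complex^'d) 1"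
  have "emeasure lborel ?U / emeasure lborel ?U = 1"
    using emeasure_unit_ball_pos_finite[of ?U] by (simp add: ennreal_divide_self less_top)
  then show ?thesis
    by (simp add: sphere_measure_def emeasure_distr)
qed

lemma AE_sphere_measure: "AE w in (sphere_measure :: (complex^'d::finite) measure). norm w = 1"
proof -
  have "AE z in lborel. z \<noteq> (0 :: complex^'d)"
    by (rule AE_lborel_singleton)
  then have "AE z in uniform_measure lborel (ball (0 :: complex^'d) 1). z \<noteq> 0"
    by (intro AE_uniform_measureI) auto
  then have "AE z in uniform_measure lborel (ball (0 :: complex^'d) 1). norm (sgn z) = 1"
    by eventually_elim (simp add: norm_sgn)
  then show ?thesis
    unfolding sphere_measure_def by (subst AE_distr_iff) auto
qed

(* Uniqueness of translation-invariant measures, specialised to images of Lebesgue measure. *)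
lemma lborel_distr_orthogonal:
  fixes T :: "'a::euclidean_space \<Rightarrow> 'a"
  assumes "orthogonal_transformation T"
  shows "distr lborel borel T = lborel"
proof (rule measure_eqI)
  let ?m = "distr lborel borel T"
  let ?U = "ball (0::'a) 1"
  have lin: "linear T" and bij: "bij T"
    using assms orthogonal_transformation_bij orthogonal_transformation_linear by blast+
  have [measurable]: "T \<in> borel_measurable borel"
    using lin by (intro borel_measurable_continuous_onI linear_continuous_on linear_conv_bounded_linear[THEN iffD1])
  have preU: "T -` ?U = ?U"
    using assms by (auto simp: orthogonal_transformation_norm)
  have mU: "emeasure ?m ?U = emeasure lborel ?U"
    using preU by (simp add: emeasure_distr)
  have transl: "emeasure lborel ((\<lambda>x. x + a) -` B) = emeasure lborel B"
    if [measurable]: "B \<in> sets borel" for a :: 'a and B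
  proof -
    have "(\<lambda>x. x + a) = (+) a" by (auto simp: add.commute)
    then show ?thesis
      using emeasure_distr[of "(+) a" lborel borel B] that by (simp add: lborel_distr_plus)
  qed
  have translm: "emeasure ?m ((\<lambda>y. y + a) -` B) = emeasure ?m B"
    if [measurable]: "B \<in> sets borel" for a B
  proof -
    obtain b where b: "T b = a" using bij by (metis bij_pointE)
    have "T -` ((\<lambda>y. y + a) -` B) = (\<lambda>x. x + b) -` (T -` B)"
      using lin b by (auto simp: linear_add)
    moreover have "(\<lambda>y. y + a) -` B \<in> sets borel"
      using measurable_sets[of "\<lambda>y. y + a" borel borel B] by simp
    moreover have "T -` B \<in> sets borel"
      using measurable_sets[of T borel borel B] by simp
    ultimately show ?thesis by (simp add: emeasure_distr transl)
  qed
  have "sigma_finite_measure ?m"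
  proof -
    have "?m = distr lborel borel T" ..
    obtain S where S: "orthogonal_transformation S" "\<And>x. S (T x) = x" "\<And>x. T (S x) = x"
      using assms by (metis orthogonal_transformation_inv bij bij_inv_eq_iff)
    show ?thesis
    proof
      let ?A = "range (\<lambda>n::nat. ball (0::'a) (real n))"
      have "T -` ball 0 r = ball 0 r" for r
        using assms by (auto simp: orthogonal_transformation_norm)
      then have "emeasure ?m (ball 0 r) \<noteq> \<infinity>" for r
        using emeasure_bounded_finite[of "ball (0::'a) r"] by (simp add: emeasure_distr)
      moreover have "\<Union> ?A = UNIV"
        using reals_Archimedean2 by fastforce
      ultimately show "\<exists>A. countable A \<and> A \<subseteq> sets ?m \<and> \<Union> A = space ?m \<and> (\<forall>a\<in>A. emeasure ?m a \<noteq> \<infinity>)"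
        by (intro exI[of _ ?A]) auto
    qed
  qed
  then interpret m: sigma_finite_measure ?m .
  interpret P: pair_sigma_finite lborel ?m
    by standard
  show "sets ?m = sets lborel" by simp
  fix B assume "B \<in> sets ?m"
  then have [measurable]: "B \<in> sets borel" by simp
  have U [measurable]: "?U \<in> sets borel" by simp
  have pair: "borel_measurable (lborel \<Otimes>\<^sub>M ?m) = borel_measurable (borel \<Otimes>\<^sub>M borel)"
    by (intro measurable_cong_sets sets_pair_measure_cong) auto
  have ind: "(indicator ?U :: 'a \<Rightarrow> ennreal) \<in> borel_measurable borel"
    "(indicator B :: 'a \<Rightarrow> ennreal) \<in> borel_measurable borel"
    by measurable
  have meas1: "(\<lambda>(x, y). indicator ?U x * indicator B (y + x) :: ennreal) \<in> borel_measurable (lborel \<Otimes>\<^sub>M ?m)"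
  proof -
    have "(\<lambda>z. indicator ?U (fst z) * indicator B (snd z + fst z) :: ennreal) \<in> borel_measurable (borel \<Otimes>\<^sub>M borel)"
      by (intro borel_measurable_times_ennreal measurable_compose[OF _ ind(1)] measurable_compose[OF _ ind(2)]) measurable
    then show ?thesis unfolding pair by (simp add: case_prod_unfold)
  qed
  have meas2: "(\<lambda>(x, y). indicator ?U (x - y) * indicator B x :: ennreal) \<in> borel_measurable (lborel \<Otimes>\<^sub>M ?m)"
  proof -
    have "(\<lambda>z. indicator ?U (fst z - snd z) * indicator B (fst z) :: ennreal) \<in> borel_measurable (borel \<Otimes>\<^sub>M borel)"
      by (intro borel_measurable_times_ennreal measurable_compose[OF _ ind(1)] measurable_compose[OF _ ind(2)]) measurable
    then show ?thesis unfolding pair by (simp add: case_prod_unfold)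
  qed
  have "emeasure lborel ?U * emeasure ?m B
      = (\<integral>\<^sup>+x. indicator ?U x * emeasure ?m ((\<lambda>y. y + x) -` B) \<partial>lborel)"
    by (subst translm, simp, subst nn_integral_multc, measurable)
  also have "\<dots> = (\<integral>\<^sup>+x. (\<integral>\<^sup>+y. indicator ?U x * indicator B (y + x) \<partial>?m) \<partial>lborel)"
  proof (rule nn_integral_cong)
    fix x :: 'a
    have s: "(\<lambda>y. y + x) -` B \<in> sets borel"
      using measurable_sets[of "\<lambda>y. y + x" borel borel B] by simp
    have "(\<integral>\<^sup>+y. indicator ?U x * indicator B (y + x) \<partial>?m)
        = indicator ?U x * (\<integral>\<^sup>+y. indicator B (y + x) \<partial>?m)"
      by (subst nn_integral_cmult) auto
    also have "(\<integral>\<^sup>+y. indicator B (y + x) \<partial>?m) = (\<integral>\<^sup>+y. indicator ((\<lambda>y. y + x) -` B) y \<partial>?m)"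
      by (simp add: indicator_def)
    also have "\<dots> = emeasure ?m ((\<lambda>y. y + x) -` B)"
      using s by (subst nn_integral_indicator) auto
    finally show "indicator ?U x * emeasure ?m ((\<lambda>y. y + x) -` B)
      = (\<integral>\<^sup>+y. indicator ?U x * indicator B (y + x) \<partial>?m)" by simp
  qed
  also have "\<dots> = (\<integral>\<^sup>+y. (\<integral>\<^sup>+x. indicator ?U x * indicator B (y + x) \<partial>lborel) \<partial>?m)"
    by (rule P.Fubini'[OF meas1, symmetric])
  also have "\<dots> = (\<integral>\<^sup>+y. (\<integral>\<^sup>+x. indicator ?U (x - y) * indicator B x \<partial>lborel) \<partial>?m)"
  proof (rule nn_integral_cong)
    fix y :: 'a
    have "(\<integral>\<^sup>+x. indicator ?U (x - y) * indicator B x \<partial>lborel)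
        = (\<integral>\<^sup>+x. indicator ?U (x - y) * indicator B x \<partial>distr lborel borel ((+) y))"
      by (simp add: lborel_distr_plus)
    also have "\<dots> = (\<integral>\<^sup>+x. indicator ?U x * indicator B (y + x) \<partial>lborel)"
      by (subst nn_integral_distr) auto
    finally show "(\<integral>\<^sup>+x. indicator ?U x * indicator B (y + x) \<partial>lborel)
      = (\<integral>\<^sup>+x. indicator ?U (x - y) * indicator B x \<partial>lborel)" by simp
  qed
  also have "\<dots> = (\<integral>\<^sup>+x. (\<integral>\<^sup>+y. indicator ?U (x - y) * indicator B x \<partial>?m) \<partial>lborel)"
    by (rule P.Fubini'[OF meas2])
  also have "\<dots> = (\<integral>\<^sup>+x. emeasure lborel ?U * indicator B x \<partial>lborel)"
  proof (rule nn_integral_cong)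
    fix x :: 'a
    have s: "(\<lambda>y. y + (- x)) -` ?U \<in> sets borel"
      using measurable_sets[of "\<lambda>y. y + (- x)" borel borel ?U] by simp
    have "(\<integral>\<^sup>+y. indicator ?U (x - y) * indicator B x \<partial>?m)
        = (\<integral>\<^sup>+y. indicator ?U (x - y) \<partial>?m) * indicator B x"
      by (subst nn_integral_multc) auto
    also have "(\<integral>\<^sup>+y. indicator ?U (x - y) \<partial>?m) = (\<integral>\<^sup>+y. indicator ((\<lambda>y. y + (- x)) -` ?U) y \<partial>?m)"
      by (intro nn_integral_cong) (simp add: indicator_def norm_minus_commute)
    also have "\<dots> = emeasure lborel ?U"
      using s translm[of ?U "- x"] mU by (subst nn_integral_indicator) auto
    finally show "(\<integral>\<^sup>+y. indicator ?U (x - y) * indicator B x \<partial>?m)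
      = emeasure lborel ?U * indicator B x" .
  qed
  also have "\<dots> = emeasure lborel ?U * emeasure lborel B"
    by (subst nn_integral_cmult) auto
  finally show "emeasure ?m B = emeasure lborel B"
    using emeasure_unit_ball_pos_finite[of ?U] by (simp add: ennreal_mult_cancel_left)
qed

lemma sphere_measure_rotation_invariant:
  fixes T :: "complex^'d::finite \<Rightarrow> complex^'d"
  assumes "orthogonal_transformation T"
  shows "distr sphere_measure borel T = sphere_measure"
proof (rule measure_eqI)
  let ?U = "ball (0::complex^'d) 1"
  have lin: "linear T" using assms orthogonal_transformation_linear by blast
  have [measurable]: "T \<in> borel_measurable borel"
    using lin by (intro borel_measurable_continuous_onI linear_continuous_on linear_conv_bounded_linear[THEN iffD1])
  show "sets (distr sphere_measure borel T) = sets (sphere_measure :: (complex^'d) measure)"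
    by (simp add: sphere_measure_def)
  fix A assume "A \<in> sets (distr sphere_measure borel T)"
  then have [measurable]: "A \<in> sets borel" by simp
  have comm: "T (sgn z) = sgn (T z)" for z
    using assms lin by (simp add: sgn_div_norm linear_scale orthogonal_transformation_norm)
  have S: "sgn -` A \<in> sets (borel :: (complex^'d) measure)"
    using measurable_sets[of "sgn :: complex^'d \<Rightarrow> _" borel borel A] by simp
  have TA: "T -` A \<in> sets borel"
    using measurable_sets[of T borel borel A] by simp
  have TS: "sgn -` (T -` A) \<in> sets (borel :: (complex^'d) measure)"
    using TA measurable_sets[of "sgn :: complex^'d \<Rightarrow> _" borel borel "T -` A"] by simp
  have "emeasure (distr sphere_measure borel T) A = emeasure sphere_measure (T -` A)"
    by (subst emeasure_distr) (auto simp: sphere_measure_def)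
  also have "\<dots> = emeasure lborel (?U \<inter> sgn -` (T -` A)) / emeasure lborel ?U"
    using TA TS by (simp add: sphere_measure_def emeasure_distr)
  also have "?U \<inter> sgn -` (T -` A) = T -` (?U \<inter> sgn -` A)"
    using assms comm by (auto simp: orthogonal_transformation_norm)
  also have "emeasure lborel (T -` (?U \<inter> sgn -` A)) = emeasure (distr lborel borel T) (?U \<inter> sgn -` A)"
    using S by (subst emeasure_distr) auto
  also have "distr lborel borel T = lborel"
    by (rule lborel_distr_orthogonal[OF assms])
  also have "emeasure lborel (?U \<inter> sgn -` A) / emeasure lborel ?U = emeasure sphere_measure A"
    using S by (simp add: sphere_measure_def emeasure_distr)
  finally show "emeasure (distr sphere_measure borel T) A = emeasure sphere_measure A" .
qed


section \<open>Admissible radial measures and mixed norm Besov spaces\<close>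

definition admissible_radial_measure :: "(complex^'d::finite) measure \<Rightarrow> real measure \<Rightarrow> bool" where
  "admissible_radial_measure \<omega> \<mu> \<longleftrightarrow>
     sets \<mu> = sets (restrict_space borel {0..1}) \<and>
     (\<forall>r. 0 < r \<and> r < 1 \<longrightarrow> emeasure \<mu> {r<..1} > 0) \<and>
     \<omega> = distr (\<mu> \<Otimes>\<^sub>M sphere_measure) borel (\<lambda>(r, w). r *\<^sub>R w)"

(* Used for a > 0 only. *)
definition ennreal_powr :: "ennreal \<Rightarrow> real \<Rightarrow> ennreal" where
  "ennreal_powr x a = (if x = \<infinity> then \<infinity> else ennreal (enn2real x powr a))"

(* The integral of |g(rw)|^p over the sphere.  Since mu lives on the closed interval [0,1] it may
   charge the point 1, where g(w) is not defined; there the mean is given its usual Hardy space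
   meaning.  For holomorphic g the means increase with r, so the supremum is the limit as r -> 1.
   If mu has no atom at 1 the second case is irrelevant. *)
definition sphere_mean :: "real \<Rightarrow> (complex^'d::finite \<Rightarrow> complex) \<Rightarrow> real \<Rightarrow> ennreal" where
  "sphere_mean p g r =
     (if r < 1 then \<integral>\<^sup>+w. ennreal (norm (g (r *\<^sub>R w)) powr p) \<partial>sphere_measure
      else (SUP s\<in>{0..<1}. \<integral>\<^sup>+w. ennreal (norm (g (s *\<^sub>R w)) powr p) \<partial>sphere_measure))"

definition mixed_norm :: "real measure \<Rightarrow> real \<Rightarrow> real \<Rightarrow> (complex^'d::finite \<Rightarrow> complex) \<Rightarrow> ennreal" where
  "mixed_norm \<mu> p q g = ennreal_powr (\<integral>\<^sup>+r. ennreal_powr (sphere_mean p g r) (q / p) \<partial>\<mu>) (1 / q)"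

(* For N > 0 the expression mixed_norm (R^N f) vanishes on constants and is only a seminorm; as
   usual for Besov spaces, |f(0)| is added to make it a norm.  The space is unaffected, and any
   other way of combining the two terms gives an equivalent norm. *)
definition besov_norm ::
  "real measure \<Rightarrow> nat \<Rightarrow> real \<Rightarrow> real \<Rightarrow> (complex^'d::finite \<Rightarrow> complex) \<Rightarrow> ennreal" where
  "besov_norm \<mu> N p q f =
     (if N = 0 then 0 else ennreal (norm (f 0))) + mixed_norm \<mu> p q ((radial_deriv ^^ N) f)"

definition besov_space ::
  "real measure \<Rightarrow> nat \<Rightarrow> real \<Rightarrow> real \<Rightarrow> (complex^'d::finite \<Rightarrow> complex) set" where
  "besov_space \<mu> N p q = {f. holomorphic_vec_on f (ball 0 1) \<and> besov_norm \<mu> N p q f < \<infinity>}"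


section \<open>Multipliers and cyclicity\<close>

definition Mult :: "('a \<Rightarrow> complex) set \<Rightarrow> ('a \<Rightarrow> complex) set" where
  "Mult X = {\<phi>. \<forall>h\<in>X. (\<lambda>z. \<phi> z * h z) \<in> X}"

definition mult_closure ::
  "('a \<Rightarrow> complex) set \<Rightarrow> (('a \<Rightarrow> complex) \<Rightarrow> ennreal) \<Rightarrow> ('a \<Rightarrow> complex) \<Rightarrow> ('a \<Rightarrow> complex) set" where
  "mult_closure X nrm f =
     {g \<in> X. \<forall>\<epsilon>>0. \<exists>\<phi>\<in>Mult X. nrm (\<lambda>z. g z - \<phi> z * f z) < ennreal \<epsilon>}"

definition cyclic_in ::
  "('a \<Rightarrow> complex) \<Rightarrow> ('a \<Rightarrow> complex) set \<Rightarrow> (('a \<Rightarrow> complex) \<Rightarrow> ennreal) \<Rightarrow> bool" where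
  "cyclic_in f X nrm \<longleftrightarrow> f \<in> X \<and> mult_closure X nrm f = X"

end

theory Submission
  imports Defs "HOL-Complex_Analysis.Complex_Analysis"
begin

text \<open>Dilations \<open>g\<^sub>t(z) = g(tz)\<close> with \<open>t < 1\<close> are bounded multipliers, because all iterated radial
  derivatives of \<open>g\<^sub>t\<close> are bounded on the ball, and \<open>g\<^sub>t \<longlonglongrightarrow> g\<close> in norm. Hence
  \<open>g - g\<^sub>t \<phi> f = (g - g\<^sub>t) + g\<^sub>t (1 - \<phi> f)\<close> can be made small as soon as \<open>1 - \<phi> f\<close> can.

  Norm convergence of dilations is dominated convergence in \<open>r\<close>, except that an atom of \<open>\<mu>\<close> at
  \<open>1\<close> requires convergence of dilations in the Hardy space, including the exponent \<open>1\<close>. This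
  follows from a quantitative form of \<open>|h(0)|\<^sup>p \<le> \<integral> |h|\<^sup>p\<close> on the circle: near equality
  forces \<open>h\<close> to be close to \<open>h(0)\<close> in mean. Applied after a Moebius transformation on every
  slice and integrated over the sphere, it compares \<open>g\<close> at radius \<open>s\<close> with \<open>g\<close> at radius \<open>s\<rho>\<close>, up
  to a rotation that does not depend on \<open>s\<close> and is therefore harmless.

  Since \<open>\<mu>\<close> may be infinite near \<open>0\<close>, the multiplier estimate uses no integrability of constants: it
  splits off \<open>h(0)\<close> and bounds \<open>h - h(0)\<close> by its radial derivative at the same radius.\<close>


section \<open>A quantitative mean value inequality on the disc\<close>

text \<open>Sphere means increase with the radius, so when their supremum is finite they are almost
  constant near the boundary. For fixed \<open>\<rho>\<close> and \<open>s\<close> near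
  \<open>1\<close> the means at radii \<open>s * \<rho>\<close> and \<open>s\<close> nearly agree,
  and the quantitative inequality converts this into closeness of the functions themselves. What
  remains is a comparison inside the ball of radius \<open>\<rho>\<close>, where uniform continuity
  suffices. Arguments by reflexivity or uniform convexity would break down at exponent
  \<open>1\<close>. A Moebius map spoils the uniform parametrization of the circle, but integration
  over the sphere removes the unimodular factor for each parameter separately, so no Poisson kernel
  appears. The size of constants is immaterial, hence crude quasi-triangle inequalities take the
  place of Minkowski's. The order of choices in the last step does matter: the multiplier bound of a
  dilation depends on \<open>t\<close>, so \<open>t\<close> is fixed first and the approximation of
  \<open>1\<close> is chosen afterwards.\<close>

lemma mean_value_disc:
  assumes "continuous_on (cball 0 1) h" and "h holomorphic_on ball 0 1"
  shows "((\<lambda>t. h (cis (2 * pi * t))) has_integral h 0) {0..1}"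
proof -
  have "((\<lambda>u. h u / (u - 0)) has_contour_integral (2 * of_real pi * \<i> * h 0)) (circlepath 0 1)"
    by (rule Cauchy_integral_circlepath) (use assms in auto)
  then have "((\<lambda>t. h (cis t) / cis t * \<i> * cis t) has_integral (2 * of_real pi * \<i> * h 0)) {0..2*pi}"
    unfolding circlepath_def by (subst (asm) has_contour_integral_part_circlepath_iff) auto
  then have "((\<lambda>t. \<i> * h (cis t)) has_integral (2 * of_real pi * \<i> * h 0)) {0..2*pi}"
    by (simp add: mult_ac)
  then have "((\<lambda>t. 1/\<i> * (\<i> * h (cis t))) has_integral (1/\<i> * (2 * of_real pi * \<i> * h 0))) {0..2*pi}"
    by (rule has_integral_mult_right)
  moreover have "1/\<i> * (2 * of_real pi * \<i> * h 0) = of_real (2*pi) * h 0" by simp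
  moreover have "(\<lambda>t. 1/\<i> * (\<i> * h (cis t))) = (\<lambda>t. h (cis t))" by simp
  ultimately have "((\<lambda>t. h (cis t)) has_integral (of_real (2*pi) * h 0)) (cbox 0 (2*pi))"
    by (simp only: cbox_interval)
  from has_integral_affinity'[OF this, of "2*pi" 0]
  have "((\<lambda>t. h (cis (2 * pi * t))) has_integral (of_real (2*pi) * h 0) /\<^sub>R (2*pi)) {0..1}"
    by (simp add: cbox_interval)
  moreover have "(of_real (2*pi) * h 0) /\<^sub>R (2*pi) = h 0"
    by (simp add: scaleR_conv_of_real field_simps)
  ultimately show ?thesis by simp
qed

text \<open>The graph of the convex function \<open>t powr p\<close> lies above its tangent at
  \<open>1\<close>. This feeds both the sign of \<open>gap\<close> and Jensen's inequality in
  \<open>integral_powr_le\<close>.\<close>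

lemma powr_tangent:
  fixes t p :: real
  assumes "0 \<le> t" "1 \<le> p"
  shows "1 + p * (t - 1) \<le> t powr p"
proof (cases "t = 0")
  case False
  then have t: "t > 0" using assms by simp
  define F where "F = (\<lambda>t. t powr p - p * (t - 1))"
  have d: "(F has_real_derivative p * x powr (p - 1) - p) (at x)" if "x > 0" for x
    unfolding F_def using that by (auto intro!: derivative_eq_intros)
  have "F 1 \<le> F t"
  proof (cases "t \<ge> 1")
    case True
    show ?thesis
    proof (rule DERIV_nonneg_imp_nondecreasing[OF True])
      fix x assume "1 \<le> x" "x \<le> t"
      moreover have "1 \<le> x powr (p - 1)" using \<open>1 \<le> x\<close> assms by (simp add: ge_one_powr_ge_zero)
      ultimately show "\<exists>y. (F has_real_derivative y) (at x) \<and> 0 \<le> y"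
        using d[of x] assms by (intro exI[of _ "p * x powr (p - 1) - p"]) auto
    qed
  next
    case f: False
    show ?thesis
    proof (rule DERIV_nonpos_imp_nonincreasing[of t 1])
      fix x assume x: "t \<le> x" "x \<le> 1"
      have "x powr (p - 1) \<le> 1" using x assms t by (simp add: powr_le1)
      then show "\<exists>y. (F has_real_derivative y) (at x) \<and> y \<le> 0"
        using d[of x] assms x t by (intro exI[of _ "p * x powr (p - 1) - p"]) (auto intro: mult_left_le)
    qed (use f in auto)
  qed
  then show ?thesis by (simp add: F_def)
qed (use assms in auto)

lemma continuous_on_norm_powr:
  fixes f :: "'a::topological_space \<Rightarrow> 'b::real_normed_vector"
  shows "continuous_on S f \<Longrightarrow> 1 \<le> p \<Longrightarrow> continuous_on S (\<lambda>x. norm (f x) powr p)"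
  by (intro continuous_on_powr' continuous_intros) auto

text \<open>The point is that one \<open>n\<close> serves every offset \<open>x\<close>: in
  \<open>log_mean_disc\<close> the offset is the argument of a boundary point, over which a maximum
  is taken. Periodicity turns the integral over a shifted period into the one over
  \<open>{0..1}\<close>.\<close>

lemma riemann_sum_le:
  fixes F :: "real \<Rightarrow> real"
  assumes cont: "continuous_on UNIV F" and per: "\<And>x. F (x + 1) = F x" and "\<epsilon> > 0"
  obtains n :: nat where "n > 0"
    "\<And>x. 0 \<le> x \<Longrightarrow> x \<le> 1 \<Longrightarrow> (\<Sum>j<n. F (x + j / n)) \<le> n * (integral {0..1} F + \<epsilon>)"
proof -
  \<comment> \<open>With \<open>x \<le> 1\<close> and \<open>j < n\<close> all sampling intervals
    lie in \<open>{0..2}\<close>.\<close>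
  have "uniformly_continuous_on {0..2} F"
    by (rule compact_uniformly_continuous) (use cont continuous_on_subset in auto)
  then obtain d where "d > 0" and d: "\<And>x y. x \<in> {0..2} \<Longrightarrow> y \<in> {0..2} \<Longrightarrow> dist y x < d \<Longrightarrow> dist (F y) (F x) < \<epsilon>"
    using \<open>\<epsilon> > 0\<close> unfolding uniformly_continuous_on_def by metis
  obtain n :: nat where n: "n > 0" "1 / n < d"
    using real_arch_inverse[of d] \<open>d > 0\<close> by (auto simp: inverse_eq_divide)
  have int: "F integrable_on {a..b}" for a b
    by (rule integrable_continuous_real) (use cont continuous_on_subset in auto)
  have "(\<Sum>j<n. F (x + j / n)) \<le> n * (integral {0..1} F + \<epsilon>)" if x: "0 \<le> x" "x \<le> 1" for x
  proof -
    have piece: "F (x + j / n) / n - \<epsilon> / n \<le> integral {x + j/n .. x + Suc j/n} F" if "j < n" for j :: nat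
    proof -
      have jn: "real j + 1 \<le> n" using that by linarith
      have le: "x + j/n \<le> x + Suc j/n" using n by (simp add: divide_right_mono)
      have len: "(x + Suc j/n) - (x + j/n) = 1 / n" using n by (simp add: field_simps)
      have "integral {x + j/n .. x + Suc j/n} (\<lambda>_. F (x + j/n) - \<epsilon>) \<le> integral {x + j/n .. x + Suc j/n} F"
      proof (rule integral_le)
        fix y assume y: "y \<in> {x + j/n .. x + Suc j/n}"
        have "real (Suc j) / n \<le> 1" using jn n by (simp add: divide_le_eq_1)
        then have "x + Suc j / n \<le> 2" using x by linarith
        moreover have "0 \<le> x + j/n" using x by simp
        ultimately have "dist (F (x + j/n)) (F y) < \<epsilon>"
          by (intro d) (use y le len n in \<open>auto simp: dist_real_def\<close>)
        then show "F (x + j/n) - \<epsilon> \<le> F y" by (simp add: dist_real_def)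
      qed (use int in auto)
      moreover have "integral {x + j/n .. x + Suc j/n} (\<lambda>_. F (x + j/n) - \<epsilon>) = (1/n) * (F (x + j/n) - \<epsilon>)"
        by (subst integral_const_real) (use le len in auto)
      ultimately show ?thesis by (simp add: diff_divide_distrib)
    qed
    have comb: "(\<Sum>j<k. integral {x + j/n .. x + Suc j/n} F) = integral {x..x + k/n} F" for k :: nat
    proof (induction k)
      case (Suc k)
      have "integral {x..x + k/n} F + integral {x + k/n..x + Suc k/n} F = integral {x..x+Suc k/n} F"
        by (rule Henstock_Kurzweil_Integration.integral_combine) (use int n in \<open>auto simp: divide_right_mono\<close>)
      then show ?case using Suc by simp
    qed simp
    have "integral {x..x+1} F = integral {x..1} F + integral {1..x+1} F"
      by (rule Henstock_Kurzweil_Integration.integral_combine[symmetric]) (use int x in auto)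
    also have "integral {1..x+1} F = integral {0..x} (F \<circ> (+) 1)"
      using integral_shift_Icc_real[of 0 x F 1] by (simp add: add.commute)
    also have "F \<circ> (+) 1 = F" using per by (auto simp: add.commute)
    also have "integral {x..1} F + integral {0..x} F = integral {0..1} F"
      using Henstock_Kurzweil_Integration.integral_combine[of 0 x 1 F] int x by auto
    finally have per': "integral {x..x+1} F = integral {0..1} F" .
    have "(\<Sum>j<n. F (x + j / n) / n - \<epsilon> / n) \<le> (\<Sum>j<n. integral {x + j/n .. x + Suc j/n} F)"
      by (rule sum_mono) (use piece in auto)
    also have "\<dots> = integral {0..1} F" using comb[of n] per' n by simp
    finally have "(\<Sum>j<n. F (x + j / n)) / n - \<epsilon> \<le> integral {0..1} F"
      using n by (simp add: sum_subtractf sum_divide_distrib)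
    then show ?thesis using n by (simp add: field_simps)
  qed
  then show ?thesis using that n by blast
qed

text \<open>The maximum principle for the product of \<open>h\<close> over \<open>n\<close> equidistant rotations bounds \<open>ln |h(0)|\<close>
  by a Riemann sum; no information on the zeros of \<open>h\<close> is needed.\<close>

lemma log_mean_disc:
  assumes cont: "continuous_on (cball 0 1) h" and hol: "h holomorphic_on ball 0 1"
    and "0 < \<eta>" and "h 0 \<noteq> 0"
  shows "ln (norm (h 0)) \<le> integral {0..1} (\<lambda>t. ln (max (norm (h (cis (2 * pi * t)))) \<eta>))"
proof (rule field_le_epsilon)
  fix \<epsilon> :: real assume "\<epsilon> > 0"
  define F where "F = (\<lambda>t. ln (max (norm (h (cis (2 * pi * t)))) \<eta>))"
  have contF: "continuous_on UNIV F"
  proof -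
    have "continuous_on UNIV (\<lambda>t. h (cis (2 * pi * t)))"
      by (rule continuous_on_compose2[OF cont]) (auto intro!: continuous_intros)
    then show ?thesis unfolding F_def using \<open>0 < \<eta>\<close>
      by (intro continuous_intros) (auto simp: max_def)
  qed
  have "F (x + 1) = F x" for x
    by (simp add: F_def distrib_left flip: cis_mult)
  then obtain n :: nat where n: "n > 0"
    "\<And>x. 0 \<le> x \<Longrightarrow> x \<le> 1 \<Longrightarrow> (\<Sum>j<n. F (x + j / n)) \<le> n * (integral {0..1} F + \<epsilon>)"
    using riemann_sum_le[OF contF _ \<open>\<epsilon> > 0\<close>] by metis
  \<comment> \<open>At the origin all factors coincide, so \<open>H 0\<close> is the
    \<open>n\<close>-th power of \<open>h 0\<close>, and the factor \<open>n\<close> cancels after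
    taking logarithms.\<close>
  define H where "H = (\<lambda>z. \<Prod>j<n. h (cis (2 * pi * (j / n)) * z))"
  have cH: "continuous_on (cball 0 1) H" unfolding H_def
    by (intro continuous_on_prod continuous_on_compose2[OF cont])
       (auto intro!: continuous_intros simp: norm_mult)
  have hH: "H holomorphic_on ball 0 1" unfolding H_def
  proof (intro holomorphic_intros)
    fix j
    show "(\<lambda>z. h (cis (2 * pi * (real j / real n)) * z)) holomorphic_on ball 0 1"
      using holomorphic_on_compose_gen[OF _ hol, of "\<lambda>z. cis (2 * pi * (real j / real n)) * z" "ball 0 1"]
      by (force simp: comp_def norm_mult intro!: holomorphic_intros)
  qed
  have "norm (H 0) \<le> exp (n * (integral {0..1} F + \<epsilon>))"
  proof (rule maximum_modulus_frontier[where S="cball 0 1" and f=H])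
    fix z :: complex assume "z \<in> frontier (cball 0 1)"
    then have z: "norm z = 1" by simp
    define x where "x = Arg2pi z / (2 * pi)"
    have x: "0 \<le> x" "x \<le> 1" "z = cis (2 * pi * x)"
      using Arg2pi[of z] z by (auto simp: x_def cis_conv_exp mult.commute is_Arg_def)
    have "norm (H z) = (\<Prod>j<n. norm (h (cis (2 * pi * (x + j / n)))))"
      by (simp add: H_def x(3) cis_mult prod_norm distrib_left add.commute)
    also have "\<dots> \<le> (\<Prod>j<n. exp (F (x + j / n)))"
      using \<open>0 < \<eta>\<close> by (intro prod_mono) (auto simp: F_def)
    also have "\<dots> = exp (\<Sum>j<n. F (x + j / n))" by (simp add: exp_sum)
    also have "\<dots> \<le> exp (n * (integral {0..1} F + \<epsilon>))" using n x by simp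
    finally show "norm (H z) \<le> exp (n * (integral {0..1} F + \<epsilon>))" .
  qed (use cH hH in auto)
  moreover have "norm (H 0) = exp (n * ln (norm (h 0)))"
    using \<open>h 0 \<noteq> 0\<close> by (simp add: H_def norm_power exp_of_nat_mult)
  ultimately show "ln (norm (h 0)) \<le> integral {0..1} (\<lambda>t. ln (max (norm (h (cis (2 * pi * t)))) \<eta>)) + \<epsilon>"
    using n by (simp add: F_def)
qed

text \<open>Composed with a holomorphic function \<open>z(\<lambda>)\<close> vanishing at the centre of the disc, the subtracted
  terms have mean value \<open>\<ge> 0\<close>. Either term alone would suffice for \<open>gap p \<ge> 0\<close>; for \<open>p = 1\<close> the
  linear one leaves zeros on a half line and the logarithmic one leaves zeros on a circle, and only
  both together make \<open>0\<close> the unique zero. Truncating the logarithm keeps it continuous.\<close>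

definition gap :: "real \<Rightarrow> complex \<Rightarrow> real" where
  "gap p z = norm (1 + z) powr p - 1 - p / 2 * (Re z + ln (max (norm (1 + z)) (exp (-2))))"

text \<open>The tangent term \<open>p * (t - 1)\<close> is split into halves, one spent against
  \<open>Re z\<close> and one against the logarithm, which makes all three summands nonnegative.
  Below the level \<open>exp (-2)\<close> the truncated logarithm is \<open>-2\<close>, strictly
  less than \<open>t - 1\<close>, so truncation creates no new equality case.\<close>

lemma gap_parts:
  fixes z :: complex
  assumes "1 \<le> p"
  defines "t \<equiv> norm (1 + z)"
  shows "1 + p * (t - 1) \<le> t powr p" "Re z \<le> t - 1" "ln (max t (exp (-2))) \<le> t - 1"
    and "gap p z = (t powr p - 1 - p * (t - 1)) + p / 2 * (t - 1 - Re z)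
                   + p / 2 * (t - 1 - ln (max t (exp (-2))))"
proof -
  have "0 \<le> t" by (simp add: t_def)
  then show "1 + p * (t - 1) \<le> t powr p" using assms by (intro powr_tangent) auto
  show "Re z \<le> t - 1" using complex_Re_le_cmod[of "1 + z"] by (simp add: t_def)
  show "ln (max t (exp (-2))) \<le> t - 1"

  proof (cases "t \<le> exp (-2)")
    case False
    then have "t > 0" using exp_gt_zero[of "-2 :: real"] by linarith
    then show ?thesis using ln_le_minus_one[of t] False by (simp add: max_def)
  qed (use \<open>0 \<le> t\<close> in \<open>auto simp: max_def\<close>)
  show "gap p z = (t powr p - 1 - p * (t - 1)) + p / 2 * (t - 1 - Re z)
                   + p / 2 * (t - 1 - ln (max t (exp (-2))))"
    by (simp add: gap_def t_def field_simps)
qed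

lemma gap_nonneg: "1 \<le> p \<Longrightarrow> 0 \<le> gap p z"
  using gap_parts[of p z] mult_nonneg_nonneg[of "p / 2" "norm (1 + z) - 1 - Re z"]
    mult_nonneg_nonneg[of "p / 2" "norm (1 + z) - 1 - ln (max (norm (1 + z)) (exp (-2)))"]
  by linarith

text \<open>Equality in the logarithmic estimate forces \<open>norm (1 + z) = 1\<close>, and
  equality in the linear one then gives \<open>Re z = 0\<close>. The unit circle about
  \<open>-1\<close> touches the imaginary axis at \<open>0\<close> only.\<close>

lemma gap_eq_0:
  assumes "1 \<le> p" "gap p z = 0"
  shows "z = 0"
proof -
  define t where "t = norm (1 + z)"
  note g = gap_parts[OF assms(1), of z, folded t_def]
  have "0 \<le> p / 2 * (t - 1 - Re z)" "0 \<le> p / 2 * (t - 1 - ln (max t (exp (-2))))"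
    using g assms by auto
  then have "p / 2 * (t - 1 - Re z) = 0" "p / 2 * (t - 1 - ln (max t (exp (-2)))) = 0"
    using g assms by linarith+
  then have eq: "t - 1 = Re z" "ln (max t (exp (-2))) = t - 1" using assms by auto
  have "t \<ge> 0" by (simp add: t_def)
  have "t = 1"
  proof (cases "t \<le> exp (-2)")
    case True
    then show ?thesis using eq \<open>t \<ge> 0\<close> by (simp add: max_def)
  next
    case False
    then have "t > 0" using exp_gt_zero[of "-2 :: real"] by linarith
    then show ?thesis using False eq ln_eq_minus_one[of t] by (auto simp: max_def)
  qed
  then have "Re z = 0" "(norm (1 + z))\<^sup>2 = 1" using eq by (auto simp: t_def)
  then show "z = 0" by (simp add: cmod_power2 complex_eq_iff)
qed

lemma continuous_gap: "1 \<le> p \<Longrightarrow> continuous_on S (gap p)"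
  unfolding gap_def[abs_def]
  by (intro continuous_intros continuous_on_norm_powr) (auto simp: max_def not_le intro: less_imp_neq exp_gt_zero split: if_splits)

text \<open>Three regimes: for large \<open>z\<close> the power dominates the subtracted terms, for
  small \<open>z\<close> the summand \<open>\<epsilon>\<close> suffices, and on the compact set in
  between \<open>gap p\<close> has a positive minimum because \<open>0\<close> is its only zero. The
  summand \<open>\<epsilon>\<close> is unavoidable: for \<open>p = 1\<close> the left side is linear
  in \<open>norm z\<close>, while \<open>gap\<close> vanishes to second order at
  \<open>0\<close>.\<close>

lemma norm_powr_le_gap:
  fixes p \<epsilon> :: real
  assumes p: "1 \<le> p" and "0 < \<epsilon>"
  obtains C where "1 \<le> C" "\<And>z. norm z powr p \<le> \<epsilon> + C * gap p z"
proof -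
  have large: "norm z powr p \<le> 8 * 2 powr p * gap p z" if "norm z \<ge> 5" for z
  proof -
    define t where "t = norm (1 + z)"
    note g = gap_parts[OF p, of z, folded t_def]
    have "norm z \<le> t + 1" using norm_triangle_ineq4[of "1 + z" 1] by (simp add: t_def)
    then have t: "t \<ge> 4" "norm z \<le> 2 * t" using that by auto
    \<comment> \<open>With \<open>t powr p\<close> the square of \<open>y\<close> and
      \<open>p / 2 * ln t\<close> equal to \<open>ln y \<le> y - 1\<close>, the estimate becomes a
      quadratic inequality in \<open>y\<close>. The radius \<open>5\<close> is chosen to give
      \<open>t \<ge> 4\<close> and hence \<open>y \<ge> 2\<close>, which that inequality
      needs.\<close>
    define y where "y = t powr (p / 2)"
    have y2: "y\<^sup>2 = t powr p" using t by (simp add: y_def power2_eq_square flip: powr_add)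
    have "4 powr (1/2) \<le> t powr (p / 2)" using t p by (intro powr_mono_both) auto
    then have y: "y \<ge> 2" by (simp add: y_def powr_half_sqrt)
    have "exp (-2 :: real) \<le> 1" by simp
    then have mx: "max t (exp (-2)) = t" using t by linarith
    have "ln y = p / 2 * ln t" using t by (simp add: y_def ln_powr)
    moreover have "ln y \<le> y - 1" using y by (intro ln_le_minus_one) auto
    moreover have "gap p z = (t powr p - 1 - p * (t - 1)) + p / 2 * (t - 1 - Re z) + p/2 * (t - 1) - p / 2 * ln t"
      using g(4) unfolding mx by (simp add: field_simps)
    moreover have "0 \<le> p / 2 * (t - 1 - Re z)" using g p by auto
    ultimately have "gap p z \<ge> (y\<^sup>2 - 1) - p / 2 * (t - 1) - (y - 1)"
      unfolding y2 by linarith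
    moreover have "p / 2 * (t - 1) \<le> (y\<^sup>2 - 1) / 2" using g(1) by (simp add: y2)
    moreover have "0 \<le> y\<^sup>2 - 4 * y + 4"
      using zero_le_power2[of "y - 2"] by (simp add: power2_diff)
    moreover have "Y \<le> 8 * g" if "Y - 1 - P - (y - 1) \<le> g" "P \<le> (Y - 1) / 2" "0 \<le> Y - 4 * y + 4"
      for Y P g :: real
    proof -
      have "8 * g \<ge> 8 * (Y - 1 - P - (y - 1))" using that(1) by simp
      then have "8 * g \<ge> 4 * Y + 4 - 8 * y" using that(2) by simp
      then show ?thesis using that(3) y by simp
    qed
    ultimately have "8 * gap p z \<ge> y\<^sup>2" by blast
    then have "t powr p \<le> 8 * gap p z" by (simp add: y2)
    have "norm z powr p \<le> (2 * t) powr p" using t p by (intro powr_mono2) auto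
    also have "\<dots> = 2 powr p * t powr p" using t by (simp add: powr_mult)
    also have "\<dots> \<le> 2 powr p * (8 * gap p z)" using \<open>t powr p \<le> 8 * gap p z\<close> by simp
    finally show ?thesis by simp
  qed
  define S where "S = cball (0::complex) 5 \<inter> {z. \<epsilon> \<le> norm z powr p}"
  have "compact S" unfolding S_def
    using p by (intro compact_Int_closed closed_Collect_le compact_cball continuous_intros continuous_on_norm_powr) auto
  have "\<exists>d>0. \<forall>z\<in>S. d \<le> gap p z"
  proof (cases "S = {}")
    case False
    then obtain z where z: "z \<in> S" "\<And>w. w \<in> S \<Longrightarrow> gap p z \<le> gap p w"
      using continuous_attains_inf[OF \<open>compact S\<close> _ continuous_gap[OF p]] by metis
    have "z \<noteq> 0" using z(1) \<open>0 < \<epsilon>\<close> p by (auto simp: S_def)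
    then have "gap p z > 0" using gap_eq_0[OF p, of z] gap_nonneg[OF p, of z] by linarith
    then show ?thesis using z by blast
  qed (auto intro: exI[of _ 1])
  then obtain d where d: "d > 0" "\<And>z. z \<in> S \<Longrightarrow> d \<le> gap p z" by blast
  define C where "C = 1 + 8 * 2 powr p + 5 powr p / d"
  have C: "8 * 2 powr p \<le> C" "5 powr p / d \<le> C" "1 \<le> C" using d by (auto simp: C_def)
  have "norm z powr p \<le> \<epsilon> + C * gap p z" for z
  proof -
    have "C * gap p z \<ge> 0" using C gap_nonneg[OF p, of z] by simp
    consider "norm z \<ge> 5" | "norm z powr p \<le> \<epsilon>" | "z \<in> S" unfolding S_def by force
    then show ?thesis
    proof cases
      case 1
      then show ?thesis using large[of z] mult_right_mono[OF C(1) gap_nonneg[OF p, of z]] \<open>0 < \<epsilon>\<close> by linarith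
    next
      case 3
      have "norm z powr p \<le> 5 powr p" using 3 p by (intro powr_mono2) (auto simp: S_def)
      also have "\<dots> = 5 powr p / d * d" using d by simp
      also have "\<dots> \<le> C * gap p z" using C d(2)[OF 3] d(1) by (intro mult_mono) auto
      finally show ?thesis using \<open>0 < \<epsilon>\<close> by linarith
    qed (use \<open>C * gap p z \<ge> 0\<close> in auto)
  qed
  then show ?thesis using that C by blast
qed

text \<open>Put \<open>z = h / h 0 - 1\<close> into \<open>norm_powr_le_gap\<close> and integrate
  over the circle. The linear term has mean \<open>0\<close> and the logarithmic one, by
  \<open>log_mean_disc\<close>, mean at least \<open>0\<close>; so the mean of \<open>gap\<close> is
  at most the excess of the mean of \<open>norm (h / h 0) powr p\<close> over \<open>1\<close>. The
  inequality is arranged without subtraction so that it transfers to \<open>ennreal\<close>.\<close>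

lemma disc_deviation_ineq:
  fixes p \<epsilon> :: real
  assumes p: "1 \<le> p" and "0 < \<epsilon>"
  obtains C where "1 \<le> C"
    "\<And>h. continuous_on (cball 0 1) h \<Longrightarrow> h holomorphic_on ball 0 1 \<Longrightarrow>
       integral {0..1} (\<lambda>t. norm (h (cis (2 * pi * t)) - h 0) powr p) + C * norm (h 0) powr p
         \<le> \<epsilon> * norm (h 0) powr p + C * integral {0..1} (\<lambda>t. norm (h (cis (2 * pi * t))) powr p)"
proof -
  obtain C where C: "1 \<le> C" "\<And>z. norm z powr p \<le> \<epsilon> + C * gap p z"
    using norm_powr_le_gap[OF assms] by metis
  have "integral {0..1} (\<lambda>t. norm (h (cis (2 * pi * t)) - h 0) powr p) + C * norm (h 0) powr p
         \<le> \<epsilon> * norm (h 0) powr p + C * integral {0..1} (\<lambda>t. norm (h (cis (2 * pi * t))) powr p)"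
    if cont: "continuous_on (cball 0 1) h" and hol: "h holomorphic_on ball 0 1" for h
  proof -
    define c where "c = (\<lambda>t. h (cis (2 * pi * t)))"
    define a where "a = h 0"
    have contc: "continuous_on UNIV c" unfolding c_def
      by (rule continuous_on_compose2[OF cont]) (auto intro!: continuous_intros)
    then have contc': "continuous_on {0..1} c" by (rule continuous_on_subset) auto
    have int: "(\<lambda>t. norm (c t) powr p) integrable_on {0..1}" "(\<lambda>t. norm (c t - a) powr p) integrable_on {0..1}"
      using p by (auto intro!: integrable_continuous_real continuous_on_norm_powr continuous_intros contc')
    show ?thesis
    \<comment> \<open>Division by \<open>h 0\<close> is impossible for \<open>a = 0\<close>, but
      there the claim reduces to \<open>C \<ge> 1\<close>.\<close>
    proof (cases "a = 0")
      case True
      have "integral {0..1} (\<lambda>t. norm (c t) powr p) \<ge> 0" by (rule integral_nonneg) (use int in auto)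
      then show ?thesis using True C(1) p mult_right_mono[OF C(1), of "integral {0..1} (\<lambda>t. norm (c t) powr p)"]
        unfolding c_def[symmetric] a_def[symmetric] by (simp add: c_def)
    next
      case False
      define A where "A = norm a powr p"
      have "A > 0" using False by (simp add: A_def)
      define L where "L = (\<lambda>t. ln (max (norm (c t / a)) (exp (-2))))"
      have contL: "continuous_on {0..1} L" unfolding L_def
        using False
        by (intro continuous_intros contc') (auto simp: max_def not_le intro: less_imp_neq exp_gt_zero split: if_splits)
      have "0 \<le> integral {0..1} L"
        using log_mean_disc[of "\<lambda>z. h z / a" "exp (-2)"] cont hol False
        unfolding L_def c_def a_def by (simp add: continuous_intros holomorphic_intros)
      then obtain l where l: "(L has_integral l) {0..1}" "0 \<le> l"
        using integrable_continuous_real[OF contL] by (metis integrable_integral)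
      have "(c has_integral a) {0..1}"
        unfolding c_def a_def by (rule mean_value_disc[OF cont hol])
      then have "((\<lambda>t. c t / a) has_integral (a / a)) {0..1}" by (rule has_integral_divide)
      then have "((\<lambda>t. Re (c t / a)) has_integral Re (a / a)) {0..1}"
        using has_integral_componentwise_iff by (metis has_integral_Re)
      then have re: "((\<lambda>t. Re (c t / a)) has_integral 1) {0..1}" using False by simp
      have g: "gap p (c t / a - 1) = norm (c t) powr p / A - 1 - p / 2 * (Re (c t / a) - 1 + L t)" for t
        using False by (simp add: gap_def L_def A_def norm_divide powr_divide)
      define I where "I = integral {0..1} (\<lambda>t. norm (c t) powr p)"
      have I: "((\<lambda>t. norm (c t) powr p) has_integral I) {0..1}"
        unfolding I_def using int by (simp add: has_integral_integral)
      have c1: "((\<lambda>_. k) has_integral k) {0..1::real}" for k :: real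
        using has_integral_const_real[of k 0 1] by simp
      have "((\<lambda>t. A * (\<epsilon> + C * gap p (c t / a - 1))) has_integral
          A * (\<epsilon> + C * (I / A - 1 - p / 2 * (1 - 1 + l)))) {0..1}"
        unfolding g
        by (intro has_integral_mult_right has_integral_add has_integral_diff has_integral_divide c1 I re l)
      moreover have "norm (c t - a) powr p \<le> A * (\<epsilon> + C * gap p (c t / a - 1))" for t
      proof -
        have "norm (c t - a) powr p = A * norm (c t / a - 1) powr p"
        proof -
          have "c t - a = a * (c t / a - 1)" using False by (simp add: field_simps)
          then have "norm (c t - a) = norm a * norm (c t / a - 1)" by (metis norm_mult)
          then show ?thesis by (simp add: A_def powr_mult)
        qed
        then show ?thesis using C(2) \<open>A > 0\<close> by simp
      qed
      ultimately have "integral {0..1} (\<lambda>t. norm (c t - a) powr p) \<le> A * (\<epsilon> + C * (I / A - 1 - p / 2 * (1 - 1 + l)))"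
        using int(2) by (meson has_integral_le has_integral_integral)
      also have "\<dots> = \<epsilon> * A + C * I - C * A - A * C * p / 2 * l" using \<open>A > 0\<close> by (simp add: field_simps)
      \<comment> \<open>The logarithmic mean \<open>l \<ge> 0\<close> enters with a negative sign
        and is discarded.\<close>
      also have "\<dots> \<le> \<epsilon> * A + C * I - C * A" using \<open>A > 0\<close> C(1) p l(2) by simp
      finally show ?thesis unfolding I_def A_def c_def a_def by simp
    qed
  qed
  then show ?thesis using that C by blast
qed

section \<open>Moebius maps of the disc\<close>

definition moebius :: "real \<Rightarrow> complex \<Rightarrow> complex" where
  "moebius \<rho> z = (z + of_real \<rho>) / (1 + of_real \<rho> * z)"

lemma moebius_0 [simp]: "moebius \<rho> 0 = of_real \<rho>"
  by (simp add: moebius_def)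

text \<open>All norm statements follow from the identity \<open>id\<close>, whose right side has the
  sign of \<open>1 - norm z\<close>.\<close>

lemma moebius_norm:
  assumes "0 \<le> \<rho>" "\<rho> < 1"
  shows "norm z \<le> 1 \<Longrightarrow> 1 + of_real \<rho> * z \<noteq> 0"
    "norm z \<le> 1 \<Longrightarrow> norm (moebius \<rho> z) \<le> 1" "norm z < 1 \<Longrightarrow> norm (moebius \<rho> z) < 1"
    "norm z = 1 \<Longrightarrow> norm (moebius \<rho> z) = 1"
proof -
  have nz: "1 + of_real \<rho> * z \<noteq> 0" if "norm z \<le> 1" for z :: complex
  proof
    assume "1 + of_real \<rho> * z = 0"
    then have "norm (of_real \<rho> * z) = 1" by (metis add_eq_0_iff norm_minus_cancel norm_one)
    then have "\<rho> * norm z = 1" using assms by (simp add: norm_mult)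
    then show False using assms that by (smt (verit) mult_left_le norm_ge_zero)
  qed
  have id: "(norm (1 + of_real \<rho> * z))\<^sup>2 - (norm (z + of_real \<rho>))\<^sup>2 = (1 - \<rho>\<^sup>2) * (1 - (norm z)\<^sup>2)" for z :: complex
    by (simp only: cmod_power2) (simp add: power2_eq_square algebra_simps)
  have r: "1 - \<rho>\<^sup>2 > 0" using assms by (simp add: power_less_one_iff abs_square_less_1)
  show "norm z \<le> 1 \<Longrightarrow> 1 + of_real \<rho> * z \<noteq> 0" by (rule nz)
  show "norm (moebius \<rho> z) \<le> 1" if "norm z \<le> 1"
  proof -
    have "(norm z)\<^sup>2 \<le> 1" using that by (simp add: power_le_one)
    then have "(norm (z + of_real \<rho>))\<^sup>2 \<le> (norm (1 + of_real \<rho> * z))\<^sup>2"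
      using id[of z] r by (smt (verit) mult_nonneg_nonneg)
    then show ?thesis using nz[OF that] by (simp add: moebius_def norm_divide divide_le_eq_1)
  qed
  show "norm (moebius \<rho> z) < 1" if "norm z < 1"
  proof -
    have "(norm z)\<^sup>2 < 1" using that by (simp add: power_less_one_iff abs_square_less_1)
    then have "(norm (z + of_real \<rho>))\<^sup>2 < (norm (1 + of_real \<rho> * z))\<^sup>2"
      using id[of z] r by (smt (verit) mult_pos_pos)
    then have "norm (z + of_real \<rho>) < norm (1 + of_real \<rho> * z)" by (rule power2_less_imp_less) auto
    then show ?thesis using nz that by (simp add: moebius_def norm_divide divide_less_eq_1)
  qed
  show "norm (moebius \<rho> z) = 1" if "norm z = 1"
    using id[of z] nz[of z] that by (auto simp: moebius_def norm_divide power2_eq_iff_nonneg)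
qed

lemma moebius_cont_hol:
  assumes "0 \<le> \<rho>" "\<rho> < 1"
  shows "continuous_on (cball 0 1) (moebius \<rho>)" "moebius \<rho> holomorphic_on ball 0 1"
  unfolding moebius_def[abs_def] using moebius_norm(1)[OF assms]
  by (auto intro!: continuous_intros holomorphic_intros)

text \<open>Moving the centre to \<open>\<rho>\<close> makes the disc inequality compare an interior
  value with boundary values. The constant is inherited from the centred case and so does not depend
  on \<open>\<rho>\<close>.\<close>

lemma moebius_deviation_ineq:
  fixes p \<epsilon> :: real
  assumes p: "1 \<le> p" and "0 < \<epsilon>"
  obtains C where "1 \<le> C"
    "\<And>h \<rho>. continuous_on (cball 0 1) h \<Longrightarrow> h holomorphic_on ball 0 1 \<Longrightarrow> 0 \<le> \<rho> \<Longrightarrow> \<rho> < 1 \<Longrightarrow>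
       integral {0..1} (\<lambda>t. norm (h (moebius \<rho> (cis (2 * pi * t))) - h (of_real \<rho>)) powr p) + C * norm (h (of_real \<rho>)) powr p
         \<le> \<epsilon> * norm (h (of_real \<rho>)) powr p + C * integral {0..1} (\<lambda>t. norm (h (moebius \<rho> (cis (2 * pi * t)))) powr p)"
proof -
  obtain C where C: "1 \<le> C"
    "\<And>h. continuous_on (cball 0 1) h \<Longrightarrow> h holomorphic_on ball 0 1 \<Longrightarrow>
       integral {0..1} (\<lambda>t. norm (h (cis (2 * pi * t)) - h 0) powr p) + C * norm (h 0) powr p
         \<le> \<epsilon> * norm (h 0) powr p + C * integral {0..1} (\<lambda>t. norm (h (cis (2 * pi * t))) powr p)"
    using disc_deviation_ineq[OF assms] by metis
  show ?thesis
  proof (rule that[OF C(1)])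
    fix h :: "complex \<Rightarrow> complex" and \<rho> :: real
    assume h: "continuous_on (cball 0 1) h" "h holomorphic_on ball 0 1" "0 \<le> \<rho>" "\<rho> < 1"
    have "continuous_on (cball 0 1) (h \<circ> moebius \<rho>)"
      by (rule continuous_on_compose[OF moebius_cont_hol(1)[OF h(3,4)] continuous_on_subset[OF h(1)]])
         (use moebius_norm[OF h(3,4)] in auto)
    moreover have "(h \<circ> moebius \<rho>) holomorphic_on ball 0 1"
      by (rule holomorphic_on_compose_gen[OF moebius_cont_hol(2)[OF h(3,4)] h(2)])
         (use moebius_norm[OF h(3,4)] in auto)
    ultimately show "integral {0..1} (\<lambda>t. norm (h (moebius \<rho> (cis (2 * pi * t))) - h (of_real \<rho>)) powr p) + C * norm (h (of_real \<rho>)) powr p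
         \<le> \<epsilon> * norm (h (of_real \<rho>)) powr p + C * integral {0..1} (\<lambda>t. norm (h (moebius \<rho> (cis (2 * pi * t)))) powr p)"
      using C(2)[of "h \<circ> moebius \<rho>"] by simp
  qed
qed

section \<open>Holomorphic functions of several variables and the radial derivative\<close>

lemma norm_cscale: "norm (c *s v) = norm c * norm (v :: complex^'d::finite)"
  by (simp add: norm_vec_def norm_mult L2_set_right_distrib)

lemma bounded_bilinear_cscale: "bounded_bilinear ((*s) :: complex \<Rightarrow> complex^'d::finite \<Rightarrow> complex^'d)"
  by (rule bounded_bilinear.intro)
     (auto simp: vec_eq_iff algebra_simps norm_cscale intro!: exI[of _ 1])

lemmas continuous_on_cscale [continuous_intros] = bounded_bilinear.continuous_on[OF bounded_bilinear_cscale]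
lemmas tendsto_cscale [tendsto_intros] = bounded_bilinear.tendsto[OF bounded_bilinear_cscale]
lemmas has_derivative_cscale = bounded_bilinear.FDERIV[OF bounded_bilinear_cscale]

lemma scaleR_cscale: "r *\<^sub>R v = complex_of_real r *s (v :: complex^'d::finite)"
  by (simp add: vec_eq_iff) (simp add: scaleR_conv_of_real)

text \<open>Cauchy's estimate for the second derivative on circles of radius \<open>r / 4\<close>
  about points of the half disc gives \<open>2 * B / (r / 4)^2\<close>, whence the
  \<open>32\<close>. The remainder depends on \<open>g\<close> through the bound \<open>B\<close>
  alone, so it is uniform over families of functions.\<close>

lemma taylor_remainder:
  assumes g: "g holomorphic_on ball 0 r" and B: "\<And>t. t \<in> ball 0 r \<Longrightarrow> norm (g t) \<le> B" and t: "norm t \<le> r / 2"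
    and r: "r > 0"
  shows "norm (g t - g 0 - t * deriv g 0) \<le> 32 * B / r\<^sup>2 * (norm t)\<^sup>2"
proof -
  have hol: "(deriv ^^ n) g holomorphic_on ball 0 r" for n
    using g by (intro holomorphic_higher_deriv) auto
  have b2: "norm ((deriv ^^ 2) g x) \<le> 32 * B / r\<^sup>2" if x: "x \<in> cball 0 (r/2)" for x
  proof -
    have sub: "cball x (r/4) \<subseteq> ball 0 r"
    proof
      fix y assume "y \<in> cball x (r/4)"
      then have "norm (y - x) \<le> r/4" by (simp add: dist_norm norm_minus_commute)
      then show "y \<in> ball 0 r" using x r norm_triangle_sub[of y x] by simp
    qed
    have "norm ((deriv ^^ 2) g x) \<le> fact 2 * B / (r/4)^2"
    proof (rule Cauchy_inequality)
      show "g holomorphic_on ball x (r/4)" using g sub ball_subset_cball holomorphic_on_subset by blast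
      show "continuous_on (cball x (r/4)) g" using g sub holomorphic_on_imp_continuous_on holomorphic_on_subset by blast
      fix y assume "norm (x - y) = r/4"
      then show "norm (g y) \<le> B" using sub by (intro B) (auto simp: dist_norm)
    qed (use r in auto)
    then show ?thesis by (simp add: power_divide fact_numeral)
  qed
  have "norm ((deriv ^^ 0) g t - (\<Sum>i\<le>1. (deriv ^^ i) g 0 * (t - 0) ^ i / fact i))
      \<le> 32 * B / r\<^sup>2 * norm (t - 0) ^ Suc 1 / fact 1"
  proof (rule complex_Taylor[of "cball 0 (r/2)"])
    fix i x assume "x \<in> cball (0::complex) (r/2)"
    then show "((deriv ^^ i) g has_field_derivative (deriv ^^ Suc i) g x) (at x within cball 0 (r/2))"
      using g r by (intro has_field_derivative_at_within[OF has_field_derivative_higher_deriv[of g "ball 0 r"]]) auto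
  qed (use b2 t r in \<open>auto simp: numeral_2_eq_2\<close>)
  then show ?thesis by (simp add: power2_eq_square algebra_simps)
qed

text \<open>This serves the radial derivative, which arises as a locally uniform limit: continuity
  and holomorphy on lines visibly pass to such limits. The Taylor bound on lines is uniform in base
  point and direction, and this uniformity yields both additivity of the directional derivative and
  a quadratic remainder.\<close>

lemma holomorphic_vec_on_lines:
  fixes f :: "complex^'d::finite \<Rightarrow> complex"
  assumes S: "open S" and cont: "continuous_on S f"
    and lines: "\<And>z v. z \<in> S \<Longrightarrow> (\<lambda>t. f (z + t *s v)) holomorphic_on {t. z + t *s v \<in> S}"
  shows "holomorphic_vec_on f S"
  unfolding holomorphic_vec_on_def
proof
  fix z assume z: "z \<in> S"
  obtain R where R: "R > 0" "cball z R \<subseteq> S" using S z open_contains_cball by blast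
  have "compact (f ` cball z R)"
    by (rule compact_continuous_image) (use cont R continuous_on_subset in auto)
  then obtain B where B: "\<And>x. x \<in> cball z R \<Longrightarrow> norm (f x) \<le> B"
    using compact_imp_bounded bounded_iff by (metis imageI)
  define D where "D = (\<lambda>x v. deriv (\<lambda>t. f (x + t *s v)) 0)"
  define C where "C = 32 * B / (R/2)\<^sup>2"
  have inR: "x + t *s v \<in> cball z R" if "x \<in> ball z (R/2)" "norm v \<le> 1" "norm t \<le> R/2" for x v t
  proof -
    have "norm t * norm v \<le> R/2 * 1" using that R by (intro mult_mono) auto
    moreover have "norm (x + t *s v - z) \<le> norm (x - z) + norm (t *s v)"
      using norm_triangle_ineq[of "x - z" "t *s v"] by (simp add: algebra_simps)
    ultimately show ?thesis using that by (simp add: dist_norm norm_minus_commute norm_cscale)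
  qed
  have T: "norm (f (x + t *s v) - f x - t * D x v) \<le> C * (norm t)\<^sup>2"
    if x: "x \<in> ball z (R/2)" and v: "norm v \<le> 1" and t: "norm t \<le> R/4" for x v t
  proof -
    have "x \<in> S" using x R by (metis (no_types) less_imp_le mem_ball mem_cball order_trans subsetD half_gt_zero field_sum_of_halves less_add_same_cancel1)
    have "norm (f (x + t *s v) - f (x + 0 *s v) - t * deriv (\<lambda>t. f (x + t *s v)) 0) \<le> C * (norm t)\<^sup>2"
      unfolding C_def
    proof (rule taylor_remainder)
      show "(\<lambda>t. f (x + t *s v)) holomorphic_on ball 0 (R/2)"
        using inR[OF x v] R by (intro holomorphic_on_subset[OF lines[OF \<open>x \<in> S\<close>]]) auto
      show "norm (f (x + t *s v)) \<le> B" if "t \<in> ball 0 (R/2)" for t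
        using inR[OF x v, of t] that by (intro B) auto
    qed (use t R in auto)
    then show ?thesis by (simp add: D_def)
  qed
  have dv: "((\<lambda>t. f (z + t *s v)) has_field_derivative D z v) (at 0)" for v
  proof -
    have "continuous_on UNIV (\<lambda>t. z + t *s v)" by (intro continuous_intros)
    then have "open {t. z + t *s v \<in> S}"
      using open_vimage[OF S] by (simp add: vimage_def)
    then show ?thesis unfolding D_def
      by (rule holomorphic_derivI[OF lines[OF z]]) (use z in auto)
  qed
  have scale: "D z (c *s v) = c * D z v" for c v
  proof -
    have 1: "((\<lambda>t. t * c) has_field_derivative c) (at 0)" by (auto intro!: derivative_eq_intros)
    have "((\<lambda>t. f (z + (t * c) *s v)) has_field_derivative D z v * c) (at 0)"
      using DERIV_chain2[of "\<lambda>t. f (z + t *s v)" "D z v" "\<lambda>t. t * c" 0 c UNIV] dv[of v] 1 by simp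
    then have "((\<lambda>t. f (z + t *s (c *s v))) has_field_derivative c * D z v) (at 0)"
      by (simp add: mult.commute)
    then show ?thesis using dv DERIV_unique by blast
  qed
  \<comment> \<open>Continuity in the base point, obtained from a uniform limit of difference
    quotients, is what the additivity argument needs.\<close>
  have contD: "continuous_on (ball z (R/2)) (\<lambda>x. D x v)" if v: "norm v \<le> 1" for v
  proof (rule uniform_limit_theorem)
    let ?F = "at (0::complex) within cball 0 (R/4)"
    show "uniform_limit (ball z (R/2)) (\<lambda>t x. (f (x + t *s v) - f x) / t) (\<lambda>x. D x v) (at 0 within cball 0 (R/4))"
    proof (rule uniform_limitI)
      fix e :: real assume e: "e > 0"
      have "((\<lambda>t::complex. C * norm t) \<longlongrightarrow> C * norm (0::complex)) ?F" by (intro tendsto_intros)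
      then have "\<forall>\<^sub>F t in ?F. C * norm t < e" using e by (intro order_tendstoD) auto
      moreover have "\<forall>\<^sub>F t in ?F. t \<in> cball 0 (R/4) \<and> t \<noteq> 0" by (auto simp: eventually_at_filter)
      ultimately show "\<forall>\<^sub>F t in ?F. \<forall>x\<in>ball z (R/2). dist ((f (x + t *s v) - f x) / t) (D x v) < e"
      proof eventually_elim
        case (elim t)
        show ?case
        proof
          fix x assume x: "x \<in> ball z (R/2)"
          have "dist ((f (x + t *s v) - f x) / t) (D x v) = norm (f (x + t *s v) - f x - t * D x v) / norm t"
            using elim by (simp add: dist_norm field_simps flip: norm_divide)
          also have "\<dots> \<le> C * (norm t)\<^sup>2 / norm t"
            using T[OF x v, of t] elim by (intro divide_right_mono) auto
          also have "\<dots> = C * norm t" by (simp add: power2_eq_square)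
          finally show "dist ((f (x + t *s v) - f x) / t) (D x v) < e" using elim by simp
        qed
      qed
    qed
    show "\<forall>\<^sub>F t in ?F. continuous_on (ball z (R/2)) (\<lambda>x. (f (x + t *s v) - f x) / t)"
    proof -
      have "\<forall>\<^sub>F t in ?F. t \<in> cball 0 (R/4) \<and> t \<noteq> 0" by (auto simp: eventually_at_filter)
      then show ?thesis
      proof eventually_elim
        case (elim t)
        have sub: "x + t *s v \<in> S" "x \<in> S" if "x \<in> ball z (R/2)" for x
          using inR[OF that v, of t] inR[OF that v, of 0] R elim by auto
        show ?case using elim sub
          by (intro continuous_intros continuous_on_compose2[OF cont]) auto
      qed
    qed
    show "?F \<noteq> bot"
      using R by (subst at_within_interior) auto
  qed
  \<comment> \<open>Go from \<open>z\<close> to \<open>z + t *s (u + v)\<close> directly and by way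
    of \<open>z + t *s u\<close>. The first order terms agree up to a multiple of
    \<open>(norm t)^2\<close>; after division by \<open>t\<close>, letting \<open>t\<close> tend to
    \<open>0\<close> moves the base point of the second leg back to \<open>z\<close>.\<close>
  have add: "D z (u + v) = D z u + D z v" if u: "norm u \<le> 1" and v: "norm v \<le> 1" and uv: "norm (u + v) \<le> 1" for u v
  proof -
    have "((\<lambda>t. D (z + t *s u) v) \<longlongrightarrow> D (z + 0 *s u) v) (at (0::complex))"
    proof (rule continuous_on_tendsto_compose[OF contD[OF v]])
      have l: "((\<lambda>t. z + t *s u) \<longlongrightarrow> z + 0 *s u) (at (0::complex))" by (intro tendsto_intros)
      then show "((\<lambda>t. z + t *s u) \<longlongrightarrow> z + 0 *s u) (at (0::complex))" .
      show "\<forall>\<^sub>F t in at (0::complex). z + t *s u \<in> ball z (R/2)"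
        using topological_tendstoD[OF l, of "ball z (R/2)"] R by simp
    qed (use R in auto)
    then have l1: "((\<lambda>t. norm (D z (u + v) - D (z + t *s u) v - D z u)) \<longlongrightarrow> norm (D z (u + v) - D z v - D z u)) (at (0::complex))"
      by (intro tendsto_intros) auto
    have l2: "((\<lambda>t::complex. 3 * C * norm t) \<longlongrightarrow> 3 * C * norm (0::complex)) (at 0)" by (intro tendsto_intros)
    have "\<forall>\<^sub>F t in at (0::complex). norm (D z (u + v) - D (z + t *s u) v - D z u) \<le> 3 * C * norm t"
      unfolding eventually_at
    proof (intro exI[of _ "R/4"] conjI ballI impI)
      fix t :: complex assume t: "t \<noteq> 0 \<and> dist t 0 < R/4"
      have zb: "z \<in> ball z (R/2)" using R by simp
      have "norm t * norm u \<le> R/4 * 1" using t u R by (intro mult_mono) auto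
      then have ztu: "z + t *s u \<in> ball z (R/2)" using t R by (simp add: dist_norm norm_cscale)
      have "norm (f (z + t *s (u + v)) - f z - t * D z (u + v)) \<le> C * (norm t)\<^sup>2"
        "norm (f (z + t *s u + t *s v) - f (z + t *s u) - t * D (z + t *s u) v) \<le> C * (norm t)\<^sup>2"
        "norm (f (z + t *s u) - f z - t * D z u) \<le> C * (norm t)\<^sup>2"
        using T[OF zb uv, of t] T[OF ztu v, of t] T[OF zb u, of t] t by auto
      moreover have "z + t *s (u + v) = z + t *s u + t *s v" by (simp add: vec_eq_iff algebra_simps)
      moreover have "norm (b + c - a) \<le> K + K + K" if "norm a \<le> K" "norm b \<le> K" "norm c \<le> K"
        for a b c :: complex and K
        using norm_triangle_ineq4[of "b + c" a] norm_triangle_ineq[of b c] that by linarith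
      ultimately have "norm ((f (z + t *s u + t *s v) - f (z + t *s u) - t * D (z + t *s u) v)
          + (f (z + t *s u) - f z - t * D z u) - (f (z + t *s (u + v)) - f z - t * D z (u + v)))
        \<le> C * (norm t)\<^sup>2 + C * (norm t)\<^sup>2 + C * (norm t)\<^sup>2"
        by blast
      then have "norm (t * (D z (u + v) - D (z + t *s u) v - D z u)) \<le> 3 * (C * (norm t)\<^sup>2)"
        using \<open>z + t *s (u + v) = z + t *s u + t *s v\<close> by (simp add: algebra_simps)
      then have "norm t * norm (D z (u + v) - D (z + t *s u) v - D z u) \<le> norm t * (3 * C * norm t)"
        by (simp add: norm_mult power2_eq_square mult_ac)
      then show "norm (D z (u + v) - D (z + t *s u) v - D z u) \<le> 3 * C * norm t" using t by simp
    qed (use R in auto)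
    from tendsto_le[OF _ l2 l1 this] have "norm (D z (u + v) - D z v - D z u) \<le> 0" by simp
    then show ?thesis by (simp add: algebra_simps)
  qed
  have add': "D z (u + v) = D z u + D z v" for u v
  proof -
    \<comment> \<open>Homogeneity removes the restriction to norm at most \<open>1\<close>: this
      factor shrinks \<open>u\<close>, \<open>v\<close> and \<open>u + v\<close> into the unit ball
      at once.\<close>
    define k where "k = 1 / (1 + norm u + norm v)"
    define c where "c = complex_of_real k"
    have pos: "0 < 1 + norm u + norm v" by (smt (verit) norm_ge_zero)
    then have k: "k > 0" "k * (1 + norm u + norm v) = 1" by (auto simp: k_def)
    have le: "norm (c *s w) \<le> 1" if "norm w \<le> 1 + norm u + norm v" for w
      using mult_left_mono[OF that, of k] k by (simp add: c_def norm_cscale)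
    have "D z (c *s u + c *s v) = D z (c *s u) + D z (c *s v)"
    proof (rule add)
      have "c *s u + c *s v = c *s (u + v)" by (simp add: vec_eq_iff algebra_simps)
      then show "norm (c *s u + c *s v) \<le> 1" using le[of "u + v"] norm_triangle_ineq[of u v] by simp
    qed (use le[of u] le[of v] in auto)
    moreover have "c *s u + c *s v = c *s (u + v)" by (simp add: vec_eq_iff algebra_simps)
    ultimately have "c * D z (u + v) = c * (D z u + D z v)" by (simp only: scale distrib_left)
    then show ?thesis using k by (simp add: c_def)
  qed
  have "(f has_derivative D z) (at z within S)"
  proof (rule has_derivativeI_sandwich[where e="R/4" and H="\<lambda>y. C * norm (y - z)"])
    have "linear (D z)"
      by (rule linearI) (simp_all only: add' scaleR_cscale scale scaleR_conv_of_real)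
    then show "bounded_linear (D z)" by (simp add: linear_conv_bounded_linear)
    show "((\<lambda>y. C * norm (y - z)) \<longlongrightarrow> 0) (at z within S)"
      by (rule tendsto_eq_intros refl)+ simp
    fix y assume y: "y \<in> S" "y \<noteq> z" "dist y z < R/4"
    \<comment> \<open>A real step length and a unit direction bring an arbitrary increment into the
      scope of \<open>T\<close>.\<close>
    define t where "t = complex_of_real (norm (y - z))"
    define v where "v = (1/t) *s (y - z)"
    have t: "t \<noteq> 0" "norm t = norm (y - z)" using y by (auto simp: t_def)
    have tv: "t *s v = y - z" using t by (simp add: v_def)
    have "norm v \<le> 1" unfolding v_def norm_cscale using t by (simp add: norm_divide)
    then have "norm (f (z + t *s v) - f z - t * D z v) \<le> C * (norm t)\<^sup>2"
      using T[of z v t] R y t by (auto simp: dist_norm)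
    then have "norm (f y - f z - D z (y - z)) \<le> C * (norm (y - z))\<^sup>2"
      using scale[of t v] t tv by simp
    then show "norm ((f y - f z) - D z (y - z)) / norm (y - z) \<le> C * norm (y - z)"
      using y by (simp add: divide_le_eq power2_eq_square mult_ac)
  qed (use R in auto)
  then show "\<exists>f'. (f has_derivative f') (at z within S) \<and> (\<forall>c v. f' (c *s v) = c * f' v)"
    using scale by blast
qed

section \<open>Rules for holomorphic functions of several variables\<close>

lemma holomorphic_vec_onD:
  assumes "holomorphic_vec_on f S" "open S" "z \<in> S"
  obtains f' where "(f has_derivative f') (at z)" "\<And>c v. f' (c *s v) = c * f' v"
proof -
  obtain f' where "(f has_derivative f') (at z within S)" "\<forall>c v. f' (c *s v) = c * f' v"
    using assms unfolding holomorphic_vec_on_def by blast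
  then show ?thesis using that assms at_within_open by metis
qed

lemma holomorphic_vec_onI:
  assumes "\<And>z. z \<in> S \<Longrightarrow> \<exists>f'. (f has_derivative f') (at z) \<and> (\<forall>c v. f' (c *s v) = c * f' v)"
  shows "holomorphic_vec_on f S"
  unfolding holomorphic_vec_on_def using assms has_derivative_at_withinI by blast

lemma holomorphic_vec_on_imp_continuous_on:
  "holomorphic_vec_on f S \<Longrightarrow> continuous_on S f"
  unfolding holomorphic_vec_on_def continuous_on_eq_continuous_within
  using has_derivative_continuous by blast

lemma holomorphic_vec_on_const: "holomorphic_vec_on (\<lambda>_. k) S"
  by (rule holomorphic_vec_onI) (auto intro!: exI[of _ "\<lambda>_. 0"])

lemma holomorphic_vec_on_add:
  assumes "holomorphic_vec_on f S" "holomorphic_vec_on g S" "open S"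
  shows "holomorphic_vec_on (\<lambda>z. f z + g z) S"
proof (rule holomorphic_vec_onI)
  fix z assume "z \<in> S"
  then obtain f' g' where f': "(f has_derivative f') (at z)" "\<And>c v. f' (c *s v) = c * f' v"
    and g': "(g has_derivative g') (at z)" "\<And>c v. g' (c *s v) = c * g' v"
    using assms holomorphic_vec_onD by metis
  then show "\<exists>D. ((\<lambda>z. f z + g z) has_derivative D) (at z) \<and> (\<forall>c v. D (c *s v) = c * D v)"
    by (intro exI[of _ "\<lambda>v. f' v + g' v"]) (auto intro!: derivative_intros simp: algebra_simps)
qed

lemma holomorphic_vec_on_mult:
  assumes "holomorphic_vec_on f S" "holomorphic_vec_on g S" "open S"
  shows "holomorphic_vec_on (\<lambda>z. f z * g z) S"
proof (rule holomorphic_vec_onI)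
  fix z assume "z \<in> S"
  then obtain f' g' where f': "(f has_derivative f') (at z)" "\<And>c v. f' (c *s v) = c * f' v"
    and g': "(g has_derivative g') (at z)" "\<And>c v. g' (c *s v) = c * g' v"
    using assms holomorphic_vec_onD by metis
  then show "\<exists>D. ((\<lambda>z. f z * g z) has_derivative D) (at z) \<and> (\<forall>c v. D (c *s v) = c * D v)"
    by (intro exI[of _ "\<lambda>v. f z * g' v + f' v * g z"]) (auto intro!: derivative_intros simp: algebra_simps)
qed

lemma holomorphic_vec_on_diff:
  assumes "holomorphic_vec_on f S" "holomorphic_vec_on g S" "open S"
  shows "holomorphic_vec_on (\<lambda>z. f z - g z) S"
  using holomorphic_vec_on_add[OF assms(1) holomorphic_vec_on_mult[OF holomorphic_vec_on_const[of "-1"] assms(2,3)] assms(3)]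
  by simp

lemma holomorphic_vec_on_cong:
  assumes f: "holomorphic_vec_on f S" and eq: "\<And>z. z \<in> S \<Longrightarrow> f z = g z" and S: "open S"
  shows "holomorphic_vec_on g S"
proof (rule holomorphic_vec_onI)
  fix z assume z: "z \<in> S"
  then obtain f' where f': "(f has_derivative f') (at z)" "\<And>c v. f' (c *s v) = c * f' v"
    using holomorphic_vec_onD[OF f S] by blast
  have "(g has_derivative f') (at z)"
    by (rule has_derivative_transform_within_open[OF f'(1) S z]) (rule eq)
  then show "\<exists>f'. (g has_derivative f') (at z) \<and> (\<forall>c v. f' (c *s v) = c * f' v)"
    using f'(2) by blast
qed

lemma norm_scaleR_less_1:
  fixes z :: "'a::real_normed_vector"
  shows "0 \<le> s \<Longrightarrow> s \<le> 1 \<Longrightarrow> norm z < 1 \<Longrightarrow> norm (s *\<^sub>R z) < 1"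
  using mult_left_le_one_le[of "norm z" s] by simp

lemma has_derivative_dilate:
  assumes "(f has_derivative f') (at (s *\<^sub>R z))"
  shows "((\<lambda>z. f (s *\<^sub>R z)) has_derivative (\<lambda>v. f' (s *\<^sub>R v))) (at z)"
proof -
  have "((*\<^sub>R) s has_derivative (*\<^sub>R) s) (at z)"
    by (auto intro!: derivative_eq_intros)
  from has_derivative_compose[OF this, of f f'] assms show ?thesis by simp
qed

lemma holomorphic_vec_on_dilate:
  fixes f :: "complex^'d::finite \<Rightarrow> complex"
  assumes "holomorphic_vec_on f (ball 0 1)" "0 \<le> s" "s \<le> 1"
  shows "holomorphic_vec_on (\<lambda>z. f (s *\<^sub>R z)) (ball 0 1)"
proof (rule holomorphic_vec_onI)
  fix z :: "complex^'d" assume "z \<in> ball 0 1"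
  then have "s *\<^sub>R z \<in> ball 0 1" using assms norm_scaleR_less_1[of s z] by simp
  then obtain f' where f': "(f has_derivative f') (at (s *\<^sub>R z))" "\<And>c v. f' (c *s v) = c * f' v"
    using assms holomorphic_vec_onD by (metis open_ball)
  have "s *\<^sub>R (c *s v) = c *s (s *\<^sub>R v)" for c and v :: "complex^'d" by (simp add: vec_eq_iff)
  then show "\<exists>D. ((\<lambda>z. f (s *\<^sub>R z)) has_derivative D) (at z) \<and> (\<forall>c v. D (c *s v) = c * D v)"
    using has_derivative_dilate[OF f'(1)] f'(2) by (intro exI[of _ "\<lambda>v. f' (s *\<^sub>R v)"]) auto
qed

section \<open>Complex lines and the radial derivative\<close>

lemma has_field_derivative_line:
  fixes f :: "complex^'d::finite \<Rightarrow> complex"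
  assumes f': "(f has_derivative f') (at (z + t *s v))" "\<And>c v. f' (c *s v) = c * f' v"
  shows "((\<lambda>t. f (z + t *s v)) has_field_derivative f' v) (at t)"
proof -
  have "((\<lambda>t. t *s v) has_derivative (\<lambda>h. t *s 0 + h *s v)) (at t)"
    by (rule has_derivative_cscale) (auto intro!: derivative_intros)
  then have "((\<lambda>t. t *s v) has_derivative (\<lambda>h. h *s v)) (at t)" by (simp add: vec_eq_iff)
  then have "((\<lambda>t. z + t *s v) has_derivative (\<lambda>h. 0 + h *s v)) (at t)"
    by (rule has_derivative_add[OF has_derivative_const])
  then have l: "((\<lambda>t. z + t *s v) has_derivative (\<lambda>h. h *s v)) (at t)" by simp
  have "((\<lambda>t. f (z + t *s v)) has_derivative (\<lambda>h. f' (h *s v))) (at t)"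
    by (rule has_derivative_compose[OF l f'(1)])
  then show ?thesis by (simp add: has_field_derivative_def f'(2) mult.commute[of "f' v"] mult_commute_abs)
qed

lemma holomorphic_on_line:
  assumes "holomorphic_vec_on f S" "open S" "\<And>t. t \<in> T \<Longrightarrow> z + t *s v \<in> S"
  shows "(\<lambda>t. f (z + t *s v)) holomorphic_on T"
  unfolding holomorphic_on_def
proof
  fix t assume t: "t \<in> T"
  obtain f' where f': "(f has_derivative f') (at (z + t *s v))" "\<And>c v. f' (c *s v) = c * f' v"
    using holomorphic_vec_onD[OF assms(1,2) assms(3)[OF t]] by blast
  show "(\<lambda>t. f (z + t *s v)) field_differentiable at t within T"
    unfolding field_differentiable_def
    using has_field_derivative_at_within[OF has_field_derivative_line[OF f']] by blast
qed

text \<open>Expand the position vector in the standard basis and use complex linearity of the total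
  derivative. Through this formula the sum, product and chain rules of \<open>has_derivative\<close>
  become rules for the radial derivative.\<close>

lemma radial_deriv_eq:
  fixes f :: "complex^'d::finite \<Rightarrow> complex"
  assumes f': "(f has_derivative f') (at z)" "\<And>c v. f' (c *s v) = c * f' v"
  shows "radial_deriv f z = f' z"
proof -
  have ax: "axis j t = t *s axis j (1::complex)" for j :: 'd and t by (simp add: vec_eq_iff axis_def)
  have pd: "partial_deriv j f z = f' (axis j 1)" for j
  proof -
    have "((\<lambda>t. f (z + t *s axis j 1)) has_field_derivative f' (axis j 1)) (at 0)"
      by (rule has_field_derivative_line) (use f' in \<open>auto simp: vec_eq_iff\<close>)
    moreover have "(\<lambda>t. f (z + axis j t)) = (\<lambda>t. f (z + t *s axis j 1))" using ax by metis
    ultimately show ?thesis unfolding partial_deriv_def by (simp add: DERIV_imp_deriv)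
  qed
  have "linear f'" using f'(1) has_derivative_linear by blast
  have "f' z = f' (\<Sum>j\<in>UNIV. z $ j *s axis j 1)" by (simp only: basis_expansion)
  also have "\<dots> = (\<Sum>j\<in>UNIV. f' (z $ j *s axis j 1))" by (rule linear_sum[OF \<open>linear f'\<close>])
  also have "\<dots> = radial_deriv f z" by (simp add: radial_deriv_def pd f'(2))
  finally show ?thesis by simp
qed

text \<open>Functions are total, so an identity valid only in the ball has to be localized before
  the operator can be iterated.\<close>

lemma radial_deriv_cong:
  assumes "\<And>z. z \<in> S \<Longrightarrow> f z = g z" "open S" "holomorphic_vec_on f S" "z \<in> S"
  shows "radial_deriv f z = radial_deriv g z"
proof -
  obtain f' where f': "(f has_derivative f') (at z)" "\<And>c v. f' (c *s v) = c * f' v"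
    using assms holomorphic_vec_onD by metis
  moreover have "(g has_derivative f') (at z)"
    using has_derivative_transform_within_open[OF f'(1) assms(2,4)] assms(1) by blast
  ultimately show ?thesis using radial_deriv_eq by metis
qed

lemma radial_deriv_const: "radial_deriv (\<lambda>_. k) z = 0"
  using radial_deriv_eq[of "\<lambda>_. k" "\<lambda>_. 0"] by simp

lemma
  assumes f: "holomorphic_vec_on f S" and g: "holomorphic_vec_on g S" and S: "open S" "z \<in> S"
  shows radial_deriv_add: "radial_deriv (\<lambda>z. f z + g z) z = radial_deriv f z + radial_deriv g z"
    and radial_deriv_mult: "radial_deriv (\<lambda>z. f z * g z) z = radial_deriv f z * g z + f z * radial_deriv g z"
proof -
  obtain f' where f': "(f has_derivative f') (at z)" "\<And>c v. f' (c *s v) = c * f' v"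
    using f S holomorphic_vec_onD by metis
  obtain g' where g': "(g has_derivative g') (at z)" "\<And>c v. g' (c *s v) = c * g' v"
    using g S holomorphic_vec_onD by metis
  have "((\<lambda>z. f z + g z) has_derivative (\<lambda>v. f' v + g' v)) (at z)"
    "((\<lambda>z. f z * g z) has_derivative (\<lambda>v. f z * g' v + f' v * g z)) (at z)"
    using f' g' by (auto intro!: derivative_intros)
  from this[THEN radial_deriv_eq]
  show "radial_deriv (\<lambda>z. f z + g z) z = radial_deriv f z + radial_deriv g z"
    "radial_deriv (\<lambda>z. f z * g z) z = radial_deriv f z * g z + f z * radial_deriv g z"
    using radial_deriv_eq[OF f'] radial_deriv_eq[OF g'] by (auto simp: f' g' algebra_simps)
qed

text \<open>The factor \<open>s\<close> from the chain rule is absorbed into the position vector.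
  The operator therefore commutes with dilations exactly, with no powers of \<open>s\<close> left
  over.\<close>

lemma radial_deriv_dilate:
  fixes f :: "complex^'d::finite \<Rightarrow> complex"
  assumes f: "holomorphic_vec_on f (ball 0 1)" and "0 \<le> s" "s \<le> 1" "z \<in> ball 0 1"
  shows "radial_deriv (\<lambda>z. f (s *\<^sub>R z)) z = radial_deriv f (s *\<^sub>R z)"
proof -
  have "s *\<^sub>R z \<in> ball 0 1" using assms norm_scaleR_less_1[of s z] by simp
  then obtain f' where f': "(f has_derivative f') (at (s *\<^sub>R z))" "\<And>c v. f' (c *s v) = c * f' v"
    using f holomorphic_vec_onD by (metis open_ball)
  have "s *\<^sub>R (c *s v) = c *s (s *\<^sub>R v)" for c and v :: "complex^'d" by (simp add: vec_eq_iff)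
  then show ?thesis
    using radial_deriv_eq[OF has_derivative_dilate[OF f'(1)]] radial_deriv_eq[OF f'] f'(2) by auto
qed

text \<open>Where \<open>norm t = 1\<close>, the slice derivative and the radial derivative have the
  same modulus; \<open>smean_diff_0_le\<close> rests on this.\<close>

lemma has_field_derivative_slice:
  assumes f: "holomorphic_vec_on f S" "open S" "t *s z \<in> S"
  obtains D where "((\<lambda>t. f (t *s z)) has_field_derivative D) (at t)" "radial_deriv f (t *s z) = t * D"
proof -
  obtain f' where f': "(f has_derivative f') (at (t *s z))" "\<And>c v. f' (c *s v) = c * f' v"
    using f holomorphic_vec_onD by metis
  have "((\<lambda>t. f (t *s z)) has_field_derivative f' z) (at t)"
    using has_field_derivative_line[of f f' 0 t z] f' by simp
  then show ?thesis using that radial_deriv_eq[OF f'] f'(2) by metis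
qed

text \<open>The increment \<open>t *s z\<close> is radial, so the quotient compares \<open>f\<close>
  with its complex dilation by \<open>1 + t\<close>. In this form the radial derivative is a limit
  of functions whose holomorphy is evident. Uniformity comes from the Taylor bound applied to all
  radial lines at once.\<close>

lemma uniform_limit_radial_deriv:
  fixes f :: "complex^'d::finite \<Rightarrow> complex"
  assumes f: "holomorphic_vec_on f (ball 0 1)" and r: "0 < r" "r < 1"
  shows "uniform_limit (cball 0 r) (\<lambda>t z. (f (z + t *s z) - f z) / t) (radial_deriv f) (at 0)"
proof -
  define d where "d = (1 - r) / 2"
  have d: "d > 0" "r + d < 1" using r by (auto simp: d_def field_simps)
  have cont: "continuous_on (ball 0 1) f" by (rule holomorphic_vec_on_imp_continuous_on[OF f])
  have "compact (f ` cball 0 (r + d))"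
    by (rule compact_continuous_image, rule continuous_on_subset[OF cont]) (use d in auto)
  then obtain B where B: "\<And>x. x \<in> cball 0 (r + d) \<Longrightarrow> norm (f x) \<le> B"
    using compact_imp_bounded bounded_iff by (metis imageI)
  define C where "C = 32 * B / d\<^sup>2"
  have in_ball: "z + t *s z \<in> cball 0 (r + d)" if "z \<in> cball 0 r" "norm t \<le> d" for z :: "complex^'d" and t
  proof -
    have "norm t * norm z \<le> d * 1" using that r d by (intro mult_mono) auto
    then show ?thesis using that norm_triangle_ineq[of z "t *s z"] by (simp add: norm_cscale)
  qed
  have T: "norm (f (z + t *s z) - f z - t * radial_deriv f z) \<le> C * (norm t)\<^sup>2"
    if z: "z \<in> cball 0 r" and t: "norm t \<le> d/2" for z t
  proof -
    have "z \<in> ball 0 1" using z r by simp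
    then obtain f' where f': "(f has_derivative f') (at z)" "\<And>c v. f' (c *s v) = c * f' v"
      using f holomorphic_vec_onD by (metis open_ball)
    have "((\<lambda>t. f (z + t *s z)) has_field_derivative f' z) (at 0)"
      by (rule has_field_derivative_line) (use f' in auto)
    then have D: "deriv (\<lambda>t. f (z + t *s z)) 0 = radial_deriv f z"
      using radial_deriv_eq[OF f'] DERIV_imp_deriv by metis
    have "norm (f (z + t *s z) - f (z + 0 *s z) - t * deriv (\<lambda>t. f (z + t *s z)) 0) \<le> C * (norm t)\<^sup>2"
      unfolding C_def
    proof (rule taylor_remainder)
      show "(\<lambda>t. f (z + t *s z)) holomorphic_on ball 0 d"
      proof (rule holomorphic_on_line[OF f])
        fix t :: complex assume "t \<in> ball 0 d"
        then show "z + t *s z \<in> ball 0 1" using in_ball[OF z, of t] d by simp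
      qed simp
      show "norm (f (z + t *s z)) \<le> B" if "t \<in> ball 0 d" for t
        using in_ball[OF z, of t] that by (intro B) auto
    qed (use t d in auto)
    then show ?thesis by (simp add: D)
  qed
  show ?thesis
  proof (rule uniform_limitI)
    fix e :: real assume e: "e > 0"
    have "((\<lambda>t::complex. C * norm t) \<longlongrightarrow> C * norm (0::complex)) (at 0)" by (intro tendsto_intros)
    then have "\<forall>\<^sub>F t in at (0::complex). C * norm t < e" using e by (intro order_tendstoD) auto
    moreover have "\<forall>\<^sub>F t in at (0::complex). norm t \<le> d/2 \<and> t \<noteq> 0"
      unfolding eventually_at by (rule exI[of _ "d/2"]) (use d in auto)
    ultimately show "\<forall>\<^sub>F t in at 0. \<forall>z\<in>cball 0 r. dist ((f (z + t *s z) - f z) / t) (radial_deriv f z) < e"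
    proof eventually_elim
      case (elim t)
      show ?case
      proof
        fix z :: "complex^'d" assume z: "z \<in> cball 0 r"
        have "dist ((f (z + t *s z) - f z) / t) (radial_deriv f z) = norm (f (z + t *s z) - f z - t * radial_deriv f z) / norm t"
          using elim by (simp add: dist_norm field_simps flip: norm_divide)
        also have "\<dots> \<le> C * (norm t)\<^sup>2 / norm t"
          using T[OF z, of t] elim by (intro divide_right_mono) auto
        also have "\<dots> = C * norm t" by (simp add: power2_eq_square)
        finally show "dist ((f (z + t *s z) - f z) / t) (radial_deriv f z) < e" using elim by simp
      qed
    qed
  qed
qed

lemma eventually_dilation_in_ball:
  fixes r :: real
  assumes "0 < r" "r < 1"
  shows "\<forall>\<^sub>F t in at (0::complex). \<forall>z::complex^'d::finite. norm z \<le> r \<longrightarrow> norm (z + t *s z) < 1"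
proof -
  have "\<forall>\<^sub>F t in at (0::complex). norm t \<le> (1 - r) / 2 \<and> t \<noteq> 0"
    unfolding eventually_at by (rule exI[of _ "(1 - r) / 2"]) (use assms in auto)
  then show ?thesis
  proof eventually_elim
    case (elim t)
    show ?case
    proof (intro allI impI)
      fix z :: "complex^'d" assume z: "norm z \<le> r"
      have "norm t * norm z \<le> (1 - r) / 2 * 1" using elim z assms by (intro mult_mono) auto
      moreover have "norm (z + t *s z) \<le> norm z + norm t * norm z" using norm_triangle_ineq[of z "t *s z"] by (simp add: norm_cscale)
      ultimately show "norm (z + t *s z) < 1" using z assms by simp
    qed
  qed
qed

text \<open>The quotients of \<open>uniform_limit_radial_deriv\<close> are continuous, and they are
  holomorphic along complex lines because complex dilations map lines to lines. Both properties
  survive the uniform limit, and \<open>holomorphic_vec_on_lines\<close> concludes. Without this the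
  operator could not be iterated.\<close>

lemma holomorphic_radial_deriv:
  fixes f :: "complex^'d::finite \<Rightarrow> complex"
  assumes f: "holomorphic_vec_on f (ball 0 1)"
  shows "holomorphic_vec_on (radial_deriv f) (ball 0 1)"
proof (rule holomorphic_vec_on_lines)
  have cont: "continuous_on (ball 0 1) f" by (rule holomorphic_vec_on_imp_continuous_on[OF f])
  have nontriv: "at (0::complex) \<noteq> bot" by simp
  have contr: "continuous_on (cball 0 r) (radial_deriv f)" if r: "0 < r" "r < 1" for r
  proof (rule uniform_limit_theorem)
    show "uniform_limit (cball 0 r) (\<lambda>t z. (f (z + t *s z) - f z) / t) (radial_deriv f) (at 0)"
      by (rule uniform_limit_radial_deriv[OF f r])
    show "\<forall>\<^sub>F t in at 0. continuous_on (cball 0 r) (\<lambda>z. (f (z + t *s z) - f z) / t)"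
      using eventually_dilation_in_ball[where 'd='d, OF r] eventually_neq_at_within[of 0 0 UNIV]
    proof eventually_elim
      case (elim t)
      then show ?case using r
        by (intro continuous_intros continuous_on_compose2[OF cont]) auto
    qed
  qed (rule nontriv)
  show "continuous_on (ball 0 1) (radial_deriv f)"
  proof (rule continuous_at_imp_continuous_on, rule ballI)
    fix z :: "complex^'d" assume z: "z \<in> ball 0 1"
    define r where "r = (1 + norm z) / 2"
    have r: "0 < r" "r < 1" "norm z < r" using z by (auto simp: r_def add_pos_nonneg)
    show "isCont (radial_deriv f) z"
      by (rule continuous_on_interior[OF contr[OF r(1,2)]]) (use r in simp)
  qed
  fix z v :: "complex^'d" assume "z \<in> ball 0 1"
  show "(\<lambda>t. radial_deriv f (z + t *s v)) holomorphic_on {t. z + t *s v \<in> ball 0 1}"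
    unfolding holomorphic_on_def
  proof
    fix t0 assume "t0 \<in> {t. z + t *s v \<in> ball 0 1}"
    then have t0: "norm (z + t0 *s v) < 1" by simp
    define r where "r = (1 + norm (z + t0 *s v)) / 2"
    have r: "0 < r" "r < 1" "norm (z + t0 *s v) < r" using t0 by (auto simp: r_def add_pos_nonneg)
    have "continuous_on UNIV (\<lambda>t. z + t *s v)" by (intro continuous_intros)
    then have "open {t. z + t *s v \<in> ball 0 r}"
      using open_vimage[of "ball 0 r" "\<lambda>t. z + t *s v"] by (simp add: vimage_def)
    moreover have "t0 \<in> {t. z + t *s v \<in> ball 0 r}" using r by simp
    ultimately obtain e where e: "e > 0" "cball t0 e \<subseteq> {t. z + t *s v \<in> ball 0 r}"
      using open_contains_cball by blast
    have sub: "z + t *s v \<in> ball 0 1" "norm (z + t *s v) \<le> r" if "t \<in> cball t0 e" for t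
      using e(2) that r by auto
    have ul: "uniform_limit (cball t0 e) (\<lambda>s t. (f ((z + t *s v) + s *s (z + t *s v)) - f (z + t *s v)) / s)
        (\<lambda>t. radial_deriv f (z + t *s v)) (at 0)"
      by (rule uniform_limit_compose'[OF uniform_limit_radial_deriv[OF f r(1,2)]]) (use sub in auto)
    have ch: "\<forall>\<^sub>F s in at 0. continuous_on (cball t0 e) (\<lambda>t. (f ((z + t *s v) + s *s (z + t *s v)) - f (z + t *s v)) / s)
       \<and> (\<lambda>t. (f ((z + t *s v) + s *s (z + t *s v)) - f (z + t *s v)) / s) holomorphic_on ball t0 e"
      using eventually_dilation_in_ball[where 'd='d, OF r(1,2)] eventually_neq_at_within[of 0 0 UNIV]
    proof eventually_elim
      case (elim s)
      \<comment> \<open>The dilated line, rewritten as a line with base point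
        \<open>z + s *s z\<close> and direction \<open>v + s *s v\<close>.\<close>
      have 1: "(\<lambda>t. f ((z + s *s z) + t *s (v + s *s v))) holomorphic_on cball t0 e"
      proof (rule holomorphic_on_line[OF f])
        fix t assume "t \<in> cball t0 e"
        then have "norm ((z + t *s v) + s *s (z + t *s v)) < 1" using elim sub by blast
        moreover have "(z + s *s z) + t *s (v + s *s v) = (z + t *s v) + s *s (z + t *s v)"
          by (simp add: vec_eq_iff algebra_simps)
        ultimately show "(z + s *s z) + t *s (v + s *s v) \<in> ball 0 1" by (simp only: mem_ball_0)
      qed simp
      have 2: "(\<lambda>t. f ((z + s *s z) + t *s (v + s *s v))) = (\<lambda>t. f ((z + t *s v) + s *s (z + t *s v)))"
        by (intro ext arg_cong[of _ _ f]) (simp add: vec_eq_iff algebra_simps)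
      have "(\<lambda>t. f ((z + t *s v) + s *s (z + t *s v))) holomorphic_on cball t0 e" using 1 unfolding 2 .
      moreover have "(\<lambda>t. f (z + t *s v)) holomorphic_on cball t0 e"
        by (rule holomorphic_on_line[OF f]) (use sub in auto)
      ultimately have "(\<lambda>t. (f ((z + t *s v) + s *s (z + t *s v)) - f (z + t *s v)) / s) holomorphic_on cball t0 e"
        using elim by (intro holomorphic_on_divide holomorphic_on_diff holomorphic_on_const) auto
      then show ?case
        using holomorphic_on_imp_continuous_on holomorphic_on_subset ball_subset_cball by blast
    qed
    have "(\<lambda>t. radial_deriv f (z + t *s v)) holomorphic_on ball t0 e"
      by (rule holomorphic_uniform_limit[OF ch ul nontriv])
    then show "(\<lambda>t. radial_deriv f (z + t *s v)) field_differentiable at t0 within {t. z + t *s v \<in> ball 0 1}"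
      using e(1) holomorphic_on_imp_differentiable_at[of _ "ball t0 e"] field_differentiable_at_within
      by (metis centre_in_ball open_ball)
  qed
qed simp

section \<open>Iterated radial derivatives\<close>

lemma holomorphic_radial_deriv_pow:
  "holomorphic_vec_on f (ball 0 1) \<Longrightarrow> holomorphic_vec_on ((radial_deriv ^^ k) f) (ball 0 1)"
  by (induction k) (auto intro: holomorphic_radial_deriv)

lemma radial_deriv_pow_cong:
  assumes eq: "\<And>z. z \<in> ball 0 1 \<Longrightarrow> f z = g z" and f: "holomorphic_vec_on f (ball 0 1)" and z: "z \<in> ball 0 1"
  shows "(radial_deriv ^^ k) f z = (radial_deriv ^^ k) g z"
  using z
proof (induction k arbitrary: z)
  case (Suc k)
  then show ?case
    using radial_deriv_cong[OF _ _ holomorphic_radial_deriv_pow[OF f, of k]] by auto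
qed (use eq in auto)

lemma radial_deriv_pow_const:
  fixes z :: "complex^'d::finite"
  shows "(radial_deriv ^^ Suc k) (\<lambda>_. c) z = 0"
proof (induction k arbitrary: z)
  case (Suc k)
  then have "(radial_deriv ^^ Suc k) (\<lambda>_::complex^'d. c) = (\<lambda>_. 0)" by blast
  then show ?case using radial_deriv_const[of 0 z] by (subst funpow.simps(2)) (simp only: comp_apply)
qed (simp add: radial_deriv_const)

lemma radial_deriv_pow_add:
  assumes f: "holomorphic_vec_on f (ball 0 1)" and g: "holomorphic_vec_on g (ball 0 1)" and z: "z \<in> ball 0 1"
  shows "(radial_deriv ^^ k) (\<lambda>z. f z + g z) z = (radial_deriv ^^ k) f z + (radial_deriv ^^ k) g z"
  using z
proof (induction k arbitrary: z)
  case (Suc k)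
  have "(radial_deriv ^^ Suc k) (\<lambda>z. f z + g z) z = radial_deriv (\<lambda>z. (radial_deriv ^^ k) f z + (radial_deriv ^^ k) g z) z"
    using radial_deriv_cong[OF Suc.IH _ holomorphic_radial_deriv_pow Suc.prems] holomorphic_vec_on_add[OF f g] by simp
  then show ?case using radial_deriv_add[OF holomorphic_radial_deriv_pow[OF f] holomorphic_radial_deriv_pow[OF g] _ Suc.prems] by simp
qed simp

lemma radial_deriv_pow_cmult:
  assumes f: "holomorphic_vec_on f (ball 0 1)" and z: "z \<in> ball 0 1"
  shows "(radial_deriv ^^ k) (\<lambda>z. c * f z) z = c * (radial_deriv ^^ k) f z"
  using z
proof (induction k arbitrary: z)
  case (Suc k)
  have "(radial_deriv ^^ Suc k) (\<lambda>z. c * f z) z = radial_deriv (\<lambda>z. c * (radial_deriv ^^ k) f z) z"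
    using radial_deriv_cong[OF Suc.IH _ holomorphic_radial_deriv_pow Suc.prems]
      holomorphic_vec_on_mult[OF holomorphic_vec_on_const f] by simp
  then show ?case
    using radial_deriv_mult[OF holomorphic_vec_on_const holomorphic_radial_deriv_pow[OF f] _ Suc.prems]
    by (simp add: radial_deriv_const)
qed simp

lemma radial_deriv_pow_diff:
  assumes f: "holomorphic_vec_on f (ball 0 1)" and g: "holomorphic_vec_on g (ball 0 1)" and z: "z \<in> ball 0 1"
  shows "(radial_deriv ^^ k) (\<lambda>z. f z - g z) z = (radial_deriv ^^ k) f z - (radial_deriv ^^ k) g z"
  using radial_deriv_pow_add[OF f holomorphic_vec_on_mult[OF holomorphic_vec_on_const[of "-1"] g] z, of k]
    radial_deriv_pow_cmult[OF g z, of k "-1"] by simp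

lemma radial_deriv_pow_dilate:
  assumes f: "holomorphic_vec_on f (ball 0 1)" and s: "0 \<le> s" "s \<le> 1" and z: "z \<in> ball 0 1"
  shows "(radial_deriv ^^ k) (\<lambda>z. f (s *\<^sub>R z)) z = (radial_deriv ^^ k) f (s *\<^sub>R z)"
  using z
proof (induction k arbitrary: z)
  case (Suc k)
  have "(radial_deriv ^^ Suc k) (\<lambda>z. f (s *\<^sub>R z)) z = radial_deriv (\<lambda>z. (radial_deriv ^^ k) f (s *\<^sub>R z)) z"
    using radial_deriv_cong[OF Suc.IH _ holomorphic_radial_deriv_pow Suc.prems] holomorphic_vec_on_dilate[OF f s] by simp
  then show ?case using radial_deriv_dilate[OF holomorphic_radial_deriv_pow[OF f] s Suc.prems] by simp
qed simp

lemma radial_deriv_0: "radial_deriv f 0 = 0"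
  by (simp add: radial_deriv_def)

section \<open>Means over spheres\<close>

abbreviation circle_param :: "real measure" where
  "circle_param \<equiv> uniform_measure lborel {0..1}"

lemma circle_param_simps [simp, measurable_cong]:
  "space circle_param = UNIV" "sets circle_param = sets borel" "emeasure circle_param UNIV = 1"
  by (auto simp: space_uniform_measure)

lemma finite_circle_param: "finite_measure circle_param"
  by (rule finite_measureI) simp

lemma sphere_measure_simps [simp, measurable_cong]:
  "space sphere_measure = UNIV" "sets sphere_measure = sets borel"
  by (auto simp: sphere_measure_def)

lemma finite_sphere_measure: "finite_measure (sphere_measure :: (complex^'d::finite) measure)"
  by (rule finite_measureI) (simp add: emeasure_sphere_measure_UNIV)

lemma nn_integral_circle_param:
  fixes F :: "real \<Rightarrow> real"
  assumes "continuous_on UNIV F" "\<And>t. 0 \<le> F t"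
  shows "(\<integral>\<^sup>+t. ennreal (F t) \<partial>circle_param) = ennreal (integral {0..1} F)"
proof -
  have [measurable]: "F \<in> borel_measurable borel" using assms(1) by (rule borel_measurable_continuous_onI)
  have "F integrable_on {0..1}"
    by (rule integrable_continuous_real, rule continuous_on_subset[OF assms(1)]) simp
  then have "(F has_integral integral {0..1} F) {0..1}" by (simp add: has_integral_integral)
  then have "((\<lambda>t. if t \<in> {0..1} then F t else 0) has_integral integral {0..1} F) UNIV"
    by (simp only: has_integral_restrict_UNIV)
  moreover have "(\<lambda>t. if t \<in> {0..1} then F t else 0) = (\<lambda>t. F t * indicator {0..1} t)" by auto
  ultimately have "((\<lambda>t. F t * indicator {0..1} t) has_integral integral {0..1} F) UNIV" by simp
  then have "(\<integral>\<^sup>+t. ennreal (F t * indicator {0..1} t) \<partial>lborel) = ennreal (integral {0..1} F)"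
    by (intro nn_integral_has_integral_lborel) (auto simp: assms)
  moreover have "ennreal (F t * indicator {0..1} t) = ennreal (F t) * indicator {0..1} t" for t
    by (auto split: split_indicator)
  ultimately show ?thesis by (simp add: nn_integral_uniform_measure divide_ennreal_def)
qed

text \<open>Multiplication by a unimodular scalar is real linear and isometric, hence
  orthogonal.\<close>

lemma nn_integral_sphere_rotate:
  fixes F :: "complex^'d::finite \<Rightarrow> ennreal"
  assumes [measurable]: "F \<in> borel_measurable borel" and "norm c = 1"
  shows "(\<integral>\<^sup>+w. F (c *s w) \<partial>sphere_measure) = (\<integral>\<^sup>+w. F w \<partial>sphere_measure)"
proof -
  have "linear ((*s) c :: complex^'d \<Rightarrow> _)"
    by (rule linearI) (simp_all add: vec_eq_iff algebra_simps)
  then have o: "orthogonal_transformation ((*s) c :: complex^'d \<Rightarrow> _)"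
    using assms by (simp only: orthogonal_transformation) (simp add: norm_cscale)
  have "continuous_on UNIV ((*s) c :: complex^'d \<Rightarrow> _)" by (intro continuous_intros)
  then have [measurable]: "((*s) c :: complex^'d \<Rightarrow> _) \<in> borel_measurable borel"
    by (rule borel_measurable_continuous_onI)
  have "(\<integral>\<^sup>+w. F w \<partial>sphere_measure) = (\<integral>\<^sup>+w. F w \<partial>distr sphere_measure borel ((*s) c))"
    using sphere_measure_rotation_invariant[OF o] by simp
  also have "\<dots> = (\<integral>\<^sup>+w. F (c *s w) \<partial>sphere_measure)"
    by (subst nn_integral_distr) auto
  finally show ?thesis by simp
qed

lemma borel_measurable_cscale [measurable (raw)]:
  assumes [measurable]: "f \<in> borel_measurable M" "g \<in> borel_measurable M"
  shows "(\<lambda>x. f x *s (g x :: complex^'d::finite)) \<in> borel_measurable M"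
proof (rule borel_measurable_continuous_Pair[OF assms])
  show "continuous_on UNIV (\<lambda>x. fst x *s (snd x :: complex^'d))" by (intro continuous_intros)
qed

lemma nn_integral_sphere_circle_swap:
  fixes F :: "(complex^'d::finite) \<Rightarrow> real \<Rightarrow> ennreal"
  assumes [measurable]: "(\<lambda>(w, t). F w t) \<in> borel_measurable (borel \<Otimes>\<^sub>M borel)"
  shows "(\<integral>\<^sup>+w. (\<integral>\<^sup>+t. F w t \<partial>circle_param) \<partial>sphere_measure) = (\<integral>\<^sup>+t. (\<integral>\<^sup>+w. F w t \<partial>sphere_measure) \<partial>circle_param)"
proof -
  interpret S: finite_measure "sphere_measure :: (complex^'d) measure" by (rule finite_sphere_measure)
  interpret C: finite_measure circle_param by (rule finite_circle_param)
  interpret P: pair_sigma_finite circle_param "sphere_measure :: (complex^'d) measure" ..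
  have "(\<lambda>(w, t). F w t) \<in> borel_measurable (sphere_measure \<Otimes>\<^sub>M circle_param)"
    using assms by (simp cong: measurable_cong_sets sets_pair_measure_cong)
  then show ?thesis
    using P.Fubini'[of "\<lambda>t w. F w t"] by simp
qed

text \<open>After the integrals are exchanged, each inner rotation is removed separately, so
  \<open>\<psi>\<close> may run around the circle at any speed. It is applied both to
  \<open>cis\<close> and to the boundary values of a Moebius map.\<close>

lemma nn_integral_sphere_circle:
  fixes F :: "complex^'d::finite \<Rightarrow> ennreal"
  assumes [measurable]: "F \<in> borel_measurable borel" and \<psi>: "continuous_on UNIV \<psi>" "\<And>t. norm (\<psi> t) = 1"
  shows "(\<integral>\<^sup>+w. (\<integral>\<^sup>+t. F (\<psi> t *s w) \<partial>circle_param) \<partial>sphere_measure) = (\<integral>\<^sup>+w. F w \<partial>sphere_measure)"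
proof -
  have [measurable]: "\<psi> \<in> borel_measurable borel" using \<psi>(1) by (rule borel_measurable_continuous_onI)
  have "(\<integral>\<^sup>+w. (\<integral>\<^sup>+t. F (\<psi> t *s w) \<partial>circle_param) \<partial>sphere_measure)
      = (\<integral>\<^sup>+t. (\<integral>\<^sup>+w. F (\<psi> t *s w) \<partial>sphere_measure) \<partial>circle_param)"
    by (rule nn_integral_sphere_circle_swap) measurable
  also have "\<dots> = (\<integral>\<^sup>+w. F w \<partial>sphere_measure)"
    using nn_integral_sphere_rotate[of F, OF _ \<psi>(2)] by (simp add: assms)
  finally show ?thesis .
qed

lemma nn_integral_sphere_mono:
  assumes "\<And>w. norm w = 1 \<Longrightarrow> F w \<le> G w"
  shows "(\<integral>\<^sup>+w. F w \<partial>sphere_measure) \<le> (\<integral>\<^sup>+w. G w \<partial>sphere_measure)"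
  using AE_sphere_measure by (intro nn_integral_mono_AE) (auto elim!: eventually_mono intro: assms)

section \<open>Means of \<open>p\<close>-th powers at a fixed radius\<close>

definition smean :: "real \<Rightarrow> (complex^'d::finite \<Rightarrow> complex) \<Rightarrow> real \<Rightarrow> ennreal" where
  "smean p g s = (\<integral>\<^sup>+w. ennreal (norm (g (s *\<^sub>R w)) powr p) \<partial>sphere_measure)"

lemma smean_cong:
  assumes "\<And>z. norm z = s \<Longrightarrow> g z = h z" "0 \<le> s"
  shows "smean p g s = smean p h s"
  unfolding smean_def using AE_sphere_measure
  by (intro nn_integral_cong_AE) (auto simp: assms)

lemma smean_le_const:
  fixes g :: "complex^'d::finite \<Rightarrow> complex"
  assumes "\<And>z. norm z = s \<Longrightarrow> norm (g z) \<le> K" "0 \<le> s" "0 \<le> p"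
  shows "smean p g s \<le> ennreal (K powr p)"
proof -
  have "smean p g s \<le> (\<integral>\<^sup>+w. ennreal (K powr p) \<partial>(sphere_measure :: (complex^'d) measure))"
    unfolding smean_def
    by (intro nn_integral_sphere_mono) (auto intro!: ennreal_leI powr_mono2 assms simp: assms(2))
  then show ?thesis by (simp add: emeasure_sphere_measure_UNIV)
qed

lemma smean_const:
  fixes c :: complex
  shows "smean p (\<lambda>_::complex^'d::finite. c) s = ennreal (norm c powr p)"
  by (simp add: smean_def emeasure_sphere_measure_UNIV)

lemma holomorphic_bounded_cball:
  fixes g :: "complex^'d::finite \<Rightarrow> complex"
  assumes g: "holomorphic_vec_on g (ball 0 1)" and "r < 1"
  obtains K where "\<And>z. norm z \<le> r \<Longrightarrow> norm (g z) \<le> K"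
proof -
  have "compact (g ` cball 0 r)"
    by (rule compact_continuous_image, rule continuous_on_subset[OF holomorphic_vec_on_imp_continuous_on[OF g]])
       (use assms in auto)
  then have "bounded (g ` cball 0 r)" by (rule compact_imp_bounded)
  then show ?thesis using that unfolding bounded_iff by fastforce
qed

lemma smean_finite:
  assumes g: "holomorphic_vec_on g (ball 0 1)" and s: "0 \<le> s" "s < 1" "0 \<le> p"
  shows "smean p g s < \<infinity>"
proof -
  obtain K where "\<And>z. norm z \<le> s \<Longrightarrow> norm (g z) \<le> K"
    using holomorphic_bounded_cball[OF g s(2)] by blast
  then have "smean p g s \<le> ennreal (K powr p)" using s by (intro smean_le_const) auto
  then show ?thesis by (simp add: order_le_less_trans)
qed

text \<open>Cutting a function off outside the ball makes it Borel measurable without changing its means.\<close>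

definition cutoff :: "(complex^'d::finite \<Rightarrow> complex) \<Rightarrow> complex^'d \<Rightarrow> complex" where
  "cutoff g z = (if norm z < 1 then g z else 0)"

lemma cutoff_measurable:
  assumes g: "holomorphic_vec_on g (ball 0 1)"
  shows "cutoff g \<in> borel_measurable borel"
proof -
  have "(\<lambda>z. indicator (ball 0 1) z *\<^sub>R g z) \<in> borel_measurable borel"
    by (rule borel_measurable_continuous_on_indicator[OF _ holomorphic_vec_on_imp_continuous_on[OF g]]) simp
  moreover have "cutoff g = (\<lambda>z. indicator (ball 0 1) z *\<^sub>R g z)"
    by (auto simp: cutoff_def fun_eq_iff split: split_indicator)
  ultimately show ?thesis by simp
qed

lemma cutoff_holomorphic:
  "holomorphic_vec_on g (ball 0 1) \<Longrightarrow> holomorphic_vec_on (cutoff g) (ball 0 1)"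
  by (rule holomorphic_vec_on_cong[of g]) (auto simp: cutoff_def)

lemma smean_cutoff: "0 \<le> s \<Longrightarrow> s < 1 \<Longrightarrow> smean p (cutoff g) s = smean p g s"
  by (rule smean_cong) (auto simp: cutoff_def)

lemma continuous_moebius_circle:
  assumes "0 \<le> \<rho>" "\<rho> < 1"
  shows "continuous_on UNIV (\<lambda>t. moebius \<rho> (cis (2 * pi * t)))"
  by (rule continuous_on_compose2[OF moebius_cont_hol(1)[OF assms]]) (auto intro!: continuous_intros)

lemma scaled_slice:
  fixes w :: "complex^'d::finite"
  assumes g: "holomorphic_vec_on g (ball 0 1)" and "0 \<le> s" "s < 1" "norm w = 1"
  shows "(\<lambda>z. g (z *s (s *\<^sub>R w))) holomorphic_on cball 0 1"
proof -
  have "(\<lambda>z. g (0 + z *s (s *\<^sub>R w))) holomorphic_on cball 0 1"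
  proof (rule holomorphic_on_line[OF g])
    fix z :: complex assume "z \<in> cball 0 1"
    then have "norm z * s \<le> 1 * s" using assms by (intro mult_right_mono) auto
    then show "0 + z *s (s *\<^sub>R w) \<in> ball 0 1" using assms by (simp add: norm_cscale)
  qed simp
  then show ?thesis by simp
qed

text \<open>The disc inequality on every slice \<open>\<lambda>z. g (z *s (s *\<^sub>R w))\<close>,
  integrated over \<open>w\<close>. The interior point \<open>\<rho>\<close> of the slice lies at
  radius \<open>s * \<rho>\<close>, and the Moebius average over the boundary becomes the plain mean
  at radius \<open>s\<close> by \<open>nn_integral_sphere_circle\<close>. In the deviation the
  rotation stays, because it acts on one of the two points only.\<close>

lemma nn_integral_moebius_deviation:
  fixes p \<epsilon> :: real
  assumes p: "1 \<le> p" and "0 < \<epsilon>"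
  obtains C where "1 \<le> C"
    "\<And>(g :: complex^'d::finite \<Rightarrow> complex) s \<rho>. holomorphic_vec_on g (ball 0 1) \<Longrightarrow> g \<in> borel_measurable borel \<Longrightarrow>
       0 \<le> s \<Longrightarrow> s < 1 \<Longrightarrow> 0 \<le> \<rho> \<Longrightarrow> \<rho> < 1 \<Longrightarrow>
       (\<integral>\<^sup>+w. (\<integral>\<^sup>+t. ennreal (norm (g (moebius \<rho> (cis (2 * pi * t)) *s (s *\<^sub>R w)) - g ((s * \<rho>) *\<^sub>R w)) powr p) \<partial>circle_param) \<partial>sphere_measure)
         + ennreal C * smean p g (s * \<rho>) \<le> ennreal \<epsilon> * smean p g (s * \<rho>) + ennreal C * smean p g s"
proof -
  obtain C where C: "1 \<le> C"
    "\<And>h \<rho>. continuous_on (cball 0 1) h \<Longrightarrow> h holomorphic_on ball 0 1 \<Longrightarrow> 0 \<le> \<rho> \<Longrightarrow> \<rho> < 1 \<Longrightarrow>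
       integral {0..1} (\<lambda>t. norm (h (moebius \<rho> (cis (2 * pi * t))) - h (of_real \<rho>)) powr p) + C * norm (h (of_real \<rho>)) powr p
         \<le> \<epsilon> * norm (h (of_real \<rho>)) powr p + C * integral {0..1} (\<lambda>t. norm (h (moebius \<rho> (cis (2 * pi * t)))) powr p)"
    using moebius_deviation_ineq[OF assms] by metis
  have "(\<integral>\<^sup>+w. (\<integral>\<^sup>+t. ennreal (norm (g (moebius \<rho> (cis (2 * pi * t)) *s (s *\<^sub>R w)) - g ((s * \<rho>) *\<^sub>R w)) powr p) \<partial>circle_param) \<partial>sphere_measure)
         + ennreal C * smean p g (s * \<rho>) \<le> ennreal \<epsilon> * smean p g (s * \<rho>) + ennreal C * smean p g s"
    if g: "holomorphic_vec_on g (ball 0 1)" and [measurable]: "g \<in> borel_measurable borel" and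
       s: "0 \<le> s" "s < 1" and \<rho>: "0 \<le> \<rho>" "\<rho> < 1" for g :: "complex^'d \<Rightarrow> complex" and s \<rho>
  proof -
    define m where "m = (\<lambda>t. moebius \<rho> (cis (2 * pi * t)))"
    have cm: "continuous_on UNIV m" unfolding m_def by (rule continuous_moebius_circle[OF \<rho>])
    have nm: "norm (m t) = 1" for t using moebius_norm(4)[OF \<rho>] by (simp add: m_def)
    have [measurable]: "m \<in> borel_measurable borel" using cm by (rule borel_measurable_continuous_onI)
    have C0: "0 \<le> C" using C(1) by simp
    define X where "X = (\<lambda>w. \<integral>\<^sup>+t. ennreal (norm (g (m t *s (s *\<^sub>R w)) - g ((s * \<rho>) *\<^sub>R w)) powr p) \<partial>circle_param)"
    define Y where "Y = (\<lambda>w. ennreal (norm (g ((s * \<rho>) *\<^sub>R w)) powr p))"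
    define Z where "Z = (\<lambda>w. \<integral>\<^sup>+t. ennreal (norm (g (s *\<^sub>R (m t *s w))) powr p) \<partial>circle_param)"
    interpret C: finite_measure circle_param by (rule finite_circle_param)
    have mX: "X \<in> borel_measurable borel" and mY: "Y \<in> borel_measurable borel" and mZ: "Z \<in> borel_measurable borel"
      unfolding X_def Y_def Z_def by measurable
    have pw: "X w + ennreal C * Y w \<le> ennreal \<epsilon> * Y w + ennreal C * Z w" if w: "norm w = 1" for w
    proof -
      define h where "h = (\<lambda>z. g (z *s (s *\<^sub>R w)))"
      have hol: "h holomorphic_on cball 0 1" unfolding h_def by (rule scaled_slice[OF g s w])
      have cont: "continuous_on (cball 0 1) h" by (rule holomorphic_on_imp_continuous_on[OF hol])
      have hol': "h holomorphic_on ball 0 1" by (rule holomorphic_on_subset[OF hol ball_subset_cball])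
      have chm: "continuous_on UNIV (\<lambda>t. h (m t))"
        by (rule continuous_on_compose2[OF cont cm]) (auto simp: nm)
      have hr: "h (of_real \<rho>) = g ((s * \<rho>) *\<^sub>R w)"
        unfolding h_def by (rule arg_cong[of _ _ g]) (simp add: scaleR_cscale mult.commute)
      have hm: "g (s *\<^sub>R (m t *s w)) = h (m t)" for t
        unfolding h_def by (rule arg_cong[of _ _ g]) (simp add: scaleR_cscale mult.commute)
      have X: "X w = ennreal (integral {0..1} (\<lambda>t. norm (h (m t) - h (of_real \<rho>)) powr p))"
        unfolding X_def hr[symmetric] h_def[symmetric]
        using nn_integral_circle_param[of "\<lambda>t. norm (h (m t) - h (of_real \<rho>)) powr p"] p
        by (simp add: h_def continuous_on_norm_powr continuous_on_diff chm[unfolded h_def])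
      have Z: "Z w = ennreal (integral {0..1} (\<lambda>t. norm (h (m t)) powr p))"
        unfolding Z_def hm
        by (rule nn_integral_circle_param) (auto intro!: continuous_on_norm_powr chm p)
      define IX where "IX = integral {0..1} (\<lambda>t. norm (h (m t) - h (of_real \<rho>)) powr p)"
      define IZ where "IZ = integral {0..1} (\<lambda>t. norm (h (m t)) powr p)"
      define yy where "yy = norm (h (of_real \<rho>)) powr p"
      have "0 \<le> IX" "0 \<le> IZ" unfolding IX_def IZ_def
        by (auto intro!: integral_nonneg integrable_continuous_real continuous_on_norm_powr p continuous_on_diff
            continuous_on_subset[OF chm])
      moreover have "IX + C * yy \<le> \<epsilon> * yy + C * IZ"
        using C(2)[OF cont hol' \<rho>] by (simp add: IX_def IZ_def yy_def m_def)
      ultimately have "ennreal (IX + C * yy) \<le> ennreal (\<epsilon> * yy + C * IZ)" by (intro ennreal_leI)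
      moreover have "0 \<le> yy" by (simp add: yy_def)
      ultimately show ?thesis
        using \<open>0 \<le> IX\<close> \<open>0 \<le> IZ\<close> C0 \<open>0 < \<epsilon>\<close>
        unfolding X Z Y_def hr[symmetric] IX_def[symmetric] IZ_def[symmetric] yy_def[symmetric]
        by (simp add: ennreal_plus ennreal_mult)
    qed
    have "(\<integral>\<^sup>+w. X w \<partial>sphere_measure) + ennreal C * smean p g (s * \<rho>) = (\<integral>\<^sup>+w. X w + ennreal C * Y w \<partial>sphere_measure)"
      unfolding smean_def Y_def[symmetric] using mX mY
      by (subst nn_integral_add) (auto simp: nn_integral_cmult)
    also have "\<dots> \<le> (\<integral>\<^sup>+w. ennreal \<epsilon> * Y w + ennreal C * Z w \<partial>sphere_measure)"
      by (rule nn_integral_sphere_mono) (rule pw)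
    also have "\<dots> = ennreal \<epsilon> * smean p g (s * \<rho>) + ennreal C * (\<integral>\<^sup>+w. Z w \<partial>sphere_measure)"
      unfolding smean_def Y_def[symmetric] using mZ mY
      by (subst nn_integral_add) (auto simp: nn_integral_cmult)
    also have "(\<integral>\<^sup>+w. Z w \<partial>sphere_measure) = smean p g s"
      unfolding smean_def Z_def
      by (rule nn_integral_sphere_circle[of "\<lambda>w. ennreal (norm (g (s *\<^sub>R w)) powr p)" m]) (use cm nm in auto)
    finally show ?thesis unfolding X_def m_def .
  qed
  then show ?thesis using that C(1) by blast
qed

text \<open>Discard the deviation in \<open>nn_integral_moebius_deviation\<close> with
  \<open>\<rho> = r / s\<close>. Division by \<open>C \<ge> 1\<close> leaves an error of at most
  \<open>\<epsilon>\<close> times the finite mean at \<open>r\<close>, and \<open>\<epsilon>\<close>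
  is arbitrary. This takes the place of a subharmonicity argument.\<close>

lemma smean_mono:
  fixes g :: "complex^'d::finite \<Rightarrow> complex"
  assumes g: "holomorphic_vec_on g (ball 0 1)" and p: "1 \<le> p" and rs: "0 \<le> r" "r \<le> s" "s < 1"
  shows "smean p g r \<le> smean p g s"
proof (cases "r = s")
  case False
  then have s: "0 < s" "r < s" using rs by auto
  define \<rho> where "\<rho> = r / s"
  have \<rho>: "0 \<le> \<rho>" "\<rho> < 1" "s * \<rho> = r" using s rs by (auto simp: \<rho>_def)
  let ?g = "cutoff g"
  have fin: "smean p ?g r < \<infinity>"
    using smean_finite[OF cutoff_holomorphic[OF g]] rs p by simp
  then obtain a where a: "smean p ?g r = ennreal a" "0 \<le> a" by (metis ennreal_cases infinity_ennreal_def less_irrefl)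
  have "smean p ?g r \<le> smean p ?g s + ennreal e" if "e > 0" for e
  proof -
    \<comment> \<open>Makes \<open>\<epsilon> * a \<le> e\<close>; the \<open>+ 1\<close> covers
      \<open>a = 0\<close>.\<close>
    define \<epsilon> where "\<epsilon> = e / (a + 1)"
    have \<epsilon>: "\<epsilon> > 0" "\<epsilon> * a \<le> e" using a that by (auto simp: \<epsilon>_def field_simps)
    obtain C where C1: "1 \<le> C" and C2: "\<And>(g :: complex^'d \<Rightarrow> complex) s \<rho>. holomorphic_vec_on g (ball 0 1) \<Longrightarrow> g \<in> borel_measurable borel \<Longrightarrow>
       0 \<le> s \<Longrightarrow> s < 1 \<Longrightarrow> 0 \<le> \<rho> \<Longrightarrow> \<rho> < 1 \<Longrightarrow>
       (\<integral>\<^sup>+w. (\<integral>\<^sup>+t. ennreal (norm (g (moebius \<rho> (cis (2 * pi * t)) *s (s *\<^sub>R w)) - g ((s * \<rho>) *\<^sub>R w)) powr p) \<partial>circle_param) \<partial>sphere_measure)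
         + ennreal C * smean p g (s * \<rho>) \<le> ennreal \<epsilon> * smean p g (s * \<rho>) + ennreal C * smean p g s"
      by (rule nn_integral_moebius_deviation[OF p \<epsilon>(1), where 'd='d]) blast
    have "ennreal C * smean p ?g (s * \<rho>) \<le> ennreal \<epsilon> * smean p ?g (s * \<rho>) + ennreal C * smean p ?g s"
      by (rule order_trans[OF _ C2[OF cutoff_holomorphic[OF g] cutoff_measurable[OF g] _ rs(3) \<rho>(1,2)]])
        (use s in \<open>auto simp: add_increasing\<close>)
    note C = C1 this[unfolded \<rho>(3)]
    have "ennreal C * smean p ?g r \<le> ennreal C * (smean p ?g s + ennreal e)"
    proof -
      have "ennreal \<epsilon> * smean p ?g r \<le> ennreal e" using \<epsilon> a by (simp add: ennreal_leI flip: ennreal_mult)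
      also have "\<dots> \<le> ennreal C * ennreal e" using C(1) that
        by (simp add: ennreal_leI flip: ennreal_mult)
      finally have "ennreal \<epsilon> * smean p ?g r + ennreal C * smean p ?g s \<le> ennreal C * ennreal e + ennreal C * smean p ?g s"
        by (rule add_right_mono)
      from order_trans[OF C(2) this] show ?thesis by (simp only: distrib_left add.commute)
    qed
    then show ?thesis using C(1) by (simp add: ennreal_mult_le_mult_iff)
  qed
  then have "smean p ?g r \<le> smean p ?g s" by (rule ennreal_le_epsilon)
  then show ?thesis using rs by (simp add: smean_cutoff)
qed simp

section \<open>Sums, multiples and dilations in the mean\<close>

lemma add3_powr_le:
  fixes a b c p :: real
  assumes "0 \<le> a" "0 \<le> b" "0 \<le> c" "0 \<le> p"
  shows "(a + b + c) powr p \<le> 3 powr p * (a powr p + b powr p + c powr p)"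
proof -
  define m where "m = max a (max b c)"
  have "(a + b + c) powr p \<le> (3 * m) powr p" using assms by (intro powr_mono2) (auto simp: m_def)
  also have "\<dots> = 3 powr p * m powr p" using assms by (simp add: powr_mult m_def)
  also have "m powr p \<le> a powr p + b powr p + c powr p" by (auto simp: m_def max_def)
  finally show ?thesis by simp
qed

lemma add_powr_le:
  fixes a b p :: real
  assumes "0 \<le> a" "0 \<le> b" "0 \<le> p"
  shows "(a + b) powr p \<le> 2 powr p * (a powr p + b powr p)"
proof -
  have "(a + b) powr p \<le> (2 * max a b) powr p" using assms by (intro powr_mono2) auto
  also have "\<dots> = 2 powr p * max a b powr p" using assms by (simp add: powr_mult)
  also have "max a b powr p \<le> a powr p + b powr p" by (auto simp: max_def)
  finally show ?thesis by simp
qed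

lemma smean_add_le:
  fixes g h :: "complex^'d::finite \<Rightarrow> complex"
  assumes g: "holomorphic_vec_on g (ball 0 1)" and h: "holomorphic_vec_on h (ball 0 1)"
    and s: "0 \<le> s" "s < 1" and p: "0 \<le> p"
  shows "smean p (\<lambda>z. g z + h z) s \<le> ennreal (2 powr p) * (smean p g s + smean p h s)"
proof -
  have [measurable]: "cutoff g \<in> borel_measurable borel" "cutoff h \<in> borel_measurable borel"
    using cutoff_measurable g h by blast+
  have "smean p (\<lambda>z. g z + h z) s = smean p (\<lambda>z. cutoff g z + cutoff h z) s"
    by (rule smean_cong) (use s in \<open>auto simp: cutoff_def\<close>)
  also have "\<dots> \<le> (\<integral>\<^sup>+w. ennreal (2 powr p) * (ennreal (norm (cutoff g (s *\<^sub>R w)) powr p) + ennreal (norm (cutoff h (s *\<^sub>R w)) powr p)) \<partial>sphere_measure)"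
    unfolding smean_def
  proof (intro nn_integral_mono)
    fix w :: "complex^'d"
    have "norm (cutoff g (s *\<^sub>R w) + cutoff h (s *\<^sub>R w)) powr p \<le> (norm (cutoff g (s *\<^sub>R w)) + norm (cutoff h (s *\<^sub>R w))) powr p"
      using p by (intro powr_mono2 norm_triangle_ineq) auto
    also have "\<dots> \<le> 2 powr p * (norm (cutoff g (s *\<^sub>R w)) powr p + norm (cutoff h (s *\<^sub>R w)) powr p)"
      using p by (intro add_powr_le) auto
    finally show "ennreal (norm (cutoff g (s *\<^sub>R w) + cutoff h (s *\<^sub>R w)) powr p)
      \<le> ennreal (2 powr p) * (ennreal (norm (cutoff g (s *\<^sub>R w)) powr p) + ennreal (norm (cutoff h (s *\<^sub>R w)) powr p))"
      by (simp add: ennreal_leI flip: ennreal_mult ennreal_plus)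
  qed
  also have "\<dots> = ennreal (2 powr p) * (smean p (cutoff g) s + smean p (cutoff h) s)"
    unfolding smean_def by (subst nn_integral_cmult, measurable, subst nn_integral_add) auto
  finally show ?thesis using s by (simp add: smean_cutoff)
qed

lemma smean_scale:
  fixes g :: "complex^'d::finite \<Rightarrow> complex"
  assumes g: "holomorphic_vec_on g (ball 0 1)" and s: "0 \<le> s" "s < 1"
    and le: "\<And>z. norm z = s \<Longrightarrow> norm (f z) \<le> K * norm (g z)" and "0 \<le> K" "0 \<le> p"
  shows "smean p f s \<le> ennreal (K powr p) * smean p g s"
proof -
  have [measurable]: "cutoff g \<in> borel_measurable borel" using cutoff_measurable g by blast
  have "smean p f s \<le> (\<integral>\<^sup>+w. ennreal (K powr p) * ennreal (norm (cutoff g (s *\<^sub>R w)) powr p) \<partial>sphere_measure)"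
    unfolding smean_def
  proof (rule nn_integral_sphere_mono)
    fix w :: "complex^'d" assume w: "norm w = 1"
    have "norm (f (s *\<^sub>R w)) powr p \<le> (K * norm (g (s *\<^sub>R w))) powr p"
      using assms w by (intro powr_mono2 le) auto
    also have "\<dots> = K powr p * norm (cutoff g (s *\<^sub>R w)) powr p"
      using w s assms by (simp add: powr_mult cutoff_def)
    finally show "ennreal (norm (f (s *\<^sub>R w)) powr p) \<le> ennreal (K powr p) * ennreal (norm (cutoff g (s *\<^sub>R w)) powr p)"
      by (simp add: ennreal_leI flip: ennreal_mult)
  qed
  also have "\<dots> = ennreal (K powr p) * smean p (cutoff g) s"
    unfolding smean_def by (subst nn_integral_cmult) auto
  finally show ?thesis using s by (simp add: smean_cutoff)
qed

lemma smean_dilate: "smean p (\<lambda>z. g (t *\<^sub>R z)) s = smean p g (s * t)"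
  by (simp add: smean_def mult.commute)

text \<open>Rotation invariance permits turning both points on the left by the same
  \<open>m t\<close>, which depends on \<open>\<rho>\<close> but not on \<open>s\<close> or
  \<open>s'\<close>. The difference then splits at the interior values at radii
  \<open>s * \<rho>\<close> and \<open>s' * \<rho>\<close> into two deviations and one term
  controlled by \<open>\<eta>\<close>.\<close>

lemma smean_diff_dilations_le:
  fixes g :: "complex^'d::finite \<Rightarrow> complex"
  assumes p: "1 \<le> p" and g: "holomorphic_vec_on g (ball 0 1)" and [measurable]: "g \<in> borel_measurable borel"
    and s: "0 \<le> s" "s < 1" and s': "0 \<le> s'" "s' < 1" and \<rho>: "0 \<le> \<rho>" "\<rho> < 1"
    and near: "\<And>w. norm w = 1 \<Longrightarrow> norm (g ((s * \<rho>) *\<^sub>R w) - g ((s' * \<rho>) *\<^sub>R w)) \<le> \<eta>"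
  defines "B \<equiv> \<lambda>s. \<integral>\<^sup>+w. (\<integral>\<^sup>+t. ennreal (norm (g (moebius \<rho> (cis (2 * pi * t)) *s (s *\<^sub>R w)) - g ((s * \<rho>) *\<^sub>R w)) powr p) \<partial>circle_param) \<partial>sphere_measure"
  shows "(\<integral>\<^sup>+w. ennreal (norm (g (s *\<^sub>R w) - g (s' *\<^sub>R w)) powr p) \<partial>sphere_measure)
    \<le> ennreal (3 powr p) * (B s + ennreal (\<eta> powr p) + B s')"
proof -
  define m where "m = (\<lambda>t. moebius \<rho> (cis (2 * pi * t)))"
  have cm: "continuous_on UNIV m" unfolding m_def by (rule continuous_moebius_circle[OF \<rho>])
  have nm: "norm (m t) = 1" for t using moebius_norm(4)[OF \<rho>] by (simp add: m_def)
  have [measurable]: "m \<in> borel_measurable borel" using cm by (rule borel_measurable_continuous_onI)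
  interpret C: finite_measure circle_param by (rule finite_circle_param)
  define X where "X = (\<lambda>s w t. ennreal (norm (g (m t *s (s *\<^sub>R w)) - g ((s * \<rho>) *\<^sub>R w)) powr p))"
  have B: "B s = (\<integral>\<^sup>+w. (\<integral>\<^sup>+t. X s w t \<partial>circle_param) \<partial>sphere_measure)" for s
    by (simp add: B_def X_def m_def)
  have [measurable]: "(\<lambda>w. \<integral>\<^sup>+t. X s w t \<partial>circle_param) \<in> borel_measurable borel" for s
    unfolding X_def by measurable
  have [measurable]: "X s w \<in> borel_measurable borel" for s w
    unfolding X_def by measurable
  have "(\<integral>\<^sup>+w. ennreal (norm (g (s *\<^sub>R w) - g (s' *\<^sub>R w)) powr p) \<partial>sphere_measure)
    = (\<integral>\<^sup>+w. (\<integral>\<^sup>+t. ennreal (norm (g (s *\<^sub>R (m t *s w)) - g (s' *\<^sub>R (m t *s w))) powr p) \<partial>circle_param) \<partial>sphere_measure)"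
    by (rule nn_integral_sphere_circle[of "\<lambda>w. ennreal (norm (g (s *\<^sub>R w) - g (s' *\<^sub>R w)) powr p)" m, symmetric]) (use cm nm in auto)
  also have "\<dots> \<le> (\<integral>\<^sup>+w. (\<integral>\<^sup>+t. ennreal (3 powr p) * (X s w t + ennreal (\<eta> powr p) + X s' w t) \<partial>circle_param) \<partial>sphere_measure)"
  proof (intro nn_integral_sphere_mono nn_integral_mono)
    fix w :: "complex^'d" and t assume w: "norm w = 1"
    have sw: "s *\<^sub>R (m t *s w) = m t *s (s *\<^sub>R w)" for s by (simp add: scaleR_cscale mult.commute)
    let ?a = "norm (g (m t *s (s *\<^sub>R w)) - g ((s * \<rho>) *\<^sub>R w))"
    let ?b = "norm (g ((s * \<rho>) *\<^sub>R w) - g ((s' * \<rho>) *\<^sub>R w))"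
    let ?c = "norm (g (m t *s (s' *\<^sub>R w)) - g ((s' * \<rho>) *\<^sub>R w))"
    have tri: "norm (x - y) \<le> norm (x - a) + norm (a - b) + norm (y - b)" for x y a b :: complex
      using norm_triangle_ineq[of "x - a" "a - b"] norm_triangle_ineq4[of "x - a + (a - b)" "y - b"] by simp
    have "norm (g (s *\<^sub>R (m t *s w)) - g (s' *\<^sub>R (m t *s w))) powr p \<le> (?a + ?b + ?c) powr p"
      unfolding sw using p by (intro powr_mono2 tri) auto
    also have "\<dots> \<le> 3 powr p * (?a powr p + ?b powr p + ?c powr p)" using p by (intro add3_powr_le) auto
    also have "\<dots> \<le> 3 powr p * (?a powr p + \<eta> powr p + ?c powr p)"
      using near[OF w] p by (intro mult_left_mono add_mono powr_mono2) auto
    finally show "ennreal (norm (g (s *\<^sub>R (m t *s w)) - g (s' *\<^sub>R (m t *s w))) powr p)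
        \<le> ennreal (3 powr p) * (X s w t + ennreal (\<eta> powr p) + X s' w t)"
      unfolding X_def by (simp add: ennreal_leI flip: ennreal_mult ennreal_plus)
  qed
  also have "\<dots> = (\<integral>\<^sup>+w. ennreal (3 powr p) * ((\<integral>\<^sup>+t. X s w t \<partial>circle_param) + ennreal (\<eta> powr p) + (\<integral>\<^sup>+t. X s' w t \<partial>circle_param)) \<partial>sphere_measure)"
    by (intro nn_integral_cong) (simp add: nn_integral_cmult nn_integral_add)
  also have "\<dots> = ennreal (3 powr p) * (B s + ennreal (\<eta> powr p) + B s')"
    unfolding B by (simp add: nn_integral_cmult nn_integral_add emeasure_sphere_measure_UNIV)
  finally show ?thesis .
qed

text \<open>This is the mean convergence of dilations in the Hardy space, stated as a Cauchy condition so
  that no boundary values are needed.\<close>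

lemma smean_dilations_Cauchy:
  fixes g :: "complex^'d::finite \<Rightarrow> complex"
  assumes p: "1 \<le> p" and g: "holomorphic_vec_on g (ball 0 1)"
    and fin: "(SUP s\<in>{0..<1}. smean p g s) < \<infinity>" and "0 < e"
  obtains s0 where "0 \<le> s0" "s0 < 1"
    "\<And>s s'. s0 < s \<Longrightarrow> s < 1 \<Longrightarrow> s0 < s' \<Longrightarrow> s' < 1 \<Longrightarrow>
      (\<integral>\<^sup>+w. ennreal (norm (g (s *\<^sub>R w) - g (s' *\<^sub>R w)) powr p) \<partial>sphere_measure) \<le> ennreal e"
proof -
  let ?g = "cutoff g"
  define L where "L = (SUP s\<in>{0..<1}. smean p ?g s)"
  have "L = (SUP s\<in>{0..<1}. smean p g s)" unfolding L_def
    by (rule SUP_cong) (auto simp: smean_cutoff)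
  then obtain l where l: "L = ennreal l" "0 \<le> l" using fin by (metis ennreal_cases infinity_ennreal_def less_irrefl)
  have hg: "holomorphic_vec_on ?g (ball 0 1)" "?g \<in> borel_measurable borel"
    using cutoff_holomorphic[OF g] cutoff_measurable[OF g] by auto
  \<comment> \<open>Two deviations of at most \<open>2 * e'\<close> and an interior term
    \<open>e'\<close> add up to \<open>5 * e'\<close>; the factor \<open>3 powr p\<close> comes from
    \<open>smean_diff_dilations_le\<close>.\<close>
  define e' where "e' = e / 3 powr p / 5"
  have e': "e' > 0" "3 powr p * (5 * e') = e" using \<open>0 < e\<close> by (auto simp: e'_def)
  define \<epsilon> where "\<epsilon> = e' / (l + 1)"
  have \<epsilon>: "\<epsilon> > 0" "\<epsilon> * l \<le> e'" using l e' by (auto simp: \<epsilon>_def field_simps)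
  obtain C where C1: "1 \<le> C" and C2: "\<And>(g :: complex^'d \<Rightarrow> complex) s \<rho>. holomorphic_vec_on g (ball 0 1) \<Longrightarrow> g \<in> borel_measurable borel \<Longrightarrow>
       0 \<le> s \<Longrightarrow> s < 1 \<Longrightarrow> 0 \<le> \<rho> \<Longrightarrow> \<rho> < 1 \<Longrightarrow>
       (\<integral>\<^sup>+w. (\<integral>\<^sup>+t. ennreal (norm (g (moebius \<rho> (cis (2 * pi * t)) *s (s *\<^sub>R w)) - g ((s * \<rho>) *\<^sub>R w)) powr p) \<partial>circle_param) \<partial>sphere_measure)
         + ennreal C * smean p g (s * \<rho>) \<le> ennreal \<epsilon> * smean p g (s * \<rho>) + ennreal C * smean p g s"
    by (rule nn_integral_moebius_deviation[OF p \<epsilon>(1), where 'd='d]) blast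
  note C = C1 C2[OF hg]
  define \<delta> where "\<delta> = e' / C"
  have \<delta>: "\<delta> > 0" "C * \<delta> = e'" using e' C(1) by (auto simp: \<delta>_def)
  obtain s1 where s1: "0 \<le> s1" "s1 < 1" "L \<le> smean p ?g s1 + ennreal \<delta>"
  proof (cases "L \<le> ennreal \<delta>")
    case True
    then show ?thesis using that[of 0] by (simp add: add_increasing)
  next
    case False
    then have "ennreal (l - \<delta>) < L" using l \<delta> by (simp add: ennreal_less_iff)
    then obtain s where s: "s \<in> {0..<1}" "ennreal (l - \<delta>) < smean p ?g s"
      unfolding L_def less_SUP_iff by blast
    have "ennreal l = ennreal (l - \<delta>) + ennreal \<delta>" using False l \<delta>
      by (simp add: not_le ennreal_less_iff flip: ennreal_plus)
    also have "\<dots> \<le> smean p ?g s + ennreal \<delta>" using s by (intro add_mono) auto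
    finally show ?thesis using that[of s] s l by auto
  qed
  \<comment> \<open>By the square root, \<open>s > \<rho>\<close> implies
    \<open>s * \<rho> \<ge> s1\<close>, so even at the smaller radius \<open>s * \<rho>\<close> the
    mean is within \<open>\<delta>\<close> of its supremum \<open>L\<close>.\<close>
  define \<rho> where "\<rho> = sqrt s1"
  have \<rho>: "0 \<le> \<rho>" "\<rho> < 1" "\<rho> * \<rho> = s1" using s1 by (auto simp: \<rho>_def real_sqrt_lt_1_iff)
  define B where "B = (\<lambda>s. \<integral>\<^sup>+w. (\<integral>\<^sup>+t. ennreal (norm (?g (moebius \<rho> (cis (2 * pi * t)) *s (s *\<^sub>R w)) - ?g ((s * \<rho>) *\<^sub>R w)) powr p) \<partial>circle_param) \<partial>sphere_measure)"
  \<comment> \<open>One \<open>e'\<close> bounds \<open>\<epsilon> * L\<close>, the other is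
    \<open>C * \<delta>\<close>. The term \<open>C * smean p ?g (s * \<rho>)\<close> occurs on both
    sides and cancels because it is finite.\<close>
  have Bs: "B s \<le> ennreal (2 * e')" if s: "\<rho> < s" "s < 1" for s
  proof -
    have s0: "0 \<le> s" "0 \<le> s * \<rho>" using s \<rho> by auto
    have sr: "s1 \<le> s * \<rho>" "s * \<rho> < 1" using s \<rho> mult_right_mono[of \<rho> s \<rho>] mult_strict_mono[of s 1 \<rho> 1] by auto
    have up: "smean p ?g t \<le> L" if "0 \<le> t" "t < 1" for t
      unfolding L_def using that by (intro SUP_upper) auto
    have "smean p ?g s \<le> L" using up s s0 by simp
    also have "L \<le> smean p ?g s1 + ennreal \<delta>" by (rule s1)
    also have "\<dots> \<le> smean p ?g (s * \<rho>) + ennreal \<delta>"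
      using smean_mono[OF hg(1) p s1(1) sr] by (rule add_right_mono)
    finally have "ennreal C * smean p ?g s \<le> ennreal C * (smean p ?g (s * \<rho>) + ennreal \<delta>)"
      by (rule mult_left_mono) simp
    also have "\<dots> = ennreal e' + ennreal C * smean p ?g (s * \<rho>)"
      using C(1) \<delta> by (simp add: distrib_left add.commute flip: ennreal_mult)
    finally have 1: "ennreal C * smean p ?g s \<le> ennreal e' + ennreal C * smean p ?g (s * \<rho>)" .
    have "ennreal \<epsilon> * smean p ?g (s * \<rho>) \<le> ennreal \<epsilon> * L" using up[OF s0(2) sr(2)] by (rule mult_left_mono) simp
    also have "\<dots> \<le> ennreal e'" using \<epsilon> l by (simp add: ennreal_leI flip: ennreal_mult)
    finally have 2: "ennreal \<epsilon> * smean p ?g (s * \<rho>) \<le> ennreal e'" .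
    have "B s + ennreal C * smean p ?g (s * \<rho>) \<le> ennreal \<epsilon> * smean p ?g (s * \<rho>) + ennreal C * smean p ?g s"
      unfolding B_def by (rule C(2)) (use s0 s \<rho> in auto)
    also have "\<dots> \<le> ennreal e' + (ennreal e' + ennreal C * smean p ?g (s * \<rho>))" using 1 2 by (rule add_mono[rotated])
    finally have 3: "ennreal C * smean p ?g (s * \<rho>) + B s \<le> ennreal C * smean p ?g (s * \<rho>) + ennreal (2 * e')"
      using e' by (simp add: add_ac flip: ennreal_plus)
    have "smean p ?g (s * \<rho>) \<noteq> top" using smean_finite[OF hg(1) s0(2) sr(2), of p] p by simp
    then have "ennreal C * smean p ?g (s * \<rho>) \<noteq> top" by (simp add: ennreal_mult_eq_top_iff)
    with 3 show "B s \<le> ennreal (2 * e')" by (simp add: ennreal_add_left_cancel_le)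
  qed
  define \<eta> where "\<eta> = e' powr (1 / p)"
  have \<eta>: "\<eta> > 0" "\<eta> powr p = e'" using e' p by (auto simp: \<eta>_def powr_powr)
  have "continuous_on (cball 0 \<rho>) ?g"
    by (rule continuous_on_subset[OF holomorphic_vec_on_imp_continuous_on[OF hg(1)]]) (use \<rho> in auto)
  then have "uniformly_continuous_on (cball 0 \<rho>) ?g" by (rule compact_uniformly_continuous) simp
  then obtain d where d: "d > 0" "\<And>x y. x \<in> cball 0 \<rho> \<Longrightarrow> y \<in> cball 0 \<rho> \<Longrightarrow> dist y x < d \<Longrightarrow> dist (?g y) (?g x) < \<eta>"
    using \<eta> unfolding uniformly_continuous_on_def by metis
  \<comment> \<open>Since \<open>\<rho>\<close> is fixed by now, \<open>d\<close> may depend on it;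
    radii above \<open>1 - d\<close> differ by less than \<open>d\<close>.\<close>
  define s0 where "s0 = max \<rho> (1 - d)"
  show ?thesis
  proof (rule that[of s0])
    fix s s' assume s: "s0 < s" "s < 1" and s': "s0 < s'" "s' < 1"
    have r: "\<rho> < s" "\<rho> < s'" "\<bar>s - s'\<bar> < d" using s s' by (auto simp: s0_def)
    have le\<rho>: "x * \<rho> \<le> \<rho>" if "0 \<le> x" "x \<le> 1" for x using that \<rho> by (simp add: mult_left_le_one_le)
    have near: "norm (?g ((s * \<rho>) *\<^sub>R w) - ?g ((s' * \<rho>) *\<^sub>R w)) \<le> \<eta>" if w: "norm w = 1" for w :: "complex^'d"
    proof -
      have "dist (?g ((s * \<rho>) *\<^sub>R w)) (?g ((s' * \<rho>) *\<^sub>R w)) < \<eta>"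
      proof (rule d(2))
        have "dist ((s * \<rho>) *\<^sub>R w) ((s' * \<rho>) *\<^sub>R w) = \<bar>s - s'\<bar> * \<rho>"
          using w \<rho> by (simp add: dist_norm abs_mult flip: scaleR_left_diff_distrib left_diff_distrib)
        also have "\<dots> \<le> \<bar>s - s'\<bar> * 1" using \<rho> by (intro mult_left_mono) auto
        finally show "dist ((s * \<rho>) *\<^sub>R w) ((s' * \<rho>) *\<^sub>R w) < d" using r by simp
      qed (use w s s' r \<rho> le\<rho>[of s] le\<rho>[of s'] in \<open>auto simp: abs_mult\<close>)
      then show ?thesis by (simp add: dist_norm)
    qed
    have "(\<integral>\<^sup>+w. ennreal (norm (g (s *\<^sub>R w) - g (s' *\<^sub>R w)) powr p) \<partial>sphere_measure)
        \<le> (\<integral>\<^sup>+w. ennreal (norm (?g (s *\<^sub>R w) - ?g (s' *\<^sub>R w)) powr p) \<partial>sphere_measure)"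
      by (rule nn_integral_sphere_mono) (use s s' r \<rho> in \<open>auto simp: cutoff_def\<close>)
    also have "\<dots> \<le> ennreal (3 powr p) * (B s + ennreal (\<eta> powr p) + B s')"
      unfolding B_def by (rule smean_diff_dilations_le[OF p hg]) (use s s' r \<rho> near in auto)
    also have "\<dots> \<le> ennreal (3 powr p) * (ennreal (2 * e') + ennreal e' + ennreal (2 * e'))"
      unfolding \<eta>(2) using Bs[OF r(1) s(2)] Bs[OF r(2) s'(2)] by (intro mult_left_mono add_mono) auto
    also have "\<dots> \<le> ennreal e"
      using e' by (simp add: ennreal_leI flip: ennreal_plus ennreal_mult)
    finally show "(\<integral>\<^sup>+w. ennreal (norm (g (s *\<^sub>R w) - g (s' *\<^sub>R w)) powr p) \<partial>sphere_measure) \<le> ennreal e" .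
  qed (use \<rho> d in \<open>auto simp: s0_def\<close>)
qed

section \<open>Bounding a function by its radial derivative at the same radius\<close>

lemma continuous_on_powr_nonneg:
  fixes F :: "'a::topological_space \<Rightarrow> real"
  shows "continuous_on S F \<Longrightarrow> (\<And>x. 0 \<le> F x) \<Longrightarrow> 1 \<le> p \<Longrightarrow> continuous_on S (\<lambda>x. F x powr p)"
  using continuous_on_norm_powr[of S F p] by simp

text \<open>Jensen's inequality, from the tangent of the power function at the mean
  \<open>A\<close>: its linear part integrates to \<open>0\<close>.\<close>

lemma integral_powr_le:
  fixes F :: "real \<Rightarrow> real"
  assumes F: "continuous_on {0..1} F" "\<And>t. 0 \<le> F t" and p: "1 \<le> p"
  shows "integral {0..1} F powr p \<le> integral {0..1} (\<lambda>t. F t powr p)"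
proof -
  define A where "A = integral {0..1} F"
  have int: "F integrable_on {0..1}" "(\<lambda>t. F t powr p) integrable_on {0..1}"
    using F p by (auto intro!: integrable_continuous_real continuous_on_powr_nonneg)
  have "A \<ge> 0" unfolding A_def by (rule integral_nonneg) (use int F in auto)
  show ?thesis
  proof (cases "A = 0")
    case True
    then show ?thesis using integral_nonneg[OF int(2)] by (simp add: A_def)
  next
    case False
    then have "A > 0" using \<open>A \<ge> 0\<close> by simp
    have le: "integral {0..1} (\<lambda>t. A powr p * (1 + p * (F t / A - 1))) \<le> integral {0..1} (\<lambda>t. F t powr p)"
    proof (rule integral_le)
      show "(\<lambda>t. A powr p * (1 + p * (F t / A - 1))) integrable_on {0..1}"
        using F(1) \<open>A > 0\<close> by (auto intro!: integrable_continuous_real continuous_intros)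
      fix t
      have "A powr p * (1 + p * (F t / A - 1)) \<le> A powr p * (F t / A) powr p"
        using F(2) \<open>A > 0\<close> p by (intro mult_left_mono powr_tangent) auto
      also have "\<dots> = F t powr p" using F(2)[of t] \<open>A > 0\<close> by (simp flip: powr_mult)
      finally show "A powr p * (1 + p * (F t / A - 1)) \<le> F t powr p" .
    qed (rule int)
    have "((\<lambda>t. A powr p * (1 + p * (F t / A - 1))) has_integral A powr p * (1 + p * (A / A - 1))) {0..1}"
    proof -
      have c1: "((\<lambda>_. k) has_integral k) {0..1::real}" for k :: real
        using has_integral_const_real[of k 0 1] by simp
      have "(F has_integral A) {0..1}" using int(1) by (simp add: A_def has_integral_integral)
      then show ?thesis
        by (intro has_integral_mult_right has_integral_add has_integral_diff has_integral_divide c1)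
    qed
    then have "integral {0..1} (\<lambda>t. A powr p * (1 + p * (F t / A - 1))) = A powr p * (1 + p * (A / A - 1))"
      by (rule integral_unique)
    then show ?thesis using \<open>A > 0\<close> le by (simp only: A_def[symmetric]) simp
  qed
qed

text \<open>The right side is the length of the image of the unit circle. It bounds the distance
  from \<open>h 1\<close> to every value on the circle, and \<open>h 0\<close> is the mean of these
  values.\<close>

lemma circle_deviation_from_center:
  fixes h h' :: "complex \<Rightarrow> complex"
  assumes "h holomorphic_on ball 0 r" "1 < r"
    and H: "\<And>z. norm z = 1 \<Longrightarrow> (h has_field_derivative h' z) (at z)"
    and cont: "continuous_on (sphere 0 1) h'"
  shows "norm (h 1 - h 0) \<le> 2 * pi * integral {0..1} (\<lambda>t. norm (h' (cis (2 * pi * t))))"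
proof -
  define c where "c = (\<lambda>t. cis (2 * pi * t))"
  define N where "N = integral {0..1} (\<lambda>t. norm (h' (c t)))"
  have cc: "continuous_on S c" for S unfolding c_def by (intro continuous_intros)
  have nc: "norm (c t) = 1" for t by (simp add: c_def)
  have ch': "continuous_on S (\<lambda>t. h' (c t))" for S
    by (rule continuous_on_compose2[OF cont cc]) (auto simp: nc)
  have sub: "cball (0::complex) 1 \<subseteq> ball 0 r" using assms by auto
  have "h holomorphic_on cball 0 1" using assms(1) sub by (rule holomorphic_on_subset)
  then have hc: "continuous_on (cball 0 1) h" "h holomorphic_on ball 0 1"
    using holomorphic_on_imp_continuous_on holomorphic_on_subset ball_subset_cball by blast+
  have dc: "((\<lambda>t. h (c t)) has_vector_derivative (of_real (2 * pi) * \<i> * c t * h' (c t))) (at t within S)" for t S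
  proof -
    have 1: "(c has_vector_derivative (of_real (2 * pi) * \<i> * c t)) (at t within S)"
    proof -
      have c: "c = circlepath 0 1" by (simp add: c_def circlepath fun_eq_iff cis_conv_exp mult_ac)
      have "(circlepath 0 1 has_vector_derivative (2 * of_real pi * \<i> * 1 * exp (2 * of_real pi * \<i> * of_real t))) (at t within S)"
        using has_vector_derivative_circlepath[of 0 1 t S] by simp
      moreover have "2 * of_real pi * \<i> * 1 * exp (2 * of_real pi * \<i> * of_real t) = of_real (2 * pi) * \<i> * c t"
        by (simp add: c_def cis_conv_exp mult_ac)
      ultimately show ?thesis unfolding c by (simp only:)
    qed
    have "(h \<circ> c has_vector_derivative (of_real (2 * pi) * \<i> * c t * h' (c t))) (at t within S)"
      by (rule field_vector_diff_chain_within[OF 1]) (use has_field_derivative_at_within[OF H] nc in auto)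
    then show ?thesis by (simp add: comp_def)
  qed
  have dev: "norm (h (c t) - h 1) \<le> 2 * pi * N" if t: "t \<in> {0..1}" for t
  proof -
    have "((\<lambda>t. of_real (2 * pi) * \<i> * c t * h' (c t)) has_integral (h (c t) - h (c 0))) {0..t}"
      by (rule fundamental_theorem_of_calculus) (use t dc in auto)
    then have i: "h (c t) - h 1 = integral {0..t} (\<lambda>t. of_real (2 * pi) * \<i> * c t * h' (c t))"
      by (simp add: integral_unique c_def)
    have "norm (h (c t) - h 1) \<le> integral {0..t} (\<lambda>t. 2 * pi * norm (h' (c t)))"
      unfolding i
      by (rule integral_norm_bound_integral)
         (auto intro!: integrable_continuous_real continuous_intros ch' cc simp: norm_mult nc)
    also have "\<dots> \<le> integral {0..1} (\<lambda>t. 2 * pi * norm (h' (c t)))"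
      by (rule integral_subset_le) (use t in \<open>auto intro!: integrable_continuous_real continuous_intros ch'\<close>)
    also have "\<dots> = 2 * pi * N" by (simp add: N_def)
    finally show ?thesis .
  qed
  have "((\<lambda>t. h (c t)) has_integral h 0) {0..1}" unfolding c_def by (rule mean_value_disc[OF hc])
  then have i: "((\<lambda>t. h (c t) - h 1) has_integral (h 0 - h 1)) {0..1}"
    using has_integral_diff[of "\<lambda>t. h (c t)" "h 0" "{0..1}" "\<lambda>_. h 1" "h 1"] has_integral_const_real[of "h 1" 0 1] by simp
  have "norm (integral {0..1} (\<lambda>t. h (c t) - h 1)) \<le> integral {0..1} (\<lambda>_::real. 2 * pi * N)"
    by (rule integral_norm_bound_integral) (use i dev in auto)
  then have "norm (h 0 - h 1) \<le> 2 * pi * N" using integral_unique[OF i] by simp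
  then show ?thesis by (simp add: N_def c_def norm_minus_commute[of "h 1"])
qed

text \<open>On the slice through \<open>w\<close>, \<open>circle_deviation_from_center\<close>
  bounds the left side by a circle average of the radial derivative. Jensen's inequality brings the
  power inside, and integration over the sphere absorbs the circle average.\<close>

lemma smean_diff_0_le:
  fixes u :: "complex^'d::finite \<Rightarrow> complex"
  assumes u: "holomorphic_vec_on u (ball 0 1)" and s: "0 \<le> s" "s < 1" and p: "1 \<le> p"
  shows "smean p (\<lambda>z. u z - u 0) s \<le> ennreal ((2 * pi) powr p) * smean p (radial_deriv u) s"
proof -
  let ?R = "cutoff (radial_deriv u)"
  have [measurable]: "?R \<in> borel_measurable borel"
    by (rule cutoff_measurable[OF holomorphic_radial_deriv[OF u]])
  interpret C: finite_measure circle_param by (rule finite_circle_param)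
  have [measurable]: "(\<lambda>t. cis (2 * pi * t)) \<in> borel_measurable borel"
    by (intro borel_measurable_continuous_onI continuous_intros)
  have "smean p (\<lambda>z. u z - u 0) s
    \<le> (\<integral>\<^sup>+w. ennreal ((2 * pi) powr p) * (\<integral>\<^sup>+t. ennreal (norm (?R (s *\<^sub>R (cis (2 * pi * t) *s w))) powr p) \<partial>circle_param) \<partial>sphere_measure)"
    unfolding smean_def
  proof (rule nn_integral_sphere_mono)
    fix w :: "complex^'d" assume w: "norm w = 1"
    define v where "v = s *\<^sub>R w"
    \<comment> \<open>Chosen so that \<open>1 < r\<close> and \<open>r * s < 1\<close>: the slice
      extends holomorphically beyond the closed unit disc.\<close>
    define r where "r = 2 / (1 + s)"
    have r: "1 < r" "r * s < 1" using s by (auto simp: r_def field_simps)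
    have nv: "norm v = s" using w s by (simp add: v_def)
    have inb: "z *s v \<in> ball 0 1" if "z \<in> ball 0 r" for z
    proof -
      have "norm z * s \<le> r * s" using that s by (intro mult_right_mono) auto
      then show ?thesis using r by (simp add: norm_cscale nv)
    qed
    define h where "h = (\<lambda>z. u (z *s v))"
    define h' where "h' = (\<lambda>z. radial_deriv u (z *s v) / z)"
    have "(\<lambda>z. u (0 + z *s v)) holomorphic_on ball 0 r" by (rule holomorphic_on_line[OF u]) (use inb in auto)
    then have hol: "h holomorphic_on ball 0 r" by (simp add: h_def)
    have "(\<lambda>z. radial_deriv u (0 + z *s v)) holomorphic_on ball 0 r"
      by (rule holomorphic_on_line[OF holomorphic_radial_deriv[OF u]]) (use inb in auto)
    then have "continuous_on (ball 0 r) (\<lambda>z. radial_deriv u (z *s v))"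
      by (simp add: holomorphic_on_imp_continuous_on)
    then have conR: "continuous_on (sphere 0 1) (\<lambda>z. radial_deriv u (z *s v))"
      by (rule continuous_on_subset) (use r in auto)
    then have conh': "continuous_on (sphere 0 1) h'" unfolding h'_def by (intro continuous_intros) auto
    have D: "(h has_field_derivative h' z) (at z)" if z: "norm z = 1" for z
    proof -
      have "z *s v \<in> ball 0 1" using inb[of z] z r by auto
      then obtain D where "((\<lambda>t. u (t *s v)) has_field_derivative D) (at z)" "radial_deriv u (z *s v) = z * D"
        using has_field_derivative_slice[OF u] by blast
      moreover have "z \<noteq> 0" using z by auto
      ultimately show ?thesis by (simp add: h_def h'_def)
    qed
    define F where "F = (\<lambda>t. norm (h' (cis (2 * pi * t))))"
    have cF: "continuous_on UNIV F" unfolding F_def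
      by (intro continuous_intros continuous_on_compose2[OF conh']) auto
    have F0: "0 \<le> F t" for t by (simp add: F_def)
    have FR: "F t = norm (?R (s *\<^sub>R (cis (2 * pi * t) *s w)))" for t
    proof -
      have "s *\<^sub>R (cis (2 * pi * t) *s w) = cis (2 * pi * t) *s v"
        by (simp add: v_def scaleR_cscale mult.commute)
      then show ?thesis using nv s by (simp add: F_def h'_def cutoff_def norm_divide norm_cscale)
    qed
    have "norm (u v - u 0) \<le> 2 * pi * integral {0..1} F"
      using circle_deviation_from_center[OF hol r(1) D conh'] by (simp add: h_def F_def)
    then have "norm (u v - u 0) powr p \<le> (2 * pi * integral {0..1} F) powr p"
      using p by (intro powr_mono2) auto
    also have "\<dots> = (2 * pi) powr p * integral {0..1} F powr p"
      using F0 continuous_on_subset[OF cF] by (intro powr_mult)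
    also have "\<dots> \<le> (2 * pi) powr p * integral {0..1} (\<lambda>t. F t powr p)"
      by (intro mult_left_mono integral_powr_le continuous_on_subset[OF cF] F0 p) auto
    finally have "ennreal (norm (u v - u 0) powr p) \<le> ennreal ((2 * pi) powr p * integral {0..1} (\<lambda>t. F t powr p))"
      by (rule ennreal_leI)
    also have "\<dots> = ennreal ((2 * pi) powr p) * ennreal (integral {0..1} (\<lambda>t. F t powr p))"
      by (rule ennreal_mult') simp
    also have "ennreal (integral {0..1} (\<lambda>t. F t powr p)) = (\<integral>\<^sup>+t. ennreal (F t powr p) \<partial>circle_param)"
      by (rule nn_integral_circle_param[symmetric]) (use F0 cF p in \<open>auto intro!: continuous_on_powr_nonneg\<close>)
    finally show "ennreal (norm (u (s *\<^sub>R w) - u 0) powr p)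
      \<le> ennreal ((2 * pi) powr p) * (\<integral>\<^sup>+t. ennreal (norm (?R (s *\<^sub>R (cis (2 * pi * t) *s w))) powr p) \<partial>circle_param)"
      by (simp only: FR v_def)
  qed
  also have "\<dots> = ennreal ((2 * pi) powr p) * (\<integral>\<^sup>+w. (\<integral>\<^sup>+t. ennreal (norm (?R (s *\<^sub>R (cis (2 * pi * t) *s w))) powr p) \<partial>circle_param) \<partial>sphere_measure)"
    by (rule nn_integral_cmult) measurable
  also have "(\<integral>\<^sup>+w. (\<integral>\<^sup>+t. ennreal (norm (?R (s *\<^sub>R (cis (2 * pi * t) *s w))) powr p) \<partial>circle_param) \<partial>sphere_measure) = smean p ?R s"
    unfolding smean_def
    by (rule nn_integral_sphere_circle[of "\<lambda>w. ennreal (norm (?R (s *\<^sub>R w)) powr p)"]) (auto intro!: continuous_intros)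
  finally show ?thesis using s by (simp add: smean_cutoff)
qed

text \<open>The induction keeps \<open>u\<close> arbitrary because the product rule replaces
  \<open>u\<close> by its radial derivative in one summand. There \<open>h\<close> carries one
  derivative too few, which \<open>smean_diff_0_le\<close> supplies; in the other summand
  \<open>radial_deriv h\<close> vanishes at \<open>0\<close> automatically, so the induction
  hypothesis applies. For \<open>N = 0\<close> the estimate is pointwise, so the normalization at
  \<open>0\<close> is demanded only for positive \<open>N\<close>.\<close>

lemma smean_radial_deriv_mult_le:
  fixes u :: "complex^'d::finite \<Rightarrow> complex"
  assumes p: "1 \<le> p" and u: "holomorphic_vec_on u (ball 0 1)"
    and bdd: "\<And>k. k \<le> N \<Longrightarrow> \<exists>K. \<forall>z\<in>ball 0 1. norm ((radial_deriv ^^ k) u z) \<le> K"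
  shows "\<exists>C\<ge>0. \<forall>h s. holomorphic_vec_on h (ball 0 1) \<longrightarrow> (N > 0 \<longrightarrow> h 0 = 0) \<longrightarrow> 0 \<le> s \<longrightarrow> s < 1 \<longrightarrow>
    smean p ((radial_deriv ^^ N) (\<lambda>z. u z * h z)) s \<le> ennreal C * smean p ((radial_deriv ^^ N) h) s"
  using u bdd
proof (induction N arbitrary: u)
  case 0
  have "\<exists>K. \<forall>z\<in>ball 0 1. norm (u z) \<le> K" using 0(2)[of 0] by simp
  then obtain K where K: "\<And>z. z \<in> ball 0 1 \<Longrightarrow> norm (u z) \<le> K" by blast
  define K' where "K' = max K 0"
  have "smean p (\<lambda>z. u z * h z) s \<le> ennreal (K' powr p) * smean p h s"
    if "holomorphic_vec_on h (ball 0 1)" "0 \<le> s" "s < 1" for h s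
  proof (rule smean_scale[OF that])
    fix z :: "complex^'d" assume "norm z = s"
    then have "norm (u z) \<le> K'" using K[of z] that by (simp add: K'_def)
    then show "norm (u z * h z) \<le> K' * norm (h z)" by (simp add: norm_mult mult_right_mono)
  qed (use p in \<open>auto simp: K'_def\<close>)
  then show ?case by (intro exI[of _ "K' powr p"]) auto
next
  case (Suc N)
  have bu: "\<exists>K. \<forall>z\<in>ball 0 1. norm ((radial_deriv ^^ k) u z) \<le> K" if "k \<le> N" for k
    using Suc.prems(2)[of k] that by auto
  have bRu: "\<exists>K. \<forall>z\<in>ball 0 1. norm ((radial_deriv ^^ k) (radial_deriv u) z) \<le> K" if "k \<le> N" for k
    using Suc.prems(2)[of "Suc k"] that by (simp add: funpow_swap1)
  obtain C1 where C1: "C1 \<ge> 0" "\<And>h s. holomorphic_vec_on h (ball 0 1) \<Longrightarrow> (N > 0 \<Longrightarrow> h 0 = 0) \<Longrightarrow> 0 \<le> s \<Longrightarrow> s < 1 \<Longrightarrow>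
    smean p ((radial_deriv ^^ N) (\<lambda>z. radial_deriv u z * h z)) s \<le> ennreal C1 * smean p ((radial_deriv ^^ N) h) s"
    using Suc.IH[OF holomorphic_radial_deriv[OF Suc.prems(1)] bRu] by blast
  obtain C2 where C2: "C2 \<ge> 0" "\<And>h s. holomorphic_vec_on h (ball 0 1) \<Longrightarrow> (N > 0 \<Longrightarrow> h 0 = 0) \<Longrightarrow> 0 \<le> s \<Longrightarrow> s < 1 \<Longrightarrow>
    smean p ((radial_deriv ^^ N) (\<lambda>z. u z * h z)) s \<le> ennreal C2 * smean p ((radial_deriv ^^ N) h) s"
    using Suc.IH[OF Suc.prems(1) bu] by blast
  define C where "C = 2 powr p * (C1 * (2 * pi) powr p + C2)"
  have "C \<ge> 0" using C1(1) C2(1) by (simp add: C_def)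
  moreover have "smean p ((radial_deriv ^^ Suc N) (\<lambda>z. u z * h z)) s \<le> ennreal C * smean p ((radial_deriv ^^ Suc N) h) s"
    if h: "holomorphic_vec_on h (ball 0 1)" and h0: "h 0 = 0" and s: "0 \<le> s" "s < 1" for h s
  proof -
    have u: "holomorphic_vec_on u (ball 0 1)" by (rule Suc.prems)
    let ?A = "\<lambda>z. radial_deriv u z * h z" and ?B = "\<lambda>z. u z * radial_deriv h z"
    have hol: "holomorphic_vec_on ?A (ball 0 1)" "holomorphic_vec_on ?B (ball 0 1)"
       "holomorphic_vec_on (\<lambda>z. u z * h z) (ball 0 1)"
      using u h holomorphic_radial_deriv by (auto intro!: holomorphic_vec_on_mult)
    have eq: "(radial_deriv ^^ Suc N) (\<lambda>z. u z * h z) z = (radial_deriv ^^ N) ?A z + (radial_deriv ^^ N) ?B z"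
      if z: "z \<in> ball 0 1" for z
    proof -
      have "(radial_deriv ^^ Suc N) (\<lambda>z. u z * h z) z = (radial_deriv ^^ N) (radial_deriv (\<lambda>z. u z * h z)) z"
        by (simp add: funpow_swap1)
      also have "\<dots> = (radial_deriv ^^ N) (\<lambda>z. ?A z + ?B z) z"
        by (rule radial_deriv_pow_cong[OF _ holomorphic_radial_deriv[OF hol(3)] z])
           (rule radial_deriv_mult[OF u h open_ball])
      also have "\<dots> = (radial_deriv ^^ N) ?A z + (radial_deriv ^^ N) ?B z"
        by (rule radial_deriv_pow_add[OF hol(1,2) z])
      finally show ?thesis .
    qed
    \<comment> \<open>For \<open>N = 0\<close> this is the normalization of \<open>h\<close>; for
      larger \<open>N\<close> every radial derivative vanishes at the origin.\<close>
    have z0: "(radial_deriv ^^ N) h 0 = 0"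
      using h0 by (cases N) (auto simp: radial_deriv_0)
    have "smean p ((radial_deriv ^^ N) h) s = smean p (\<lambda>z. (radial_deriv ^^ N) h z - (radial_deriv ^^ N) h 0) s"
      by (simp add: z0)
    also have "\<dots> \<le> ennreal ((2 * pi) powr p) * smean p (radial_deriv ((radial_deriv ^^ N) h)) s"
      by (rule smean_diff_0_le[OF holomorphic_radial_deriv_pow[OF h] s p])
    finally have P: "smean p ((radial_deriv ^^ N) h) s \<le> ennreal ((2 * pi) powr p) * smean p ((radial_deriv ^^ Suc N) h) s"
      by simp
    let ?S = "smean p ((radial_deriv ^^ Suc N) h) s"
    have "smean p ((radial_deriv ^^ Suc N) (\<lambda>z. u z * h z)) s = smean p (\<lambda>z. (radial_deriv ^^ N) ?A z + (radial_deriv ^^ N) ?B z) s"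
      by (rule smean_cong) (use s eq in auto)
    also have "\<dots> \<le> ennreal (2 powr p) * (smean p ((radial_deriv ^^ N) ?A) s + smean p ((radial_deriv ^^ N) ?B) s)"
      by (rule smean_add_le) (use hol s p in \<open>auto intro: holomorphic_radial_deriv_pow\<close>)
    also have "\<dots> \<le> ennreal (2 powr p) * (ennreal C1 * (ennreal ((2 * pi) powr p) * ?S) + ennreal C2 * ?S)"
    proof (intro mult_left_mono add_mono)
      show "smean p ((radial_deriv ^^ N) ?A) s \<le> ennreal C1 * (ennreal ((2 * pi) powr p) * ?S)"
        by (rule order_trans[OF C1(2)[OF h h0 s] mult_left_mono[OF P]]) simp
      have "smean p ((radial_deriv ^^ N) ?B) s \<le> ennreal C2 * smean p ((radial_deriv ^^ N) (radial_deriv h)) s"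
        by (rule C2(2)[OF holomorphic_radial_deriv[OF h] radial_deriv_0 s])
      then show "smean p ((radial_deriv ^^ N) ?B) s \<le> ennreal C2 * ?S" by (simp add: funpow_swap1)
    qed simp
    also have "\<dots> = ennreal C * ?S"
      using C1(1) C2(1) by (simp add: C_def ennreal_mult ennreal_plus algebra_simps)
    finally show ?thesis .
  qed
  ultimately show ?case by (intro exI[of _ C]) auto
qed

section \<open>Mixed norms and cyclicity\<close>

lemma ennreal_powr_top [simp]: "ennreal_powr \<infinity> a = \<infinity>" "ennreal_powr top a = top"
  by (auto simp: ennreal_powr_def)

lemma ennreal_powr_ennreal: "0 \<le> x \<Longrightarrow> ennreal_powr (ennreal x) a = ennreal (x powr a)"
  by (simp add: ennreal_powr_def)

lemma ennreal_powr_0 [simp]: "ennreal_powr 0 a = 0"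
  using ennreal_powr_ennreal[of 0 a] by simp

lemma ennreal_powr_mono:
  assumes "x \<le> y" "0 \<le> a" shows "ennreal_powr x a \<le> ennreal_powr y a"
proof (cases y)
  case (real r)
  then obtain s where s: "x = ennreal s" "0 \<le> s" "s \<le> r" using assms by (cases x) (auto simp: top_unique)
  then show ?thesis using real assms by (simp add: ennreal_powr_ennreal ennreal_leI powr_mono2)
qed simp

lemma ennreal_powr_cmult_le:
  assumes "0 \<le> c" "0 < a"
  shows "ennreal_powr (ennreal c * x) a \<le> ennreal (c powr a) * ennreal_powr x a"
proof (cases x)
  case (real r)
  then show ?thesis using assms by (simp add: ennreal_powr_ennreal powr_mult flip: ennreal_mult)
next
  case top
  then show ?thesis using assms by (cases "c = 0") (auto simp: ennreal_mult_top)
qed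

lemma ennreal_powr_add_le:
  assumes "0 \<le> a"
  shows "ennreal_powr (x + y) a \<le> ennreal (2 powr a) * (ennreal_powr x a + ennreal_powr y a)"
proof (cases "x = top \<or> y = top")
  case True
  then show ?thesis by (auto simp: ennreal_mult_top)
next
  case False
  then obtain r s where "x = ennreal r" "0 \<le> r" "y = ennreal s" "0 \<le> s" by (metis ennreal_cases)
  then show ?thesis using assms add_powr_le[of r s a]
    by (simp add: ennreal_powr_ennreal ennreal_leI flip: ennreal_plus ennreal_mult)
qed

lemma ennreal_powr_less:
  assumes "x < ennreal (e powr (1 / a))" "0 < a" "0 < e"
  shows "ennreal_powr x a < ennreal e"
proof (cases x)
  case (real r)
  then have "r < e powr (1 / a)" using assms by (simp add: ennreal_less_iff)
  then have "r powr a < (e powr (1 / a)) powr a" using real assms by (intro powr_less_mono2) auto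
  then have "r powr a < e" using assms by (simp add: powr_powr)
  then show ?thesis using real by (simp add: ennreal_powr_ennreal ennreal_less_iff)
qed (use assms in auto)

lemma ennreal_positive_real_below:
  fixes y :: ennreal
  assumes "0 < y"
  obtains e :: real where "0 < e" "ennreal e < y"
proof -
  obtain z where z: "0 < z" "z < y" using dense assms by blast
  then obtain e where "z = ennreal e" "0 \<le> e" by (cases z) auto
  then show ?thesis using that[of e] z by auto
qed

lemma ennreal_powr_tendsto_0:
  assumes "(f \<longlongrightarrow> 0) F" "0 < a"
  shows "((\<lambda>x. ennreal_powr (f x) a) \<longlongrightarrow> 0) F"
proof (rule order_tendstoI)
  fix y :: ennreal assume "0 < y"
  then obtain e where e: "0 < e" "ennreal e < y" by (rule ennreal_positive_real_below)
  then have "e > 0" by simp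
  have "\<forall>\<^sub>F x in F. f x < ennreal (e powr (1 / a))"
    using order_tendstoD(2)[OF assms(1)] \<open>e > 0\<close> by simp
  then show "\<forall>\<^sub>F x in F. ennreal_powr (f x) a < y"
    by eventually_elim (use ennreal_powr_less[OF _ assms(2) \<open>e > 0\<close>] e(2) in \<open>blast intro: less_trans\<close>)
qed simp

section \<open>Means up to radius one and the mixed norm\<close>

lemma sphere_mean_eq_smean: "r < 1 \<Longrightarrow> sphere_mean p g r = smean p g r"
  by (simp add: sphere_mean_def smean_def)

lemma sphere_mean_eq_SUP: "1 \<le> r \<Longrightarrow> sphere_mean p g r = (SUP s\<in>{0..<1}. smean p g s)"
  by (simp add: sphere_mean_def smean_def)

lemma sphere_mean_mono:
  fixes g :: "complex^'d::finite \<Rightarrow> complex"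
  assumes g: "holomorphic_vec_on g (ball 0 1)" and p: "1 \<le> p" and rs: "0 \<le> r" "r \<le> s"
  shows "sphere_mean p g r \<le> sphere_mean p g s"
proof -
  consider "s < 1" | "r < 1" "1 \<le> s" | "1 \<le> r" "1 \<le> s" using rs by linarith
  then show ?thesis
  proof cases
    case 2
    then show ?thesis using rs by (auto simp: sphere_mean_eq_smean sphere_mean_eq_SUP intro!: SUP_upper)
  qed (use smean_mono[OF g p rs] rs in \<open>auto simp: sphere_mean_eq_smean sphere_mean_eq_SUP\<close>)
qed

text \<open>Estimates at radii below \<open>1\<close> reach a possible atom of \<open>\<mu>\<close>
  at \<open>1\<close> through the supremum. The two terms on the right serve sums; comparisons with
  a single function take a zero coefficient.\<close>

lemma sphere_mean_lin:
  assumes "\<And>s. 0 \<le> s \<Longrightarrow> s < 1 \<Longrightarrow> smean p f s \<le> a * smean p g s + b * smean p h s" "0 \<le> r"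
  shows "sphere_mean p f r \<le> a * sphere_mean p g r + b * sphere_mean p h r"
proof (cases "r < 1")
  case False
  then have "sphere_mean p f r = (SUP s\<in>{0..<1}. smean p f s)" by (simp add: sphere_mean_eq_SUP)
  also have "\<dots> \<le> a * (SUP s\<in>{0..<1}. smean p g s) + b * (SUP s\<in>{0..<1}. smean p h s)"
  proof (rule SUP_least)
    fix s :: real assume s: "s \<in> {0..<1}"
    then have "smean p f s \<le> a * smean p g s + b * smean p h s" using assms by simp
    also have "\<dots> \<le> a * (SUP s\<in>{0..<1}. smean p g s) + b * (SUP s\<in>{0..<1}. smean p h s)"
      using s by (intro add_mono mult_left_mono SUP_upper) auto
    finally show "smean p f s \<le> a * (SUP s\<in>{0..<1}. smean p g s) + b * (SUP s\<in>{0..<1}. smean p h s)" .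
  qed
  finally show ?thesis using False by (simp add: sphere_mean_eq_SUP)
qed (use assms in \<open>simp add: sphere_mean_eq_smean\<close>)

definition mixed_integral :: "real measure \<Rightarrow> real \<Rightarrow> real \<Rightarrow> (complex^'d::finite \<Rightarrow> complex) \<Rightarrow> ennreal" where
  "mixed_integral \<mu> p q g = (\<integral>\<^sup>+r. ennreal_powr (sphere_mean p g r) (q / p) \<partial>\<mu>)"

lemma mixed_norm_eq: "mixed_norm \<mu> p q g = ennreal_powr (mixed_integral \<mu> p q g) (1 / q)"
  by (simp add: mixed_norm_def mixed_integral_def)

locale radial_weight =
  fixes \<mu> :: "real measure" and p q :: real
  assumes sets_mu: "sets \<mu> = sets (restrict_space borel {0..1})"
    and p: "1 \<le> p" and q: "1 \<le> q"
begin

lemma space_mu: "space \<mu> = {0..1}"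
  using sets_eq_imp_space_eq[OF sets_mu] by (simp add: space_restrict_space)

text \<open>Superlevel sets of an increasing function are intervals. As sphere means increase with
  the radius, their measurability in \<open>r\<close> requires no joint measurability.\<close>

lemma mono_measurable:
  fixes f :: "real \<Rightarrow> ennreal"
  assumes "\<And>r s. 0 \<le> r \<Longrightarrow> r \<le> s \<Longrightarrow> s \<le> 1 \<Longrightarrow> f r \<le> f s"
  shows "f \<in> borel_measurable \<mu>"
proof (rule borel_measurableI_greater)
  fix y
  have "is_interval {x \<in> {0..1}. y < f x}"
    unfolding is_interval_1 using assms by (auto intro: order_less_le_trans)
  then have "{x \<in> {0..1}. y < f x} \<in> sets borel" by (rule real_interval_borel_measurable)
  then show "{x \<in> space \<mu>. y < f x} \<in> sets \<mu>"
    unfolding sets_mu space_mu by (subst sets_restrict_space_iff) auto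
qed

lemma sphere_mean_powr_measurable:
  assumes "holomorphic_vec_on g (ball 0 1)"
  shows "(\<lambda>r. ennreal_powr (sphere_mean p g r) (q / p)) \<in> borel_measurable \<mu>"
  by (rule mono_measurable) (use assms p q in \<open>auto intro!: ennreal_powr_mono sphere_mean_mono\<close>)

text \<open>The coefficients enter as \<open>p\<close>-th powers so that \<open>a\<close> and
  \<open>b\<close> come out linearly. The constant collects two uses of
  \<open>ennreal_powr_add_le\<close>: the one with exponent \<open>q / p\<close> contributes
  \<open>2 powr (1 / p)\<close> after the final root, the one with exponent \<open>1 / q\<close>
  contributes \<open>2 powr (1 / q)\<close>.\<close>

lemma mixed_norm_lin:
  assumes g: "holomorphic_vec_on g (ball 0 1)" and h: "holomorphic_vec_on h (ball 0 1)" and ab: "0 \<le> a" "0 \<le> b"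
    and le: "\<And>s. 0 \<le> s \<Longrightarrow> s < 1 \<Longrightarrow> smean p f s \<le> ennreal (a powr p) * smean p g s + ennreal (b powr p) * smean p h s"
  shows "mixed_norm \<mu> p q f \<le> ennreal (2 powr (1 / p) * 2 powr (1 / q)) * (ennreal a * mixed_norm \<mu> p q g + ennreal b * mixed_norm \<mu> p q h)"
proof -
  have pq: "0 < p" "0 < q" "0 < q / p" using p q by auto
  let ?P = "\<lambda>g r. ennreal_powr (sphere_mean p g r) (q / p)"
  have meas [measurable]: "?P g \<in> borel_measurable \<mu>" "?P h \<in> borel_measurable \<mu>"
    using sphere_mean_powr_measurable g h by blast+
  have c: "ennreal_powr (ennreal (c powr p) * x) (q / p) \<le> ennreal (c powr q) * ennreal_powr x (q / p)" if "0 \<le> c" for c x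
    using ennreal_powr_cmult_le[of "c powr p" "q / p" x] that pq by (simp add: powr_powr)
  have "mixed_integral \<mu> p q f \<le> (\<integral>\<^sup>+r. ennreal (2 powr (q / p)) * (ennreal (a powr q) * ?P g r + ennreal (b powr q) * ?P h r) \<partial>\<mu>)"
    unfolding mixed_integral_def
  proof (rule nn_integral_mono)
    fix r assume "r \<in> space \<mu>"
    then have r: "0 \<le> r" by (simp add: space_mu)
    have "?P f r \<le> ennreal_powr (ennreal (a powr p) * sphere_mean p g r + ennreal (b powr p) * sphere_mean p h r) (q / p)"
      using pq by (intro ennreal_powr_mono sphere_mean_lin le r) auto
    also have "\<dots> \<le> ennreal (2 powr (q / p)) * (ennreal_powr (ennreal (a powr p) * sphere_mean p g r) (q / p) + ennreal_powr (ennreal (b powr p) * sphere_mean p h r) (q / p))"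
      using pq by (intro ennreal_powr_add_le) auto
    also have "\<dots> \<le> ennreal (2 powr (q / p)) * (ennreal (a powr q) * ?P g r + ennreal (b powr q) * ?P h r)"
      by (intro mult_left_mono add_mono c ab) auto
    finally show "?P f r \<le> ennreal (2 powr (q / p)) * (ennreal (a powr q) * ?P g r + ennreal (b powr q) * ?P h r)" .
  qed
  also have "\<dots> = ennreal (2 powr (q / p)) * (ennreal (a powr q) * mixed_integral \<mu> p q g + ennreal (b powr q) * mixed_integral \<mu> p q h)"
    unfolding mixed_integral_def by (simp add: nn_integral_cmult nn_integral_add)
  finally have J: "mixed_integral \<mu> p q f \<le> \<dots>" .
  have c': "ennreal_powr (ennreal (c powr q) * x) (1 / q) \<le> ennreal c * ennreal_powr x (1 / q)" if "0 \<le> c" for c x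
    using ennreal_powr_cmult_le[of "c powr q" "1 / q" x] that pq by (simp add: powr_powr)
  let ?X = "ennreal (a powr q) * mixed_integral \<mu> p q g" and ?Y = "ennreal (b powr q) * mixed_integral \<mu> p q h"
  have "mixed_norm \<mu> p q f \<le> ennreal_powr (ennreal (2 powr (q / p)) * (?X + ?Y)) (1 / q)"
    unfolding mixed_norm_eq using J pq by (intro ennreal_powr_mono) auto
  also have "\<dots> \<le> ennreal (2 powr (1 / p)) * ennreal_powr (?X + ?Y) (1 / q)"
    using ennreal_powr_cmult_le[of "2 powr (q / p)" "1 / q" "?X + ?Y"] pq by (simp add: powr_powr)
  also have "\<dots> \<le> ennreal (2 powr (1 / p)) * (ennreal (2 powr (1 / q)) * (ennreal_powr ?X (1 / q) + ennreal_powr ?Y (1 / q)))"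
    using pq by (intro mult_left_mono ennreal_powr_add_le) auto
  also have "\<dots> \<le> ennreal (2 powr (1 / p)) * (ennreal (2 powr (1 / q)) * (ennreal a * mixed_norm \<mu> p q g + ennreal b * mixed_norm \<mu> p q h))"
    unfolding mixed_norm_eq by (intro mult_left_mono add_mono c' ab) auto
  finally show ?thesis by (simp add: ennreal_mult mult.assoc)
qed

lemma smean_diff_le:
  fixes g h :: "complex^'d::finite \<Rightarrow> complex"
  assumes g: "holomorphic_vec_on g (ball 0 1)" and h: "holomorphic_vec_on h (ball 0 1)" and s: "0 \<le> s" "s < 1"
  shows "smean p (\<lambda>z. g z - h z) s \<le> ennreal (2 powr p) * (smean p g s + smean p h s)"
proof -
  have "smean p (\<lambda>z. g z + (- h z)) s \<le> ennreal (2 powr p) * (smean p g s + smean p (\<lambda>z. - h z) s)"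
    using holomorphic_vec_on_mult[OF holomorphic_vec_on_const[of "-1"] h] p by (intro smean_add_le g s) auto
  then show ?thesis by (simp add: smean_def)
qed

text \<open>Below radius \<open>1\<close> uniform continuity suffices. At radius \<open>1\<close>
  the mean is a supremum: \<open>smean_dilations_Cauchy\<close> handles radii near \<open>1\<close>,
  and monotonicity of the means, applied to the difference itself, covers the smaller radii.\<close>

lemma sphere_mean_diff_dilations_tendsto:
  fixes G :: "complex^'d::finite \<Rightarrow> complex"
  assumes G: "holomorphic_vec_on G (ball 0 1)" and fin: "sphere_mean p G r < \<infinity>" and r: "0 \<le> r"
    and t: "\<And>n. 0 < t n" "\<And>n. t n < 1" and tl: "t \<longlonglongrightarrow> 1"
  shows "(\<lambda>n. sphere_mean p (\<lambda>z. G z - G (t n *\<^sub>R z)) r) \<longlonglongrightarrow> 0"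
proof (rule order_tendstoI)
  fix y :: ennreal assume "0 < y"
  then obtain e where e: "0 < e" "ennreal e < y" by (rule ennreal_positive_real_below)
  then have "e > 0" by simp
  have hol: "holomorphic_vec_on (\<lambda>z. G z - G (t n *\<^sub>R z)) (ball 0 1)" for n
    using t[of n] by (intro holomorphic_vec_on_diff G holomorphic_vec_on_dilate) auto
  have "\<forall>\<^sub>F n in sequentially. sphere_mean p (\<lambda>z. G z - G (t n *\<^sub>R z)) r \<le> ennreal e"
  proof (cases "r < 1")
    case True
    define \<eta> where "\<eta> = e powr (1 / p)"
    have \<eta>: "\<eta> > 0" "\<eta> powr p = e" using \<open>e > 0\<close> p by (auto simp: \<eta>_def powr_powr)
    have "continuous_on (cball 0 r) G"
      by (rule continuous_on_subset[OF holomorphic_vec_on_imp_continuous_on[OF G]]) (use True in auto)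
    then have "uniformly_continuous_on (cball 0 r) G" by (rule compact_uniformly_continuous) simp
    then obtain d where d: "d > 0" "\<And>x y. x \<in> cball 0 r \<Longrightarrow> y \<in> cball 0 r \<Longrightarrow> dist y x < d \<Longrightarrow> dist (G y) (G x) < \<eta>"
      using \<eta> unfolding uniformly_continuous_on_def by metis
    have "\<forall>\<^sub>F n in sequentially. 1 - d < t n" using tl d by (intro order_tendstoD(1)) auto
    then show ?thesis
    proof eventually_elim
      case (elim n)
      have "smean p (\<lambda>z. G z - G (t n *\<^sub>R z)) r \<le> ennreal (\<eta> powr p)"
      proof (rule smean_le_const)
        fix z :: "complex^'d" assume z: "norm z = r"
        have "dist (G z) (G (t n *\<^sub>R z)) < \<eta>"
        proof (rule d(2))
          have "t n * r \<le> r" using t[of n] r by (simp add: mult_left_le_one_le)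
          then show "t n *\<^sub>R z \<in> cball 0 r" using z t(1)[of n] by simp
          have "z - t n *\<^sub>R z = (1 - t n) *\<^sub>R z" by (simp add: algebra_simps)
          then have "dist z (t n *\<^sub>R z) = (1 - t n) * r" using z t[of n] by (simp add: dist_norm)
          also have "\<dots> \<le> 1 - t n" using True r t[of n] by (intro mult_left_le) auto
          finally show "dist z (t n *\<^sub>R z) < d" using elim by simp
        qed (use z in simp)
        then show "norm (G z - G (t n *\<^sub>R z)) \<le> \<eta>" by (simp add: dist_norm)
      qed (use r p in auto)
      then show ?case using True \<eta> by (simp add: sphere_mean_eq_smean)
    qed
  next
    case False
    then have "(SUP s\<in>{0..<1}. smean p G s) < \<infinity>" using fin by (simp add: sphere_mean_eq_SUP)
    then obtain s0 where s0: "0 \<le> s0" "s0 < 1"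
      "\<And>s s'. s0 < s \<Longrightarrow> s < 1 \<Longrightarrow> s0 < s' \<Longrightarrow> s' < 1 \<Longrightarrow>
        (\<integral>\<^sup>+w. ennreal (norm (G (s *\<^sub>R w) - G (s' *\<^sub>R w)) powr p) \<partial>sphere_measure) \<le> ennreal e"
      using smean_dilations_Cauchy[OF p G _ \<open>e > 0\<close>] by blast
    \<comment> \<open>For \<open>s \<ge> \<sigma>\<close> and \<open>t n > s0 / \<sigma>\<close>
      both \<open>s\<close> and \<open>s * t n\<close> exceed \<open>s0\<close>, as the Cauchy
      condition demands.\<close>
    define \<sigma> where "\<sigma> = (1 + s0) / 2"
    have \<sigma>: "s0 < \<sigma>" "\<sigma> < 1" "0 < \<sigma>" using s0 by (auto simp: \<sigma>_def)
    have "\<forall>\<^sub>F n in sequentially. s0 / \<sigma> < t n" using tl \<sigma> by (intro order_tendstoD(1)) auto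
    then show ?thesis
    proof eventually_elim
      case (elim n)
      have big: "smean p (\<lambda>z. G z - G (t n *\<^sub>R z)) s \<le> ennreal e" if s: "\<sigma> \<le> s" "s < 1" for s
      proof -
        have "s0 < \<sigma> * t n" using elim \<sigma> by (simp add: divide_less_eq mult.commute)
        also have "\<dots> \<le> s * t n" using s t(1)[of n] by (intro mult_right_mono) auto
        finally have "s0 < s * t n" .
        moreover have "s * t n < 1" using s t[of n] \<sigma> mult_strict_mono[of s 1 "t n" 1] by simp
        ultimately have "(\<integral>\<^sup>+w. ennreal (norm (G (s *\<^sub>R w) - G ((s * t n) *\<^sub>R w)) powr p) \<partial>sphere_measure) \<le> ennreal e"
          using s \<sigma> by (intro s0(3)) auto
        then show ?thesis by (simp add: smean_def mult.commute)
      qed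
      have "smean p (\<lambda>z. G z - G (t n *\<^sub>R z)) s \<le> ennreal e" if s: "0 \<le> s" "s < 1" for s
      proof (cases "\<sigma> \<le> s")
        case False
        then have "smean p (\<lambda>z. G z - G (t n *\<^sub>R z)) s \<le> smean p (\<lambda>z. G z - G (t n *\<^sub>R z)) \<sigma>"
          by (intro smean_mono[OF hol p]) (use s \<sigma> in auto)
        then show ?thesis using big[of \<sigma>] \<sigma> by (auto intro: order_trans)
      qed (use big s in auto)
      then show ?case using False by (auto simp: sphere_mean_eq_SUP intro!: SUP_least)
    qed
  qed
  then show "\<forall>\<^sub>F n in sequentially. sphere_mean p (\<lambda>z. G z - G (t n *\<^sub>R z)) r < y"
    by eventually_elim (use e in \<open>auto intro: order_le_less_trans\<close>)
qed simp

text \<open>The majorant for dominated convergence comes from \<open>smean_mono\<close>: a dilation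
  has no larger means than \<open>G\<close>. Finiteness of the norm makes
  \<open>sphere_mean p G r\<close> finite for almost every \<open>r\<close>, hence also at
  \<open>1\<close> if there is an atom.\<close>

lemma mixed_norm_diff_dilation:
  fixes G :: "complex^'d::finite \<Rightarrow> complex"
  assumes G: "holomorphic_vec_on G (ball 0 1)" and fin: "mixed_norm \<mu> p q G < \<infinity>" and "0 < \<epsilon>"
  shows "\<exists>t. 0 < t \<and> t < 1 \<and> mixed_norm \<mu> p q (\<lambda>z. G z - G (t *\<^sub>R z)) < ennreal \<epsilon>"
proof -
  have pq: "0 < p" "0 < q" "0 < q / p" using p q by auto
  \<comment> \<open>The double successor makes already \<open>t 0\<close> positive.\<close>
  define t where "t = (\<lambda>n. 1 - inverse (real (Suc (Suc n))))"
  have t: "0 < t n" "t n < 1" for n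
    by (auto simp: t_def field_simps)
  have "(\<lambda>n. inverse (real (Suc n))) \<longlonglongrightarrow> 0" by (rule LIMSEQ_inverse_real_of_nat)
  then have "(\<lambda>n. inverse (real (Suc (Suc n)))) \<longlonglongrightarrow> 0" by (rule LIMSEQ_Suc)
  then have tl: "t \<longlonglongrightarrow> 1" unfolding t_def using tendsto_diff[OF tendsto_const[of 1]] by force
  let ?D = "\<lambda>n z. G z - G (t n *\<^sub>R z)"
  let ?P = "\<lambda>g r. ennreal_powr (sphere_mean p g r) (q / p)"
  have hD: "holomorphic_vec_on (?D n) (ball 0 1)" for n
    using t[of n] by (intro holomorphic_vec_on_diff G holomorphic_vec_on_dilate) auto
  have finJ: "mixed_integral \<mu> p q G < \<infinity>"
    using fin by (cases "mixed_integral \<mu> p q G") (auto simp: mixed_norm_eq)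
  define c where "c = 2 powr p * 2"
  have dom: "?P (?D n) r \<le> ennreal (c powr (q / p)) * ?P G r" if r: "0 \<le> r" for n r
  proof -
    have "smean p (?D n) s \<le> ennreal c * smean p G s + 0 * smean p G s" if s: "0 \<le> s" "s < 1" for s
    proof -
      have "s * t n \<le> s" using s t[of n] by (simp add: mult_left_le)
      then have d: "smean p (\<lambda>z. G (t n *\<^sub>R z)) s \<le> smean p G s"
        unfolding smean_dilate using s t[of n] by (intro smean_mono[OF G p]) auto
      have "smean p (?D n) s \<le> ennreal (2 powr p) * (smean p G s + smean p (\<lambda>z. G (t n *\<^sub>R z)) s)"
        using t[of n] s by (intro smean_diff_le G holomorphic_vec_on_dilate) auto
      also have "\<dots> \<le> ennreal (2 powr p) * (smean p G s + smean p G s)"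
        using d by (intro mult_left_mono add_left_mono) auto
      also have "\<dots> = ennreal c * smean p G s"
        unfolding c_def by (simp add: ennreal_mult mult.assoc flip: mult_2)
      finally show ?thesis by simp
    qed
    from sphere_mean_lin[OF this r] have "?P (?D n) r \<le> ennreal_powr (ennreal c * sphere_mean p G r) (q / p)"
      using pq by (intro ennreal_powr_mono) auto
    also have "\<dots> \<le> ennreal (c powr (q / p)) * ?P G r"
      using pq by (intro ennreal_powr_cmult_le) (auto simp: c_def)
    finally show ?thesis .
  qed
  have PG [measurable]: "?P G \<in> borel_measurable \<mu>" by (rule sphere_mean_powr_measurable[OF G])
  have "(\<lambda>n. mixed_integral \<mu> p q (?D n)) \<longlonglongrightarrow> (\<integral>\<^sup>+r. 0 \<partial>\<mu>)"
    unfolding mixed_integral_def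
  proof (rule nn_integral_dominated_convergence[where w="\<lambda>r. ennreal (c powr (q / p)) * ?P G r"])
    show "?P (?D n) \<in> borel_measurable \<mu>" for n by (rule sphere_mean_powr_measurable[OF hD])
    show "AE r in \<mu>. ?P (?D n) r \<le> ennreal (c powr (q / p)) * ?P G r" for n
      by (rule AE_I2) (use dom in \<open>simp add: space_mu\<close>)
    show "(\<integral>\<^sup>+r. ennreal (c powr (q / p)) * ?P G r \<partial>\<mu>) < \<infinity>"
      using finJ unfolding mixed_integral_def by (simp add: nn_integral_cmult ennreal_mult_less_top)
    have "AE r in \<mu>. ?P G r \<noteq> \<infinity>"
      using finJ unfolding mixed_integral_def by (intro nn_integral_PInf_AE PG) auto
    then show "AE r in \<mu>. (\<lambda>n. ?P (?D n) r) \<longlonglongrightarrow> 0"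
      using AE_space
    proof eventually_elim
      case (elim r)
      have "sphere_mean p G r < \<infinity>" using elim(1) by (cases "sphere_mean p G r") auto
      then show ?case using elim t tl pq
        by (intro ennreal_powr_tendsto_0 sphere_mean_diff_dilations_tendsto G) (auto simp: space_mu)
    qed
  qed auto
  then have "(\<lambda>n. mixed_norm \<mu> p q (?D n)) \<longlonglongrightarrow> 0"
    unfolding mixed_norm_eq using pq by (intro ennreal_powr_tendsto_0) auto
  then have "\<forall>\<^sub>F n in sequentially. mixed_norm \<mu> p q (?D n) < ennreal \<epsilon>"
    using \<open>0 < \<epsilon>\<close> by (intro order_tendstoD(2)) auto
  then obtain n where "mixed_norm \<mu> p q (?D n) < ennreal \<epsilon>"
    using eventually_happens'[OF sequentially_bot] by blast
  then show ?thesis using t[of n] by blast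
qed

end

section \<open>Addition, multiplication and dilation in the Besov norm\<close>

context radial_weight begin

text \<open>The last factor \<open>2\<close> in \<open>K\<close> is the \<open>p\<close>-th root of
  the \<open>2 powr p\<close> in \<open>smean_add_le\<close>. Since \<open>K \<ge> 1\<close>, the
  same constant covers the value at the origin.\<close>

lemma besov_norm_add_le:
  fixes a b :: "complex^'d::finite \<Rightarrow> complex"
  defines "K \<equiv> ennreal (2 powr (1 / p) * 2 powr (1 / q) * 2)"
  assumes a: "holomorphic_vec_on a (ball 0 1)" and b: "holomorphic_vec_on b (ball 0 1)"
  shows "besov_norm \<mu> N p q (\<lambda>z. a z + b z) \<le> K * (besov_norm \<mu> N p q a + besov_norm \<mu> N p q b)"
proof -
  have "1 \<le> 2 powr (1 / p)" "1 \<le> 2 powr (1 / q)" using p q by (auto intro: ge_one_powr_ge_zero)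
  then have "1 * 1 \<le> 2 powr (1 / p) * 2 powr (1 / q)" by (intro mult_mono) auto
  then have K: "1 \<le> K" unfolding K_def by simp
  let ?R = "radial_deriv ^^ N"
  have le: "smean p (?R (\<lambda>z. a z + b z)) s \<le> ennreal (2 powr p) * smean p (?R a) s + ennreal (2 powr p) * smean p (?R b) s"
    if s: "0 \<le> s" "s < 1" for s
  proof -
    have "smean p (?R (\<lambda>z. a z + b z)) s = smean p (\<lambda>z. ?R a z + ?R b z) s"
      by (rule smean_cong) (use s in \<open>auto intro!: radial_deriv_pow_add[OF a b]\<close>)
    also have "\<dots> \<le> ennreal (2 powr p) * (smean p (?R a) s + smean p (?R b) s)"
      using p s by (intro smean_add_le holomorphic_radial_deriv_pow a b) auto
    finally show ?thesis by (simp add: distrib_left)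
  qed
  have "mixed_norm \<mu> p q (?R (\<lambda>z. a z + b z)) \<le> ennreal (2 powr (1 / p) * 2 powr (1 / q)) * (ennreal 2 * mixed_norm \<mu> p q (?R a) + ennreal 2 * mixed_norm \<mu> p q (?R b))"
    by (rule mixed_norm_lin[OF holomorphic_radial_deriv_pow[OF a] holomorphic_radial_deriv_pow[OF b] _ _ le]) auto
  also have "\<dots> = K * (mixed_norm \<mu> p q (?R a) + mixed_norm \<mu> p q (?R b))"
    unfolding K_def by (simp add: ennreal_mult distrib_left mult_ac)
  finally have m: "mixed_norm \<mu> p q (?R (\<lambda>z. a z + b z)) \<le> K * (mixed_norm \<mu> p q (?R a) + mixed_norm \<mu> p q (?R b))" .
  let ?z = "\<lambda>f :: complex^'d \<Rightarrow> complex. if N = 0 then 0 else ennreal (norm (f 0))"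
  have "?z (\<lambda>z. a z + b z) \<le> ?z a + ?z b"
    by (auto simp: norm_triangle_ineq ennreal_leI simp flip: ennreal_plus)
  also have "\<dots> \<le> K * (?z a + ?z b)" using mult_right_mono[OF K, of "?z a + ?z b"] by simp
  finally have "besov_norm \<mu> N p q (\<lambda>z. a z + b z) \<le> K * (?z a + ?z b) + K * (mixed_norm \<mu> p q (?R a) + mixed_norm \<mu> p q (?R b))"
    unfolding besov_norm_def using m by (rule add_mono)
  also have "\<dots> = K * (besov_norm \<mu> N p q a + besov_norm \<mu> N p q b)"
    unfolding besov_norm_def by (simp only: distrib_left add_ac)
  finally show ?thesis .
qed

text \<open>Split \<open>k\<close> into a constant \<open>b\<close> and a remainder. The product
  \<open>b * u\<close> is controlled by the norm of \<open>u\<close>, not by that of a constant; for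
  \<open>N > 0\<close> the remainder vanishes at \<open>0\<close>, as
  \<open>smean_radial_deriv_mult_le\<close> requires.\<close>

lemma besov_norm_mult_le:
  fixes u :: "complex^'d::finite \<Rightarrow> complex"
  assumes u: "holomorphic_vec_on u (ball 0 1)" and fin: "besov_norm \<mu> N p q u < \<infinity>"
    and bdd: "\<And>k. k \<le> N \<Longrightarrow> \<exists>K. \<forall>z\<in>ball 0 1. norm ((radial_deriv ^^ k) u z) \<le> K"
  shows "\<exists>C\<ge>0. \<forall>k. holomorphic_vec_on k (ball 0 1) \<longrightarrow>
    besov_norm \<mu> N p q (\<lambda>z. u z * k z) \<le> ennreal C * besov_norm \<mu> N p q k"
proof -
  let ?R = "radial_deriv ^^ N"
  obtain C0 where C0: "C0 \<ge> 0" "\<And>h s. holomorphic_vec_on h (ball 0 1) \<Longrightarrow> (N > 0 \<Longrightarrow> h 0 = 0) \<Longrightarrow> 0 \<le> s \<Longrightarrow> s < 1 \<Longrightarrow>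
    smean p (?R (\<lambda>z. u z * h z)) s \<le> ennreal C0 * smean p (?R h) s"
    using smean_radial_deriv_mult_le[OF p u bdd] by blast
  \<comment> \<open>Its \<open>p\<close>-th power absorbs both \<open>C0\<close> and the
    \<open>2 powr p\<close> from \<open>smean_add_le\<close>.\<close>
  define c where "c = 2 * C0 powr (1 / p)"
  have c: "0 \<le> c" "c powr p = 2 powr p * C0"
    using C0(1) p by (auto simp: c_def powr_mult powr_powr)
  define K where "K = 2 powr (1 / p) * 2 powr (1 / q)"
  have K: "0 \<le> K" by (simp add: K_def)
  obtain M where M: "mixed_norm \<mu> p q (?R u) = ennreal M" "0 \<le> M"
    using fin by (cases "mixed_norm \<mu> p q (?R u)") (auto simp: besov_norm_def)
  have main: "mixed_norm \<mu> p q (?R (\<lambda>z. u z * k z))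
      \<le> ennreal K * (ennreal (2 * norm b) * mixed_norm \<mu> p q (?R u) + ennreal c * mixed_norm \<mu> p q (?R k))"
    if k: "holomorphic_vec_on k (ball 0 1)" and b: "b = (if N = 0 then 0 else k 0)" for k b
    unfolding K_def
  proof (rule mixed_norm_lin)
    fix s :: real assume s: "0 \<le> s" "s < 1"
    let ?k = "\<lambda>z. k z - b"
    have hk: "holomorphic_vec_on ?k (ball 0 1)" by (intro holomorphic_vec_on_diff holomorphic_vec_on_const k) simp
    have hb: "holomorphic_vec_on (\<lambda>z. b * u z) (ball 0 1)" by (intro holomorphic_vec_on_mult holomorphic_vec_on_const u) simp
    have huk: "holomorphic_vec_on (\<lambda>z. u z * ?k z) (ball 0 1)" by (intro holomorphic_vec_on_mult u hk) simp
    \<comment> \<open>For \<open>N > 0\<close> the operator kills the constant; for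
      \<open>N = 0\<close> the choice \<open>b = 0\<close> leaves \<open>k\<close>
      unchanged.\<close>
    have Rk: "?R ?k z = ?R k z" if z: "z \<in> ball 0 1" for z
    proof (cases N)
      case (Suc n)
      have "?R ?k z = ?R k z - ?R (\<lambda>_. b) z"
        by (rule radial_deriv_pow_diff[OF k holomorphic_vec_on_const z])
      then show ?thesis using radial_deriv_pow_const[of n b z] by (simp only: Suc diff_zero)
    qed (simp add: b)
    have "smean p (?R (\<lambda>z. u z * k z)) s = smean p (\<lambda>z. ?R (\<lambda>z. b * u z) z + ?R (\<lambda>z. u z * ?k z) z) s"
    proof (rule smean_cong)
      fix z :: "complex^'d" assume "norm z = s"
      then have z: "z \<in> ball 0 1" using s by simp
      have "?R (\<lambda>z. u z * k z) z = ?R (\<lambda>z. b * u z + u z * ?k z) z"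
        by (simp add: algebra_simps)
      also have "\<dots> = ?R (\<lambda>z. b * u z) z + ?R (\<lambda>z. u z * ?k z) z"
        by (rule radial_deriv_pow_add[OF hb huk z])
      finally show "?R (\<lambda>z. u z * k z) z = ?R (\<lambda>z. b * u z) z + ?R (\<lambda>z. u z * ?k z) z" .
    qed (use s in simp)
    also have "\<dots> \<le> ennreal (2 powr p) * (smean p (?R (\<lambda>z. b * u z)) s + smean p (?R (\<lambda>z. u z * ?k z)) s)"
      using p s by (intro smean_add_le holomorphic_radial_deriv_pow hb huk) auto
    also have "\<dots> \<le> ennreal (2 powr p) * (ennreal (norm b powr p) * smean p (?R u) s + ennreal C0 * smean p (?R k) s)"
    proof (intro mult_left_mono add_mono)
      show "smean p (?R (\<lambda>z. b * u z)) s \<le> ennreal (norm b powr p) * smean p (?R u) s"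
        using p s by (intro smean_scale holomorphic_radial_deriv_pow u)
          (auto simp: radial_deriv_pow_cmult[OF u] norm_mult)
      have "smean p (?R (\<lambda>z. u z * ?k z)) s \<le> ennreal C0 * smean p (?R ?k) s"
        by (rule C0(2)[OF hk _ s]) (simp add: b)
      also have "smean p (?R ?k) s = smean p (?R k) s" by (rule smean_cong) (use s Rk in auto)
      finally show "smean p (?R (\<lambda>z. u z * ?k z)) s \<le> ennreal C0 * smean p (?R k) s" .
    qed simp
    also have "\<dots> = ennreal ((2 * norm b) powr p) * smean p (?R u) s + ennreal (c powr p) * smean p (?R k) s"
      using C0(1) by (simp add: c(2) powr_mult ennreal_mult distrib_left mult.assoc)
    finally show "smean p (?R (\<lambda>z. u z * k z)) s \<le> ennreal ((2 * norm b) powr p) * smean p (?R u) s + ennreal (c powr p) * smean p (?R k) s" .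
  qed (use c u k in \<open>auto intro: holomorphic_radial_deriv_pow\<close>)
  define C where "C = norm (u 0) + K * 2 * M + K * c"
  have Cn: "0 \<le> C" "norm (u 0) + K * 2 * M \<le> C" "K * c \<le> C"
    using K M(2) c(1) by (auto simp: C_def)
  have "besov_norm \<mu> N p q (\<lambda>z. u z * k z) \<le> ennreal C * besov_norm \<mu> N p q k" if k: "holomorphic_vec_on k (ball 0 1)" for k
  proof -
    define b where "b = (if N = 0 then 0 else k 0)"
    let ?m = "mixed_norm \<mu> p q (?R k)"
    have nb: "(if N = 0 then 0 else ennreal (norm (k 0))) = ennreal (norm b)" by (simp add: b_def)
    have "(if N = 0 then 0 else ennreal (norm (u 0 * k 0))) = ennreal (norm (u 0) * norm b)"
      by (simp add: b_def norm_mult)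
    then have "besov_norm \<mu> N p q (\<lambda>z. u z * k z) = ennreal (norm (u 0) * norm b) + mixed_norm \<mu> p q (?R (\<lambda>z. u z * k z))"
      by (simp add: besov_norm_def)
    also have "\<dots> \<le> ennreal (norm (u 0) * norm b) + ennreal K * (ennreal (2 * norm b) * ennreal M + ennreal c * ?m)"
      unfolding M(1)[symmetric] by (intro add_left_mono main k b_def)
    also have "\<dots> = ennreal ((norm (u 0) + K * 2 * M) * norm b) + ennreal (K * c) * ?m"
      using K M c by (simp add: ennreal_mult ennreal_plus distrib_left distrib_right mult_ac add_ac)
    also have "\<dots> \<le> ennreal (C * norm b) + ennreal C * ?m"
      using Cn by (intro add_mono ennreal_leI mult_right_mono) auto
    also have "\<dots> = ennreal C * besov_norm \<mu> N p q k"
      unfolding besov_norm_def nb using Cn by (simp add: ennreal_mult distrib_left)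
    finally show ?thesis .
  qed
  then show ?thesis using Cn(1) by blast
qed

lemma besov_norm_dilate_finite:
  fixes g :: "complex^'d::finite \<Rightarrow> complex"
  assumes g: "holomorphic_vec_on g (ball 0 1)" and fin: "besov_norm \<mu> N p q g < \<infinity>" and t: "0 \<le> t" "t \<le> 1"
  shows "besov_norm \<mu> N p q (\<lambda>z. g (t *\<^sub>R z)) < \<infinity>"
proof -
  let ?R = "radial_deriv ^^ N"
  have "smean p (?R (\<lambda>z. g (t *\<^sub>R z))) s \<le> ennreal (1 powr p) * smean p (?R g) s + ennreal (0 powr p) * smean p (?R g) s"
    if s: "0 \<le> s" "s < 1" for s
  proof -
    have "smean p (?R (\<lambda>z. g (t *\<^sub>R z))) s = smean p (\<lambda>z. ?R g (t *\<^sub>R z)) s"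
      by (rule smean_cong) (use s radial_deriv_pow_dilate[OF g t] in auto)
    also have "\<dots> = smean p (?R g) (s * t)" by (rule smean_dilate)
    also have "\<dots> \<le> smean p (?R g) s"
      using s t by (intro smean_mono holomorphic_radial_deriv_pow g p) (auto simp: mult_left_le)
    finally show ?thesis by simp
  qed
  then have "mixed_norm \<mu> p q (?R (\<lambda>z. g (t *\<^sub>R z))) \<le> ennreal (2 powr (1 / p) * 2 powr (1 / q)) * (ennreal 1 * mixed_norm \<mu> p q (?R g) + ennreal 0 * mixed_norm \<mu> p q (?R g))"
    by (intro mixed_norm_lin holomorphic_radial_deriv_pow g) auto
  also have "\<dots> < \<infinity>" using fin by (auto simp: besov_norm_def ennreal_mult_less_top split: if_splits)
  finally show ?thesis by (auto simp: besov_norm_def)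
qed

text \<open>Because the radial derivative commutes with dilations, this is
  \<open>mixed_norm_diff_dilation\<close> for the \<open>N\<close>-th radial derivative of
  \<open>g\<close>. The values at the origin cancel.\<close>

lemma besov_norm_diff_dilation:
  fixes g :: "complex^'d::finite \<Rightarrow> complex"
  assumes g: "holomorphic_vec_on g (ball 0 1)" and fin: "besov_norm \<mu> N p q g < \<infinity>" and "0 < \<epsilon>"
  shows "\<exists>t. 0 < t \<and> t < 1 \<and> besov_norm \<mu> N p q (\<lambda>z. g z - g (t *\<^sub>R z)) < ennreal \<epsilon>"
proof -
  let ?R = "radial_deriv ^^ N"
  have finm: "mixed_norm \<mu> p q (?R g) < \<infinity>" using fin by (auto simp: besov_norm_def)
  define \<delta> where "\<delta> = \<epsilon> / (2 powr (1 / p) * 2 powr (1 / q))"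
  have \<delta>: "0 < \<delta>" "2 powr (1 / p) * 2 powr (1 / q) * \<delta> = \<epsilon>" using \<open>0 < \<epsilon>\<close> by (auto simp: \<delta>_def)
  obtain t where t: "0 < t" "t < 1" "mixed_norm \<mu> p q (\<lambda>z. ?R g z - ?R g (t *\<^sub>R z)) < ennreal \<delta>"
    using mixed_norm_diff_dilation[OF holomorphic_radial_deriv_pow[OF g] finm \<delta>(1)] by blast
  have hd: "holomorphic_vec_on (\<lambda>z. g (t *\<^sub>R z)) (ball 0 1)"
    using t by (intro holomorphic_vec_on_dilate g) auto
  have hd': "holomorphic_vec_on (\<lambda>z. ?R g z - ?R g (t *\<^sub>R z)) (ball 0 1)"
    using t by (intro holomorphic_vec_on_diff holomorphic_vec_on_dilate holomorphic_radial_deriv_pow g) auto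
  let ?D = "\<lambda>z. ?R g z - ?R g (t *\<^sub>R z)"
  have eq: "?R (\<lambda>z. g z - g (t *\<^sub>R z)) z = ?D z" if "z \<in> ball 0 1" for z
    using radial_deriv_pow_diff[OF g hd that] radial_deriv_pow_dilate[OF g _ _ that, of t] t by simp
  have "smean p (?R (\<lambda>z. g z - g (t *\<^sub>R z))) s \<le> ennreal (1 powr p) * smean p ?D s + ennreal (0 powr p) * smean p ?D s"
    if s: "0 \<le> s" "s < 1" for s
  proof -
    have "smean p (?R (\<lambda>z. g z - g (t *\<^sub>R z))) s = smean p ?D s"
      by (rule smean_cong) (use s eq in auto)
    then show ?thesis by simp
  qed
  then have "mixed_norm \<mu> p q (?R (\<lambda>z. g z - g (t *\<^sub>R z))) \<le> ennreal (2 powr (1 / p) * 2 powr (1 / q)) * (ennreal 1 * mixed_norm \<mu> p q ?D + ennreal 0 * mixed_norm \<mu> p q ?D)"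
    by (intro mixed_norm_lin hd') auto
  also have "\<dots> = ennreal (2 powr (1 / p) * 2 powr (1 / q)) * mixed_norm \<mu> p q ?D" by simp
  also have "\<dots> < ennreal (2 powr (1 / p) * 2 powr (1 / q)) * ennreal \<delta>"
    using t(3) by (intro ennreal_mult_strict_left_mono) auto
  also have "\<dots> = ennreal \<epsilon>" using \<delta> by (simp flip: ennreal_mult)
  finally show ?thesis using t by (auto simp: besov_norm_def)
qed

text \<open>The radial derivatives of the dilation are those of \<open>g\<close> evaluated in the
  compact ball of radius \<open>t\<close>, hence bounded, which is what
  \<open>besov_norm_mult_le\<close> asks for.\<close>

lemma besov_dilate_multiplier:
  fixes g :: "complex^'d::finite \<Rightarrow> complex"
  assumes g: "g \<in> besov_space \<mu> N p q" and t: "0 \<le> t" "t < 1"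
  shows "\<exists>C\<ge>0. \<forall>k. holomorphic_vec_on k (ball 0 1) \<longrightarrow>
      besov_norm \<mu> N p q (\<lambda>z. g (t *\<^sub>R z) * k z) \<le> ennreal C * besov_norm \<mu> N p q k"
    and "(\<lambda>z. g (t *\<^sub>R z)) \<in> Mult (besov_space \<mu> N p q)"
proof -
  have hg: "holomorphic_vec_on g (ball 0 1)" and fin: "besov_norm \<mu> N p q g < \<infinity>"
    using g by (auto simp: besov_space_def)
  have hd: "holomorphic_vec_on (\<lambda>z. g (t *\<^sub>R z)) (ball 0 1)"
    using t by (intro holomorphic_vec_on_dilate hg) auto
  have bdd: "\<exists>K. \<forall>z\<in>ball 0 1. norm ((radial_deriv ^^ k) (\<lambda>z. g (t *\<^sub>R z)) z) \<le> K" for k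
  proof -
    obtain K where K: "\<And>z. norm z \<le> t \<Longrightarrow> norm ((radial_deriv ^^ k) g z) \<le> K"
      using holomorphic_bounded_cball[OF holomorphic_radial_deriv_pow[OF hg] t(2)] by blast
    have "norm ((radial_deriv ^^ k) (\<lambda>z. g (t *\<^sub>R z)) z) \<le> K" if z: "z \<in> ball 0 1" for z
    proof -
      have "norm (t *\<^sub>R z) \<le> t" using z t by (simp add: mult_left_le)
      then show ?thesis using K radial_deriv_pow_dilate[OF hg t(1) _ z] t by simp
    qed
    then show ?thesis by blast
  qed
  show C: "\<exists>C\<ge>0. \<forall>k. holomorphic_vec_on k (ball 0 1) \<longrightarrow>
      besov_norm \<mu> N p q (\<lambda>z. g (t *\<^sub>R z) * k z) \<le> ennreal C * besov_norm \<mu> N p q k"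
    by (rule besov_norm_mult_le[OF hd besov_norm_dilate_finite[OF hg fin t(1) less_imp_le[OF t(2)]] bdd])
  show "(\<lambda>z. g (t *\<^sub>R z)) \<in> Mult (besov_space \<mu> N p q)"
    unfolding Mult_def
  proof (rule CollectI, rule ballI)
    fix h :: "complex^'d \<Rightarrow> complex" assume "h \<in> besov_space \<mu> N p q"
    then have h: "holomorphic_vec_on h (ball 0 1)" "besov_norm \<mu> N p q h < \<infinity>" by (auto simp: besov_space_def)
    obtain C where "besov_norm \<mu> N p q (\<lambda>z. g (t *\<^sub>R z) * h z) \<le> ennreal C * besov_norm \<mu> N p q h"
      using C h by blast
    also have "\<dots> < \<infinity>" using h by (simp add: ennreal_mult_less_top)
    finally show "(\<lambda>z. g (t *\<^sub>R z) * h z) \<in> besov_space \<mu> N p q"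
      using holomorphic_vec_on_mult[OF hd h(1)] by (simp add: besov_space_def)
  qed
qed

text \<open>For \<open>N = 0\<close> this says that \<open>\<mu>\<close> has finite total mass. The
  mass is finite because the means of \<open>f\<close> are at least
  \<open>norm (f 0) powr p\<close>, their value at radius \<open>0\<close>; here the nonvanishing of
  \<open>f\<close> enters. For \<open>N > 0\<close> the derivatives of the constant vanish.\<close>

lemma one_in_besov_space:
  fixes f :: "complex^'d::finite \<Rightarrow> complex"
  assumes f: "f \<in> besov_space \<mu> N p q" and f0: "f 0 \<noteq> 0"
  shows "(\<lambda>_::complex^'d. 1) \<in> besov_space \<mu> N p q"
proof -
  let ?R = "radial_deriv ^^ N"
  have hf: "holomorphic_vec_on f (ball 0 1)" and fin: "besov_norm \<mu> N p q f < \<infinity>"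
    using f by (auto simp: besov_space_def)
  have finm: "mixed_norm \<mu> p q (?R f) < \<infinity>" using fin by (auto simp: besov_norm_def)
  define a where "a = inverse (norm (f 0))"
  have a: "0 \<le> a" "a powr p * norm (f 0) powr p = 1"
    using f0 by (auto simp: a_def simp flip: powr_mult)
  have "smean p (?R (\<lambda>_::complex^'d. 1)) s \<le> ennreal (a powr p) * smean p (?R f) s + ennreal (0 powr p) * smean p (?R f) s"
    if s: "0 \<le> s" "s < 1" for s
  proof (cases N)
    case 0
    have "smean p (?R (\<lambda>_::complex^'d. 1)) s = 1" using 0 by (simp add: smean_const)
    also have "1 = ennreal (a powr p) * smean p f 0"
      using a by (simp add: smean_def emeasure_sphere_measure_UNIV flip: ennreal_mult)
    also have "\<dots> \<le> ennreal (a powr p) * smean p f s"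
      using s by (intro mult_left_mono smean_mono hf p) auto
    finally show ?thesis using 0 by simp
  next
    case (Suc n)
    have "?R (\<lambda>_::complex^'d. 1) = (\<lambda>_. 0)" unfolding Suc by (rule ext) (rule radial_deriv_pow_const)
    then have "smean p (?R (\<lambda>_::complex^'d. 1)) s = 0" by (simp add: smean_const)
    then show ?thesis by simp
  qed
  then have "mixed_norm \<mu> p q (?R (\<lambda>_::complex^'d. 1)) \<le> ennreal (2 powr (1 / p) * 2 powr (1 / q)) * (ennreal a * mixed_norm \<mu> p q (?R f) + ennreal 0 * mixed_norm \<mu> p q (?R f))"
    by (intro mixed_norm_lin holomorphic_radial_deriv_pow hf a) auto
  also have "\<dots> < \<infinity>" using finm by (simp add: ennreal_mult_less_top)
  finally show ?thesis by (auto simp: besov_space_def besov_norm_def holomorphic_vec_on_const)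
qed

lemma cyclic_in_besov_iff:
  fixes f :: "complex^'d::finite \<Rightarrow> complex"
  assumes f: "f \<in> besov_space \<mu> N p q" and f0: "f 0 \<noteq> 0"
  shows "cyclic_in f (besov_space \<mu> N p q) (besov_norm \<mu> N p q) \<longleftrightarrow>
    (INF \<phi>\<in>Mult (besov_space \<mu> N p q). besov_norm \<mu> N p q (\<lambda>z. 1 - \<phi> z * f z)) = 0"
proof
  let ?X = "besov_space \<mu> N p q :: (complex^'d \<Rightarrow> complex) set" and ?n = "besov_norm \<mu> N p q"
  assume "cyclic_in f ?X ?n"
  then have "(\<lambda>_. 1) \<in> mult_closure ?X ?n f"
    using one_in_besov_space[OF f f0] by (simp add: cyclic_in_def)
  then have ex: "\<exists>\<phi>\<in>Mult ?X. ?n (\<lambda>z. 1 - \<phi> z * f z) < ennreal e" if "e > 0" for e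
    using that by (simp add: mult_closure_def)
  have "(INF \<phi>\<in>Mult ?X. ?n (\<lambda>z. 1 - \<phi> z * f z)) \<le> 0 + ennreal e" if e: "e > 0" for e
  proof -
    obtain \<phi> where "\<phi> \<in> Mult ?X" "?n (\<lambda>z. 1 - \<phi> z * f z) < ennreal e" using ex[OF e] by blast
    then show ?thesis by (intro INF_lower2[of \<phi>]) auto
  qed
  then have "(INF \<phi>\<in>Mult ?X. ?n (\<lambda>z. 1 - \<phi> z * f z)) \<le> 0" by (rule ennreal_le_epsilon)
  then show "(INF \<phi>\<in>Mult ?X. ?n (\<lambda>z. 1 - \<phi> z * f z)) = 0" by simp
next
  let ?X = "besov_space \<mu> N p q :: (complex^'d \<Rightarrow> complex) set" and ?n = "besov_norm \<mu> N p q"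
  assume inf: "(INF \<phi>\<in>Mult ?X. ?n (\<lambda>z. 1 - \<phi> z * f z)) = 0"
  have "g \<in> mult_closure ?X ?n f" if g: "g \<in> ?X" for g
    unfolding mult_closure_def
  proof (rule CollectI, intro conjI allI impI g)
    fix \<epsilon> :: real assume "\<epsilon> > 0"
    have hg: "holomorphic_vec_on g (ball 0 1)" and fin: "?n g < \<infinity>" using g by (auto simp: besov_space_def)
    define K where "K = 2 powr (1 / p) * 2 powr (1 / q) * (2::real)"
    have K: "K > 0" by (simp add: K_def)
    \<comment> \<open>Two contributions \<open>K * \<delta>\<close> make two thirds of
      \<open>\<epsilon>\<close>, which leaves the inequality strict.\<close>
    define \<delta> where "\<delta> = \<epsilon> / (3 * K)"
    have \<delta>: "\<delta> > 0" "K * (\<delta> + \<delta>) < \<epsilon>" using K \<open>\<epsilon> > 0\<close> by (auto simp: \<delta>_def field_simps)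
    obtain t where t: "0 < t" "t < 1" "?n (\<lambda>z. g z - g (t *\<^sub>R z)) < ennreal \<delta>"
      using besov_norm_diff_dilation[OF hg fin \<delta>(1)] by blast
    let ?u = "\<lambda>z. g (t *\<^sub>R z)"
    have u: "?u \<in> Mult ?X" using besov_dilate_multiplier(2)[OF g] t by simp
    obtain C where C: "C \<ge> 0" "\<And>k. holomorphic_vec_on k (ball 0 1) \<Longrightarrow> ?n (\<lambda>z. ?u z * k z) \<le> ennreal C * ?n k"
      using besov_dilate_multiplier(1)[OF g less_imp_le[OF t(1)] t(2)] by blast
    \<comment> \<open>The bound \<open>C\<close> belongs to the dilation fixed above, so
      \<open>\<phi>\<close> is chosen after it; the \<open>+ 1\<close> admits
      \<open>C = 0\<close>.\<close>
    have "0 < ennreal (\<delta> / (C + 1))" using C(1) \<delta>(1) by simp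
    then obtain \<phi> where \<phi>: "\<phi> \<in> Mult ?X" "?n (\<lambda>z. 1 - \<phi> z * f z) < ennreal (\<delta> / (C + 1))"
      unfolding inf[symmetric] INF_less_iff by blast
    have "(\<lambda>z. \<phi> z * f z) \<in> ?X" using \<phi>(1) f by (simp add: Mult_def)
    then have hk: "holomorphic_vec_on (\<lambda>z. 1 - \<phi> z * f z) (ball 0 1)"
      by (intro holomorphic_vec_on_diff holomorphic_vec_on_const) (auto simp: besov_space_def)
    have hu: "holomorphic_vec_on ?u (ball 0 1)" using t by (intro holomorphic_vec_on_dilate hg) auto
    have "?n (\<lambda>z. ?u z * (1 - \<phi> z * f z)) \<le> ennreal C * ennreal (\<delta> / (C + 1))"
      using C(2)[OF hk] \<phi>(2) by (meson less_imp_le mult_left_mono order_trans zero_le)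
    also have "\<dots> \<le> ennreal \<delta>" using C(1) \<delta> by (simp add: ennreal_leI field_simps flip: ennreal_mult)
    finally have 1: "?n (\<lambda>z. ?u z * (1 - \<phi> z * f z)) \<le> ennreal \<delta>" .
    have "(\<lambda>z. g z - (?u z * \<phi> z) * f z) = (\<lambda>z. (g z - ?u z) + ?u z * (1 - \<phi> z * f z))"
      by (simp add: fun_eq_iff algebra_simps)
    then have "?n (\<lambda>z. g z - (?u z * \<phi> z) * f z) = ?n (\<lambda>z. (g z - ?u z) + ?u z * (1 - \<phi> z * f z))"
      by (rule arg_cong)
    also have "\<dots> \<le> ennreal K * (?n (\<lambda>z. g z - ?u z) + ?n (\<lambda>z. ?u z * (1 - \<phi> z * f z)))"
      unfolding K_def
      by (intro besov_norm_add_le holomorphic_vec_on_diff holomorphic_vec_on_mult hg hu hk) auto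
    also have "\<dots> \<le> ennreal K * (ennreal \<delta> + ennreal \<delta>)"
      using t(3) 1 by (intro mult_left_mono add_mono) auto
    also have "\<dots> < ennreal \<epsilon>" using K \<delta> by (simp add: ennreal_less_iff flip: ennreal_plus ennreal_mult)
    finally have 2: "?n (\<lambda>z. g z - (?u z * \<phi> z) * f z) < ennreal \<epsilon>" .
    have "(\<lambda>z. ?u z * \<phi> z) \<in> Mult ?X"
      using u \<phi>(1) unfolding Mult_def by (auto simp: mult.assoc)
    then show "\<exists>\<phi>\<in>Mult ?X. ?n (\<lambda>z. g z - \<phi> z * f z) < ennreal \<epsilon>"
      using 2 by (intro bexI[of _ "\<lambda>z. ?u z * \<phi> z"]) auto
  qed
  then show "cyclic_in f ?X ?n"
    using f unfolding cyclic_in_def mult_closure_def by blast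
qed

end

theorem theorem7p4:
  fixes \<omega> :: "(complex^'d::finite) measure" and \<mu> :: "real measure"
    and p q :: real and N :: nat and f :: "complex^'d \<Rightarrow> complex"
  assumes "admissible_radial_measure \<omega> \<mu>"
    and "1 \<le> p" and "1 \<le> q"
    and "f \<in> besov_space \<mu> N p q"
    and "\<exists>F. continuous_on (cball 0 1) F \<and> (\<forall>z\<in>ball 0 1. F z = f z)"
    and "\<forall>z\<in>ball 0 1. f z \<noteq> 0"
  shows "cyclic_in f (besov_space \<mu> N p q) (besov_norm \<mu> N p q) \<longleftrightarrow>
    (INF \<phi>\<in>Mult (besov_space \<mu> N p q). besov_norm \<mu> N p q (\<lambda>z. 1 - \<phi> z * f z)) = 0"
proof -
  interpret radial_weight \<mu> p q
    using assms by unfold_locales (auto simp: admissible_radial_measure_def)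
  show ?thesis by (rule cyclic_in_besov_iff) (use assms in auto)
qed

end
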